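(* Let $\Omega\subset\mathbb{R}^n$ be a bounded, connected open set with Lipschitz boundary, let $\lambda\in\mathbb{R}$, and for $v\in\mathcal{V}$, $\chi\in\mathcal{X}$ let $$ L(v,\chi)=\int_\Omega \left(\frac12\sum_{i=1,2}k_i|\nabla v_i|^2+\frac12\chi(1-\chi)\,v\cdot Av-\lambda\chi\right)dx . $$ Then there exist $\bar v\in\mathcal{V}$ and $\bar\chi\in\mathcal{X}$ such that $$ L(\bar v,\bar\chi)=\sup_{\chi\in\mathcal{X}}\inf_{v\in\mathcal{V}}L(v,\chi)=\inf_{v\in\mathcal{V}}\sup_{\chi\in\mathcal{X}}L(v,\chi). $$
   Context: The boundary of $\Omega$ is divided into three regions, $\partial\Omega=\partial_1\Omega\cup\partial_2\Omega\cup\partial_0\Omega$, where $\partial_1\Omega$ and $\partial_2\Omega$ have positive surface measure, and $u_1^*,u_2^*\in\mathbb{R}$ are prescribed values. Boundary values are understood in the sense of traces: $$\mathcal{V}=\{v\in H^1(\Omega;\mathbb{R}^2): v_i=u_i^*\text{ on }\partial_i\Omega,\ i=1,2\}.$$ The set $\mathcal{X}=\{\chi\in L^2(\Omega;[0,1])\}$ consists of the functions in $L^2(\Omega)$ with values in $[0,1]$ almost everywhere. The conductivities depend on $\chi$: $$k_1(x)=k_{11}\chi(x)+k_{12}(1-\chi(x)),\qquad k_2(x)=k_{21}\chi(x)+k_{22}(1-\chi(x)),$$ with constants $k_{11},k_{22}>k_{12},k_{21}>0$. Finally $A=k_s\begin{pmatrix}1&-1\\-1&1\end{pmatrix}$ with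 a constant $k_s>0$, so that $v\cdot Av=k_s(v_1-v_2)^2$. *)

theory Defs
  imports "HOL-Analysis.Analysis"
begin

text \<open>
  Elements of function spaces are represented by functions on the whole ambient type. Only their
  values on the domain matter, up to null sets: every integral below is taken over the domain or
  its boundary.
\<close>


section \<open>Lipschitz domains and surface measure\<close>

text \<open>
  Near each boundary point, \<open>\<Omega>\<close> is the strict epigraph, in a direction \<open>e\<close>, of a Lipschitz function
  on the hyperplane orthogonal to \<open>e\<close>; \<open>y - (y \<bullet> e) *\<^sub>R e\<close> is the orthogonal projection of \<open>y\<close>
  onto that hyperplane.
\<close>

definition lipschitz_boundary :: "'a::euclidean_space set \<Rightarrow> bool" where
  "lipschitz_boundary \<Omega> \<longleftrightarrow>
     (\<forall>x\<in>frontier \<Omega>. \<exists>r>0. \<exists>e \<gamma> C. norm e = 1 \<and> C-lipschitz_on {y. y \<bullet> e = 0} \<gamma> \<and>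
        \<Omega> \<inter> ball x r = {y \<in> ball x r. y \<bullet> e > \<gamma> (y - (y \<bullet> e) *\<^sub>R e)})"

text \<open>
  The \<open>s\<close>-dimensional Hausdorff measure, normalised so as to agree with surface measure. The empty
  set is treated separately because \<open>0 ^ 0 = 1\<close>: for \<open>s = 0\<close> (counting measure, the surface measure
  in dimension one) a nonempty set of diameter \<open>0\<close> has to count \<open>1\<close>, and the empty set \<open>0\<close>.
\<close>

definition hausdorff_gauge :: "nat \<Rightarrow> 'a::metric_space set \<Rightarrow> ennreal" where
  "hausdorff_gauge s C =
     (if C = {} then 0 else ennreal (unit_ball_vol (real s) * (diameter C / 2) ^ s))"

definition hausdorff_content :: "nat \<Rightarrow> real \<Rightarrow> 'a::metric_space set \<Rightarrow> ennreal" where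
  "hausdorff_content s \<delta> A =
     (INF C\<in>{C :: nat \<Rightarrow> 'a set. A \<subseteq> (\<Union>i. C i) \<and> (\<forall>i. bounded (C i) \<and> diameter (C i) \<le> \<delta>)}.
        \<Sum>i. hausdorff_gauge s (C i))"

definition hausdorff_outer :: "nat \<Rightarrow> 'a::metric_space set \<Rightarrow> ennreal" where
  "hausdorff_outer s A = (SUP \<delta>\<in>{0<..}. hausdorff_content s \<delta> A)"

text \<open>The measurable sets are those of Caratheodory, among them all Borel sets.\<close>

definition hausdorff_measure :: "nat \<Rightarrow> 'a::metric_space measure" where
  "hausdorff_measure s =
     measure_of UNIV (lambda_system UNIV (Pow UNIV) (hausdorff_outer s)) (hausdorff_outer s)"

definition surface_measure :: "'a::euclidean_space set \<Rightarrow> 'a measure" where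
  "surface_measure \<Omega> = restrict_space (hausdorff_measure (DIM('a) - 1)) (frontier \<Omega>)"


section \<open>The Sobolev space of order one\<close>

definition L2_space :: "'a measure \<Rightarrow> ('a \<Rightarrow> 'b::euclidean_space) set" where
  "L2_space M = {f \<in> borel_measurable M. integrable M (\<lambda>x. (norm (f x))\<^sup>2)}"

definition locally_integrable_on ::
  "'a::euclidean_space set \<Rightarrow> ('a \<Rightarrow> 'b::euclidean_space) \<Rightarrow> bool" where
  "locally_integrable_on \<Omega> f \<longleftrightarrow> (\<forall>K. compact K \<and> K \<subseteq> \<Omega> \<longrightarrow> f absolutely_integrable_on K)"

text \<open>
  The weak gradient is tested against continuously differentiable functions \<open>\<phi>\<close> (with gradient
  \<open>D\<phi>\<close>) of compact support in \<open>\<Omega>\<close>, as in Gilbarg and Trudinger, \<^emph>\<open>Elliptic Partial Differential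
  Equations of Second Order\<close>, Section 7.3. The identity is between vectors.
\<close>

definition has_weak_gradient ::
  "'a::euclidean_space set \<Rightarrow> ('a \<Rightarrow> real) \<Rightarrow> ('a \<Rightarrow> 'a) \<Rightarrow> bool" where
  "has_weak_gradient \<Omega> v G \<longleftrightarrow>
     locally_integrable_on \<Omega> v \<and> locally_integrable_on \<Omega> G \<and>
     (\<forall>\<phi> D\<phi>. (\<forall>x. GDERIV \<phi> x :> D\<phi> x) \<and> continuous_on UNIV D\<phi> \<and>
         compact (closure {x. \<phi> x \<noteq> 0}) \<and> closure {x. \<phi> x \<noteq> 0} \<subseteq> \<Omega> \<longrightarrow>
       (LINT x|lebesgue_on \<Omega>. v x *\<^sub>R D\<phi> x) = - (LINT x|lebesgue_on \<Omega>. \<phi> x *\<^sub>R G x))"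

text \<open>On an open set the weak gradient is determined up to a null set, if it exists.\<close>

definition weak_gradient :: "'a::euclidean_space set \<Rightarrow> ('a \<Rightarrow> real) \<Rightarrow> 'a \<Rightarrow> 'a" where
  "weak_gradient \<Omega> v = (SOME G. has_weak_gradient \<Omega> v G)"

definition H1_space :: "'a::euclidean_space set \<Rightarrow> ('a \<Rightarrow> real) set" where
  "H1_space \<Omega> = {v \<in> L2_space (lebesgue_on \<Omega>).
     \<exists>G. has_weak_gradient \<Omega> v G \<and> G \<in> L2_space (lebesgue_on \<Omega>)}"

text \<open>The square of the norm, meaningful on \<open>H1_space \<Omega>\<close>.\<close>

definition H1_sqnorm :: "'a::euclidean_space set \<Rightarrow> ('a \<Rightarrow> real) \<Rightarrow> ennreal" where
  "H1_sqnorm \<Omega> v =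
     (\<integral>\<^sup>+ x. ennreal ((v x)\<^sup>2 + (norm (weak_gradient \<Omega> v x))\<^sup>2) \<partial>lebesgue_on \<Omega>)"

text \<open>
  \<open>has_trace \<Omega> v g\<close>: the function \<open>g\<close> on the boundary is the trace of \<open>v\<close>. For a bounded Lipschitz
  domain the trace operator is the bounded linear operator from \<open>H\<^sup>1(\<Omega>)\<close> to \<open>L\<^sup>2(\<partial>\<Omega>)\<close> which restricts
  \<open>w\<close> to \<open>\<partial>\<Omega>\<close> whenever \<open>w \<in> H\<^sup>1(\<Omega>)\<close> is continuous on the closure of \<open>\<Omega>\<close>; such \<open>w\<close> are dense, so its
  graph is the closure of the graph of that restriction.
\<close>

definition has_trace :: "'a::euclidean_space set \<Rightarrow> ('a \<Rightarrow> real) \<Rightarrow> ('a \<Rightarrow> real) \<Rightarrow> bool" where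
  "has_trace \<Omega> v g \<longleftrightarrow>
     v \<in> H1_space \<Omega> \<and> g \<in> L2_space (surface_measure \<Omega>) \<and>
     (\<exists>w :: nat \<Rightarrow> 'a \<Rightarrow> real.
        (\<forall>m. w m \<in> H1_space \<Omega> \<and> continuous_on (closure \<Omega>) (w m)) \<and>
        (\<lambda>m. H1_sqnorm \<Omega> (\<lambda>x. w m x - v x)) \<longlonglongrightarrow> 0 \<and>
        (\<lambda>m. \<integral>\<^sup>+ x. ennreal ((w m x - g x)\<^sup>2) \<partial>surface_measure \<Omega>) \<longlonglongrightarrow> 0)"


section \<open>The two-component functional\<close>

text \<open>\<open>\<Gamma> 1\<close>, \<open>\<Gamma> 2\<close> are the parts of the boundary on which the components are prescribed.\<close>

definition admissible_fields ::
  "'a::euclidean_space set \<Rightarrow> (2 \<Rightarrow> 'a set) \<Rightarrow> real^2 \<Rightarrow> ('a \<Rightarrow> real^2) set" where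
  "admissible_fields \<Omega> \<Gamma> u =
     {v. \<forall>i. (\<lambda>x. v x $ i) \<in> H1_space \<Omega> \<and>
        (\<exists>g. has_trace \<Omega> (\<lambda>x. v x $ i) g \<and>
             (AE x in surface_measure \<Omega>. x \<in> \<Gamma> i \<longrightarrow> g x = u $ i))}"

definition admissible_designs :: "'a::euclidean_space set \<Rightarrow> ('a \<Rightarrow> real) set" where
  "admissible_designs \<Omega> =
     {chi \<in> L2_space (lebesgue_on \<Omega>). (AE x in lebesgue_on \<Omega>. 0 \<le> chi x \<and> chi x \<le> 1)}"

text \<open>\<open>k $ i $ j\<close> is the constant \<open>k\<^sub>i\<^sub>j\<close>.\<close>

definition conductivity :: "real^2^2 \<Rightarrow> ('a \<Rightarrow> real) \<Rightarrow> 2 \<Rightarrow> 'a \<Rightarrow> real" where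
  "conductivity k chi i x = k $ i $ 1 * chi x + k $ i $ 2 * (1 - chi x)"

definition coupling_matrix :: "real \<Rightarrow> real^2^2" where
  "coupling_matrix ks = ks *\<^sub>R vector [vector [1, -1], vector [-1, 1]]"

definition lagrangian ::
  "'a::euclidean_space set \<Rightarrow> real^2^2 \<Rightarrow> real \<Rightarrow> real \<Rightarrow> ('a \<Rightarrow> real^2) \<Rightarrow> ('a \<Rightarrow> real) \<Rightarrow> real" where
  "lagrangian \<Omega> k ks lam v chi =
     (LINT x|lebesgue_on \<Omega>.
        1/2 * (\<Sum>i\<in>UNIV. conductivity k chi i x * (norm (weak_gradient \<Omega> (\<lambda>y. v y $ i) x))\<^sup>2)
        + 1/2 * chi x * (1 - chi x) * (v x \<bullet> (coupling_matrix ks *v v x))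
        - lam * chi x)"

end

theory Submission
  imports Defs
begin

text \<open>
  The Lagrangian is convex in \<open>v\<close> and concave in \<open>\<chi>\<close>, and the theorem amounts to the existence of
  a saddle point. Truncating \<open>v\<close> between the two boundary values does not increase the Lagrangian,
  whatever \<open>\<chi>\<close> is. Hence one may restrict to fields bounded by the boundary values, for which the
  \<open>L\<^sup>2\<close> norms of \<open>v\<close> in \<open>\<Omega>\<close> and of its trace on \<open>\<partial>\<Omega>\<close> are bounded at no cost, and a bound on the
  Lagrangian bounds the gradient. The set of triples (field, gradient, trace) obeying these bounds is
  closed and convex in a product of \<open>L\<^sup>2\<close> spaces.

  Weak compactness is replaced by the parallelogram identity: almost minimisers of the norm over a
  decreasing sequence of bounded convex sets form a Cauchy sequence. The saddle point is first found
  for the Lagrangian with an added term \<open>\<epsilon> \<parallel>(v, \<nabla>v, trace v)\<parallel>\<^sup>2\<close>, where strict convexity makes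
  minimisers depend continuously on \<open>\<chi>\<close>, and then \<open>\<epsilon>\<close> tends to zero.

  Truncation in \<open>H\<^sup>1\<close> rests on the fact that difference quotients of \<open>v\<close> converge in \<open>L\<^sup>1\<close> to the
  weak derivative. The Lipschitz condition enters only through the finiteness of the surface measure,
  which makes constant fields admissible and bounds the traces.
\<close>

section \<open>Test functions\<close>

text \<open>The trace \<open>g\<close> is carried as an independent component of a state, next to
  \<open>v\<close> and its gradient. The energy does not see \<open>g\<close>, and no estimate
  bounds it by \<open>v\<close>; hence the added norm contains \<open>g\<close> as well, and limits
  are taken jointly in the three components. Why the added term: let \<open>chi\<close> maximise the
  dual functional, the infimum over the states, and move it towards \<open>xi\<close> by a fraction
  t. A near-minimiser v(t) for the moved design satisfies L(v(t), \<open>xi\<close>) \<le> c + t,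
  where c is the dual value. This becomes half of the saddle inequality at t = 0 if v(t) converges
  to a state that is the same for every \<open>xi\<close>. With \<epsilon> times the squared norm
  added, two states within r of the minimum have squared distance at most 4 r / \<epsilon>, which
  gives this convergence. As \<epsilon> tends to 0 the saddle points themselves are not shown to
  converge. They only show that two nested families of convex sets are non-empty, one of designs and
  one of states, and each family is then treated separately. Payoffs are never taken to a limit in
  both variables at once.\<close>

definition test_function :: "'a::euclidean_space set \<Rightarrow> ('a \<Rightarrow> real) \<Rightarrow> ('a \<Rightarrow> 'a) \<Rightarrow> bool" where
  "test_function \<Omega> \<phi> D\<phi> \<longleftrightarrow> (\<forall>x. GDERIV \<phi> x :> D\<phi> x) \<and> continuous_on UNIV D\<phi> \<and>
     compact (closure {x. \<phi> x \<noteq> 0}) \<and> closure {x. \<phi> x \<noteq> 0} \<subseteq> \<Omega>"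

lemma test_functionI:
  assumes "\<And>x. GDERIV \<phi> x :> D\<phi> x" "continuous_on UNIV D\<phi>" "compact K" "K \<subseteq> \<Omega>"
    and "\<And>x. x \<notin> K \<Longrightarrow> \<phi> x = 0"
  shows "test_function \<Omega> \<phi> D\<phi>"
proof -
  have "closure {x. \<phi> x \<noteq> 0} \<subseteq> K"
    using assms by (intro closure_minimal compact_imp_closed) auto
  then show ?thesis
    using assms compact_Int_closed[OF \<open>compact K\<close> closed_closure, of "{x. \<phi> x \<noteq> 0}"]
    unfolding test_function_def by (auto simp: Int_absorb1)
qed

text \<open>Off its closed support the function is constant on an open set, so the gradient vanishes
  there too; the set \<open>K\<close> obtained serves both \<open>\<phi>\<close> and
  \<open>D\<phi>\<close>.\<close>

lemma test_functionE:
  assumes "test_function \<Omega> \<phi> D\<phi>"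
  obtains K where "compact K" "K \<subseteq> \<Omega>" "\<And>x. x \<notin> K \<Longrightarrow> \<phi> x = 0" "\<And>x. x \<notin> K \<Longrightarrow> D\<phi> x = 0"
proof (rule that[of "closure {x. \<phi> x \<noteq> 0}"])
  show 0: "\<phi> x = 0" if "x \<notin> closure {x. \<phi> x \<noteq> 0}" for x
    using that closure_subset[of "{x. \<phi> x \<noteq> 0}"] by auto
  show "D\<phi> x = 0" if x: "x \<notin> closure {x. \<phi> x \<noteq> 0}" for x
  proof -
    have "GDERIV \<phi> x :> D\<phi> x"
      using assms by (auto simp: test_function_def)
    then have 1: "(\<phi> has_derivative (\<lambda>h. inner h (D\<phi> x))) (at x)"
      by (simp add: gderiv_def)
    have "((\<lambda>_. 0) has_derivative (\<lambda>h. inner h (D\<phi> x))) (at x)"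
    proof (rule has_derivative_transform_within_open[OF 1])
      show "open (- closure {x. \<phi> x \<noteq> 0})" by (intro open_Compl closed_closure)
      show "x \<in> - closure {x. \<phi> x \<noteq> 0}" using x by (simp only: Compl_iff not_False_eq_True)
      show "\<phi> y = 0" if "y \<in> - closure {x. \<phi> x \<noteq> 0}" for y
        by (rule 0) (rule ComplD[OF that])
    qed
    then have "(\<lambda>h. inner h (D\<phi> x)) = (\<lambda>h. 0)"
      by (metis has_derivative_const has_derivative_unique)
    then show ?thesis
      by (metis inner_eq_zero_iff)
  qed
qed (use assms in \<open>auto simp: test_function_def\<close>)

lemma test_function_mono: "test_function U \<phi> D\<phi> \<Longrightarrow> U \<subseteq> V \<Longrightarrow> test_function V \<phi> D\<phi>"
  by (auto simp: test_function_def)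

lemma GDERIV_imp_continuous_on:
  assumes "\<And>x. GDERIV f x :> Df x"
  shows "continuous_on UNIV f"
  using assms unfolding gderiv_def
  by (intro continuous_at_imp_continuous_on) (auto intro: has_derivative_continuous)

lemma test_function_continuous:
  assumes "test_function \<Omega> \<phi> D\<phi>"
  shows "continuous_on UNIV \<phi>" "continuous_on UNIV D\<phi>"
  using assms GDERIV_imp_continuous_on[of \<phi> D\<phi>] by (auto simp: test_function_def)

lemma test_function_bounded:
  assumes "test_function \<Omega> \<phi> D\<phi>"
  obtains B where "B > 0" "\<And>x. \<bar>\<phi> x\<bar> \<le> B" "\<And>x. norm (D\<phi> x) \<le> B"
proof -
  obtain K where K: "compact K" "K \<subseteq> \<Omega>" "\<And>x. x \<notin> K \<Longrightarrow> \<phi> x = 0" "\<And>x. x \<notin> K \<Longrightarrow> D\<phi> x = 0"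
    by (rule test_functionE[OF assms]) (rule that)
  have "bounded (\<phi> ` K)" "bounded (D\<phi> ` K)"
    using test_function_continuous[OF assms] K(1)
    by (auto intro!: compact_imp_bounded compact_continuous_image intro: continuous_on_subset)
  then obtain a b where ab: "\<And>x. x \<in> K \<Longrightarrow> norm (\<phi> x) \<le> a" "\<And>x. x \<in> K \<Longrightarrow> norm (D\<phi> x) \<le> b"
    by (auto simp: bounded_iff)
  have "\<bar>\<phi> x\<bar> \<le> \<bar>a\<bar> + \<bar>b\<bar> + 1" "norm (D\<phi> x) \<le> \<bar>a\<bar> + \<bar>b\<bar> + 1" for x
    using ab[of x] K(3,4)[of x] by (cases "x \<in> K"; force)+
  then show ?thesis
    by (intro that[of "\<bar>a\<bar> + \<bar>b\<bar> + 1"]) auto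
qed

lemma test_function_add:
  assumes "test_function \<Omega> f Df" "test_function \<Omega> g Dg"
  shows "test_function \<Omega> (\<lambda>x. f x + g x) (\<lambda>x. Df x + Dg x)"
proof -
  obtain K where K: "compact K" "K \<subseteq> \<Omega>" "\<And>x. x \<notin> K \<Longrightarrow> f x = 0" "\<And>x. x \<notin> K \<Longrightarrow> Df x = 0"
    by (rule test_functionE[OF assms(1)]) (rule that)
  obtain L where L: "compact L" "L \<subseteq> \<Omega>" "\<And>x. x \<notin> L \<Longrightarrow> g x = 0" "\<And>x. x \<notin> L \<Longrightarrow> Dg x = 0"
    by (rule test_functionE[OF assms(2)]) (rule that)
  show ?thesis
    using K L assms
    by (intro test_functionI[where K="K \<union> L"])
       (auto simp: test_function_def intro!: GDERIV_add continuous_intros)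
qed

lemma test_function_zero: "test_function \<Omega> (\<lambda>_. 0) (\<lambda>_. 0)"
  by (rule test_functionI[where K="{}"]) (auto intro: GDERIV_const)

lemma test_function_sum:
  assumes "\<And>i. i \<in> I \<Longrightarrow> test_function \<Omega> (f i) (Df i)"
  shows "test_function \<Omega> (\<lambda>x. \<Sum>i\<in>I. f i x) (\<lambda>x. \<Sum>i\<in>I. Df i x)"
  using assms
  by (induction I rule: infinite_finite_induct) (auto intro: test_function_zero test_function_add)

lemma test_function_mult:
  assumes "test_function \<Omega> f Df" "\<And>x. GDERIV g x :> Dg x" "continuous_on UNIV Dg"
  shows "test_function \<Omega> (\<lambda>x. f x * g x) (\<lambda>x. f x *\<^sub>R Dg x + g x *\<^sub>R Df x)"
proof -
  obtain K where K: "compact K" "K \<subseteq> \<Omega>" "\<And>x. x \<notin> K \<Longrightarrow> f x = 0" "\<And>x. x \<notin> K \<Longrightarrow> Df x = 0"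
    by (rule test_functionE[OF assms(1)]) (rule that)
  show ?thesis
    using K assms test_function_continuous[OF assms(1)] GDERIV_imp_continuous_on[of g Dg, OF assms(2)]
    by (intro test_functionI[where K=K])
       (auto simp: test_function_def intro!: GDERIV_mult continuous_intros)
qed

text \<open>Differentiability of \<open>F\<close> and continuity of \<open>F'\<close> are only asked
  on the range of \<open>f\<close>: in \<open>test_functions_approximate_sign\<close> the outer
  function has a pole at a negative argument while \<open>f\<close> is non-negative. The condition
  \<open>F 0 = 0\<close> keeps the support compact.\<close>

lemma test_function_compose:
  assumes "test_function \<Omega> f Df" "\<And>x. (F has_real_derivative F' (f x)) (at (f x))"
    "continuous_on (range f) F'" "F 0 = 0"
  shows "test_function \<Omega> (\<lambda>x. F (f x)) (\<lambda>x. F' (f x) *\<^sub>R Df x)"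
proof -
  obtain K where K: "compact K" "K \<subseteq> \<Omega>" "\<And>x. x \<notin> K \<Longrightarrow> f x = 0" "\<And>x. x \<notin> K \<Longrightarrow> Df x = 0"
    by (rule test_functionE[OF assms(1)]) (rule that)
  have "continuous_on UNIV (\<lambda>x. F' (f x))"
    using continuous_on_compose[OF test_function_continuous(1)[OF assms(1)], of F'] assms(3)
    by (simp add: o_def)
  moreover have "GDERIV (\<lambda>x. F (f x)) x :> F' (f x) *\<^sub>R Df x" for x
    using assms by (intro GDERIV_DERIV_compose) (auto simp: test_function_def)
  ultimately show ?thesis
    using K assms(4) test_function_continuous[OF assms(1)]
    by (intro test_functionI[where K=K] continuous_on_scaleR) auto
qed

section \<open>Bump functions and approximation of signs\<close>

lemma has_real_derivative_pos_part_sq: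
  "((\<lambda>s::real. (max 0 s)\<^sup>2) has_real_derivative 2 * max 0 s) (at s)"
proof -
  consider "s > 0" | "s < 0" | "s = 0" by linarith
  then show ?thesis
  proof cases
    case 1
    have "((\<lambda>s::real. s\<^sup>2) has_real_derivative 2 * max 0 s) (at s)"
      using 1 by (auto intro!: derivative_eq_intros)
    then show ?thesis
      by (rule has_field_derivative_transform_within_open[where S="{0<..}"]) (use 1 in auto)
  next
    case 2
    have "((\<lambda>s::real. 0) has_real_derivative 2 * max 0 s) (at s)"
      using 2 by (auto intro!: derivative_eq_intros)
    then show ?thesis
      by (rule has_field_derivative_transform_within_open[where S="{..<0}"]) (use 2 in auto)
  next
    case 3
    have "((\<lambda>h::real. (max 0 h)\<^sup>2 / h) \<longlongrightarrow> 0) (at 0)"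
    proof (rule Lim_null_comparison)
      show "\<forall>\<^sub>F h::real in at 0. norm ((max 0 h)\<^sup>2 / h) \<le> \<bar>h\<bar>"
        by (auto simp: power2_eq_square max_def eventually_at_filter)
      show "((\<lambda>h::real. \<bar>h\<bar>) \<longlongrightarrow> 0) (at 0)"
        by (auto intro!: tendsto_eq_intros)
    qed
    then show ?thesis
      using 3 by (simp add: DERIV_def)
  qed
qed

text \<open>Squaring the positive part of \<open>q\<close>, the function r^2 - |x - c|^2, already
  gives a continuously differentiable bump. Test functions are only asked to be of class C^1, so no
  exponential is involved.\<close>

lemma test_function_ball:
  assumes "r > 0" "cball c r \<subseteq> \<Omega>"
  obtains \<phi> D\<phi> where "test_function \<Omega> \<phi> D\<phi>" "\<And>x. \<phi> x \<ge> 0" "\<And>x. x \<in> ball c r \<Longrightarrow> \<phi> x > 0"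
proof -
  define q where "q x = r\<^sup>2 - inner (x - c) (x - c)" for x
  have q: "GDERIV q x :> -2 *\<^sub>R (x - c)" for x
    unfolding q_def gderiv_def
    by (auto intro!: derivative_eq_intros simp: inner_commute algebra_simps)
  have qneg: "q x > 0 \<longleftrightarrow> dist c x < r" for x
    using assms(1) by (auto simp: q_def power2_norm_eq_inner[symmetric] dist_norm norm_minus_commute
       abs_le_square_iff[symmetric] not_less intro: power_strict_mono dest: power2_less_imp_less)
  let ?f = "\<lambda>x. (max 0 (q x))\<^sup>2"
  have "test_function \<Omega> ?f (\<lambda>x. (2 * max 0 (q x)) *\<^sub>R (-2 *\<^sub>R (x - c)))"
  proof (rule test_functionI[where K="cball c r"])
    show "GDERIV ?f x :> (2 * max 0 (q x)) *\<^sub>R (-2 *\<^sub>R (x - c))" for x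
      by (rule GDERIV_DERIV_compose[OF q has_real_derivative_pos_part_sq])
    show "continuous_on UNIV (\<lambda>x. (2 * max 0 (q x)) *\<^sub>R (-2 *\<^sub>R (x - c)))"
      unfolding q_def by (intro continuous_intros)
    show "(max 0 (q x))\<^sup>2 = 0" if "x \<notin> cball c r" for x
      using qneg[of x] that by (auto simp: max_def)
  qed (use assms in auto)
  then show ?thesis
    by (rule that) (use qneg[THEN iffD2] in \<open>fastforce+\<close>)
qed

text \<open>Finitely many balls inside \<open>\<Omega>\<close> cover \<open>K\<close>; the sum of
  their bumps is positive wherever one of them is.\<close>

lemma test_function_positive_on_compact:
  assumes "compact K" "K \<subseteq> \<Omega>" "open \<Omega>"
  obtains \<phi> D\<phi> where "test_function \<Omega> \<phi> D\<phi>" "\<And>x. \<phi> x \<ge> 0" "\<And>x. x \<in> K \<Longrightarrow> \<phi> x > 0"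
proof -
  have "\<forall>c\<in>K. \<exists>r>0. cball c r \<subseteq> \<Omega>"
    using assms open_contains_cball by blast
  then obtain r where r: "\<And>c. c \<in> K \<Longrightarrow> r c > 0" "\<And>c. c \<in> K \<Longrightarrow> cball c (r c) \<subseteq> \<Omega>"
    by metis
  have "\<forall>c\<in>K. \<exists>\<phi> D\<phi>. test_function \<Omega> \<phi> D\<phi> \<and> (\<forall>x. \<phi> x \<ge> 0) \<and> (\<forall>x\<in>ball c (r c). \<phi> x > 0)"
    using test_function_ball[OF r] by (metis (no_types, lifting))
  then obtain f Df where f: "\<And>c. c \<in> K \<Longrightarrow> test_function \<Omega> (f c) (Df c)"
    "\<And>c x. c \<in> K \<Longrightarrow> f c x \<ge> 0" "\<And>c x. c \<in> K \<Longrightarrow> x \<in> ball c (r c) \<Longrightarrow> f c x > 0"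
    by metis
  obtain C where C: "C \<subseteq> K" "finite C" "K \<subseteq> (\<Union>c\<in>C. ball c (r c))"
  proof (rule compactE_image[OF \<open>compact K\<close>, of K "\<lambda>c. ball c (r c)"])
    show "K \<subseteq> (\<Union>c\<in>K. ball c (r c))"
      using r(1) by force
  qed auto
  show ?thesis
  proof (rule that)
    show "test_function \<Omega> (\<lambda>x. \<Sum>c\<in>C. f c x) (\<lambda>x. \<Sum>c\<in>C. Df c x)"
      using C f by (intro test_function_sum) auto
    show "(\<Sum>c\<in>C. f c x) \<ge> 0" for x
      using C f by (intro sum_nonneg) auto
    show "(\<Sum>c\<in>C. f c x) > 0" if x: "x \<in> K" for x
    proof -
      obtain c where "c \<in> C" "x \<in> ball c (r c)" using C(3) x by blast
      then show ?thesis
        using C f by (intro sum_pos2[of C c]) auto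
    qed
  qed
qed

lemma real_polynomial_function_GDERIV:
  fixes p :: "'a::euclidean_space \<Rightarrow> real"
  assumes "real_polynomial_function p"
  shows "\<exists>Dp. (\<forall>x. GDERIV p x :> Dp x) \<and> continuous_on UNIV Dp"
  using assms
proof (induction rule: real_polynomial_function.induct)
  case (linear f)
  then interpret bounded_linear f .
  note bl = bounded_linear_axioms
  have repr: "f h = inner h (\<Sum>b\<in>Basis. f b *\<^sub>R b)" for h
  proof -
    have "f h = f (\<Sum>b\<in>Basis. inner h b *\<^sub>R b)"
      by (simp add: euclidean_representation)
    also have "\<dots> = (\<Sum>b\<in>Basis. inner h b * f b)"
      by (simp add: sum scaleR)
    finally show ?thesis
      by (simp add: inner_sum_right mult.commute)
  qed
  have "(\<lambda>h. inner h (\<Sum>b\<in>Basis. f b *\<^sub>R b)) = f"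
    by (intro ext) (rule repr[symmetric])
  then have "GDERIV f x :> (\<Sum>b\<in>Basis. f b *\<^sub>R b)" for x
    using bounded_linear_imp_has_derivative[OF bl] by (simp add: gderiv_def)
  then show ?case
    by (intro exI[of _ "\<lambda>_. \<Sum>b\<in>Basis. f b *\<^sub>R b"]) auto
next
  case (const c)
  then show ?case by (intro exI[of _ "\<lambda>_. 0"]) (auto intro: GDERIV_const)
next
  case (add f g)
  then obtain Df Dg where "\<And>x. GDERIV f x :> Df x" "continuous_on UNIV Df"
    "\<And>x. GDERIV g x :> Dg x" "continuous_on UNIV Dg"
    by blast
  then show ?case
    by (intro exI[of _ "\<lambda>x. Df x + Dg x"]) (auto intro!: GDERIV_add continuous_intros)
next
  case (mult f g)
  then obtain Df Dg where *: "\<And>x. GDERIV f x :> Df x" "continuous_on UNIV Df"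
    "\<And>x. GDERIV g x :> Dg x" "continuous_on UNIV Dg"
    by blast
  then have "continuous_on UNIV f" "continuous_on UNIV g"
    using GDERIV_imp_continuous_on by blast+
  with * show ?case
    by (intro exI[of _ "\<lambda>x. f x *\<^sub>R Dg x + g x *\<^sub>R Df x"]) (auto intro!: GDERIV_mult continuous_intros)
qed

text \<open>The map \<open>s \<mapsto> 2 s / (1 + s\<^sup>2)\<close> fixes \<open>-1, 0, 1\<close> and has values in \<open>[-1, 1]\<close>: it makes polynomial
  approximations of a function with these three values bounded.\<close>

lemma test_functions_approximate_sign:
  fixes s :: "'a::euclidean_space \<Rightarrow> real"
  assumes s: "s \<in> borel_measurable lebesgue" "\<And>x. s x \<in> {-1, 0, 1}"
    and K: "compact K" "K \<subseteq> \<Omega>" "open \<Omega>" "\<And>x. x \<notin> K \<Longrightarrow> s x = 0"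
  obtains \<phi> D\<phi> where "\<And>n. test_function \<Omega> (\<phi> n) (D\<phi> n)" "\<And>n x. \<bar>\<phi> n x\<bar> \<le> 1"
    "AE x in lebesgue. (\<lambda>n. \<phi> n x) \<longlonglongrightarrow> s x"
proof -
  define S where "S t = 2 * t / (1 + t\<^sup>2)" for t :: real
  define S' where "S' t = 2 * (1 - t\<^sup>2) / (1 + t\<^sup>2)\<^sup>2" for t :: real
  have pos: "1 + t\<^sup>2 > 0" for t :: real
    by (simp add: add_pos_nonneg)
  then have nz: "1 + t\<^sup>2 \<noteq> 0" for t :: real
    by (metis less_irrefl)
  have S_deriv: "(S has_real_derivative S' t) (at t)" for t
    unfolding S_def S'_def using nz[of t]
    by (auto intro!: derivative_eq_intros simp: field_simps power2_eq_square)
  have S_bound: "\<bar>S t\<bar> \<le> 1" for t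
  proof -
    have "2 * \<bar>t\<bar> \<le> 1 + t\<^sup>2"
      using zero_le_power2[of "1 - \<bar>t\<bar>"] by (simp add: power2_diff algebra_simps)
    then show ?thesis
      using pos[of t] by (simp add: S_def abs_mult)
  qed
  have S_fix: "S (s x) = s x" for x
    using s(2)[of x] by (auto simp: S_def)
  have S'_cont: "continuous_on T S'" for T
    unfolding S'_def using nz by (auto intro!: continuous_intros)
  have S_cont: "isCont S t" for t
    using S_deriv DERIV_isCont by blast
  obtain \<sigma> D\<sigma> where \<sigma>: "test_function \<Omega> \<sigma> D\<sigma>" "\<And>x. \<sigma> x \<ge> 0" "\<And>x. x \<in> K \<Longrightarrow> \<sigma> x > 0"
    by (rule test_function_positive_on_compact[OF K(1-3)]) (rule that)
  obtain L where L: "compact L" "L \<subseteq> \<Omega>" "\<And>x. x \<notin> L \<Longrightarrow> \<sigma> x = 0" "\<And>x. x \<notin> L \<Longrightarrow> D\<sigma> x = 0"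
    by (rule test_functionE[OF \<sigma>(1)]) (rule that)
  \<comment> \<open>A cut-off built from \<sigma>: it vanishes where \<sigma> does and tends to 1
    where \<sigma> is positive, in particular on \<open>K\<close>. Off \<open>K\<close> its limit is
    harmless, since \<open>s\<close> is 0 there.\<close>
  define \<tau> where "\<tau> n x = real n * \<sigma> x / (1 + real n * \<sigma> x)" for n x
  have \<tau>_bound: "0 \<le> \<tau> n x" "\<tau> n x \<le> 1" for n x
    using \<sigma>(2)[of x] by (auto simp: \<tau>_def intro!: divide_nonneg_nonneg divide_le_eq_1_pos[THEN iffD2] add_pos_nonneg)
  have \<tau>_test: "\<exists>D. test_function \<Omega> (\<tau> n) D" for n
  proof -
    have nz: "1 + real n * \<sigma> x \<noteq> 0" for x
      using \<sigma>(2)[of x] by (metis add_pos_nonneg mult_nonneg_nonneg of_nat_0_le_iff order_less_irrefl zero_less_one)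
    show ?thesis
      unfolding \<tau>_def
      apply (rule exI)
      apply (rule test_function_compose[OF \<sigma>(1), where F="\<lambda>t. real n * t / (1 + real n * t)"
          and F'="\<lambda>t. real n / (1 + real n * t)\<^sup>2"])
      using nz
         apply (auto intro!: derivative_eq_intros continuous_intros)
      apply (simp add: power2_eq_square algebra_simps)
      done
  qed
  then obtain D\<tau> where D\<tau>: "\<And>n. test_function \<Omega> (\<tau> n) (D\<tau> n)" by metis
  \<comment> \<open>A measurable function is the limit, off a negligible set, of continuous
    functions. These are replaced by polynomials on the compact set \<open>L\<close>, outside which
    the cut-off is 0.\<close>
  have "s measurable_on UNIV"
    using s(1) lebesgue_measurable_imp_measurable_on[of s UNIV] by simp
  then obtain N g where N: "negligible N" "\<And>n. continuous_on UNIV (g n)"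
    "\<And>x. x \<notin> N \<Longrightarrow> (\<lambda>n. g n x) \<longlonglongrightarrow> s x"
    unfolding measurable_on_def by auto
  have "\<exists>p. real_polynomial_function p \<and> (\<forall>x\<in>L. \<bar>g n x - p x\<bar> < 1 / real (Suc n))" for n
    using Stone_Weierstrass_real_polynomial_function[OF L(1), of "g n" "1 / real (Suc n)"] N(2)
      continuous_on_subset by (metis divide_pos_pos of_nat_0_less_iff subset_UNIV zero_less_Suc zero_less_one)
  then obtain p where p: "\<And>n. real_polynomial_function (p n)"
    "\<And>n x. x \<in> L \<Longrightarrow> \<bar>g n x - p n x\<bar> < 1 / real (Suc n)"
    by metis
  obtain Dp where Dp: "\<And>n x. GDERIV (p n) x :> Dp n x" "\<And>n. continuous_on UNIV (Dp n)"
    using real_polynomial_function_GDERIV[OF p(1)] by metis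
  define \<phi> where "\<phi> n x = \<tau> n x * S (p n x)" for n x
  have test: "\<exists>D. test_function \<Omega> (\<phi> n) D" for n
    unfolding \<phi>_def
  proof (rule exI, rule test_function_mult[OF D\<tau>])
    show "GDERIV (\<lambda>x. S (p n x)) x :> S' (p n x) *\<^sub>R Dp n x" for x
      by (rule GDERIV_DERIV_compose[OF Dp(1) S_deriv])
    show "continuous_on UNIV (\<lambda>x. S' (p n x) *\<^sub>R Dp n x)"
      using continuous_on_compose[OF GDERIV_imp_continuous_on[OF Dp(1)] S'_cont]
      by (intro continuous_intros Dp(2)) (simp add: o_def)
  qed
  have bound: "\<bar>\<phi> n x\<bar> \<le> 1" for n x
    using \<tau>_bound[of n x] S_bound[of "p n x"]
    by (auto simp: \<phi>_def abs_mult intro!: mult_le_one)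
  have lim: "(\<lambda>n. \<phi> n x) \<longlonglongrightarrow> s x" if "x \<notin> N" for x
  proof (cases "\<sigma> x = 0")
    case True
    then have "x \<notin> K" using \<sigma>(3) by fastforce
    then show ?thesis using True K(4) by (simp add: \<phi>_def \<tau>_def)
  next
    case False
    then have pos: "\<sigma> x > 0" using \<sigma>(2)[of x] by linarith
    have "x \<in> L" using False L(3) by blast
    have "(\<lambda>n. p n x - g n x) \<longlonglongrightarrow> 0"
    proof (rule Lim_null_comparison)
      show "\<forall>\<^sub>F n in sequentially. norm (p n x - g n x) \<le> 1 / real (Suc n)"
        using p(2)[OF \<open>x \<in> L\<close>] by (auto simp: abs_minus_commute less_imp_le)
      show "(\<lambda>n. 1 / real (Suc n)) \<longlonglongrightarrow> 0"
        using LIMSEQ_inverse_real_of_nat by (simp add: inverse_eq_divide)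
    qed
    from tendsto_add[OF this N(3)[OF that]] have "(\<lambda>n. p n x) \<longlonglongrightarrow> s x" by simp
    then have 1: "(\<lambda>n. S (p n x)) \<longlonglongrightarrow> s x"
      using isCont_tendsto_compose[OF S_cont] S_fix by metis
    have "(\<lambda>n. inverse (1 + real n * \<sigma> x)) \<longlonglongrightarrow> 0"
      by (intro tendsto_inverse_0_at_top filterlim_tendsto_add_at_top[OF tendsto_const]
            filterlim_at_top_mult_tendsto_pos[OF tendsto_const pos] filterlim_real_sequentially)
    then have "(\<lambda>n. 1 - inverse (1 + real n * \<sigma> x)) \<longlonglongrightarrow> 1 - 0"
      by (intro tendsto_intros)
    moreover have "1 - inverse (1 + real n * \<sigma> x) = \<tau> n x" for n
      using pos by (simp add: \<tau>_def field_simps add_pos_nonneg less_imp_neq[symmetric])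
    ultimately have 2: "(\<lambda>n. \<tau> n x) \<longlonglongrightarrow> 1" by simp
    show ?thesis using tendsto_mult[OF 2 1] by (simp add: \<phi>_def)
  qed
  have "AE x in lebesgue. (\<lambda>n. \<phi> n x) \<longlonglongrightarrow> s x"
    using lim N(1) by (intro AE_I'[of N]) (auto simp: negligible_iff_null_sets)
  moreover obtain D\<phi> where "\<And>n. test_function \<Omega> (\<phi> n) (D\<phi> n)" using test by metis
  ultimately show ?thesis using bound that by metis
qed

section \<open>Translations in L^1 and duality with test functions\<close>

lemma distr_lebesgue_translation:
  fixes c :: "'a::euclidean_space"
  shows "distr lebesgue lebesgue (\<lambda>x. x + c) = lebesgue"
proof -
  have "(\<lambda>x::'a. c + (\<Sum>j\<in>Basis. (1 * (x \<bullet> j)) *\<^sub>R j)) = (\<lambda>x. x + c)"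
    by (simp add: euclidean_representation add.commute)
  then show ?thesis
    using lebesgue_affine_euclidean[of "\<lambda>_. 1" c] by (simp add: density_1)
qed

lemma measurable_lebesgue_translation:
  fixes c :: "'a::euclidean_space"
  shows "(\<lambda>x. x + c) \<in> lebesgue \<rightarrow>\<^sub>M lebesgue"
proof -
  have "(\<lambda>x::'a. c + (\<Sum>j\<in>Basis. (1 * (x \<bullet> j)) *\<^sub>R j)) = (\<lambda>x. x + c)"
    by (simp add: euclidean_representation add.commute)
  then show ?thesis
    using lebesgue_affine_measurable[of "\<lambda>_. 1" c] by simp
qed

lemma integrable_lebesgue_translation:
  fixes f :: "'a::euclidean_space \<Rightarrow> 'b::{banach, second_countable_topology}"
  assumes "integrable lebesgue f"
  shows "integrable lebesgue (\<lambda>x. f (x + c))"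
  using assms integrable_distr[OF measurable_lebesgue_translation[of c], of f]
  by (simp add: distr_lebesgue_translation)

lemma integral_lebesgue_translation:
  fixes f :: "'a::euclidean_space \<Rightarrow> 'b::{banach, second_countable_topology}"
  assumes "f \<in> borel_measurable lebesgue"
  shows "(\<integral>x. f (x + c) \<partial>lebesgue) = (\<integral>x. f x \<partial>lebesgue)"
  using integral_distr[OF measurable_lebesgue_translation[of c] assms]
  by (simp add: distr_lebesgue_translation)

lemma continuous_on_imp_borel_measurable_lebesgue:
  fixes f :: "'a::euclidean_space \<Rightarrow> 'b::euclidean_space"
  assumes "continuous_on UNIV f"
  shows "f \<in> borel_measurable lebesgue"
  using borel_measurable_continuous_onI[OF assms] by (simp add: measurable_completion)

lemma AE_lebesgue_on_iff:
  assumes "S \<in> sets lebesgue"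
  shows "(AE x in lebesgue_on S. P x) \<longleftrightarrow> (AE x in lebesgue. x \<in> S \<longrightarrow> P x)"
  using AE_restrict_space_iff[of S lebesgue P] assms by simp

lemma integrable_indicator_cball: "integrable lebesgue (indicat_real (cball (x::'a::euclidean_space) r))"
  using lmeasurable_cball[of x r] by (simp add: fmeasurable_def)

text \<open>Density of compactly supported continuous functions in L^1. The continuous functions
  that converge to \<open>f\<close> almost everywhere come with no integrable bound, so the same
  truncations \<open>cut R\<close> and \<open>clip R\<close> are applied to them and to
  \<open>f\<close>: on both sides the result is bounded by \<open>R\<close> on the ball of radius
  \<open>R\<close>. The one number \<open>R\<close> thus bounds support and values.\<close>

lemma integrable_continuous_approx:
  fixes f :: "'a::euclidean_space \<Rightarrow> real"
  assumes f: "integrable lebesgue f" and "e > 0"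
  obtains g R where "continuous_on UNIV g" "\<And>x. norm x > R \<Longrightarrow> g x = 0" "\<And>x. \<bar>g x\<bar> \<le> R"
    "integrable lebesgue g" "(\<integral>x. \<bar>f x - g x\<bar> \<partial>lebesgue) < e"
proof -
  define clip where "clip R t = max (-R) (min R t)" for R t :: real
  define cut where "cut R x = max 0 (min 1 (R - norm x))" for R :: real and x :: 'a
  have [measurable]: "f \<in> borel_measurable lebesgue"
    using f by auto
  have cut_cont: "continuous_on UNIV (cut R)" for R
    unfolding cut_def by (intro continuous_intros)
  have [measurable]: "cut R \<in> borel_measurable lebesgue" for R
    by (rule continuous_on_imp_borel_measurable_lebesgue[OF cut_cont])
  have [measurable]: "clip R \<in> borel_measurable borel" for R
    unfolding clip_def by measurable
  have clip_cont: "isCont (clip R) t" for R t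
    unfolding clip_def by (intro continuous_intros)
  have clip_abs: "\<bar>clip R t\<bar> \<le> R" if "R \<ge> 0" for R t
    using that by (auto simp: clip_def)
  have clip_le: "\<bar>clip R t\<bar> \<le> \<bar>t\<bar>" if "R \<ge> 0" for R t
    using that by (auto simp: clip_def)
  have cut01: "0 \<le> cut R x" "cut R x \<le> 1" for R x
    by (auto simp: cut_def)
  have "(\<lambda>n. \<integral>x. \<bar>f x - cut (real n) x * clip (real n) (f x)\<bar> \<partial>lebesgue) \<longlonglongrightarrow> integral\<^sup>L lebesgue (\<lambda>x::'a. 0::real)"
  proof (rule integral_dominated_convergence[where w="\<lambda>x. 2 * \<bar>f x\<bar>"])
    show "AE x in lebesgue. (\<lambda>n. \<bar>f x - cut (real n) x * clip (real n) (f x)\<bar>) \<longlonglongrightarrow> 0"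
    proof (rule AE_I2)
      fix x
      obtain N :: nat where N: "real N \<ge> norm x + 1 + \<bar>f x\<bar>"
        using real_arch_simple by blast
      show "(\<lambda>n. \<bar>f x - cut (real n) x * clip (real n) (f x)\<bar>) \<longlonglongrightarrow> 0"
      proof (rule tendsto_eventually)
        show "\<forall>\<^sub>F n in sequentially. \<bar>f x - cut (real n) x * clip (real n) (f x)\<bar> = 0"
          using eventually_ge_at_top[of N]
        proof eventually_elim
          case (elim n)
          then have *: "real n \<ge> norm x + 1 + \<bar>f x\<bar>" using N by linarith
          then have "real n \<ge> \<bar>f x\<bar>" using norm_ge_zero[of x] by linarith
          with * have "cut (real n) x = 1" "clip (real n) (f x) = f x"
            using norm_ge_zero[of x] by (auto simp: cut_def clip_def abs_le_iff)
          then show ?case by simp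
        qed
      qed
    qed
    show "AE x in lebesgue. norm \<bar>f x - cut (real n) x * clip (real n) (f x)\<bar> \<le> 2 * \<bar>f x\<bar>" for n
    proof (rule AE_I2)
      fix x
      have "\<bar>cut (real n) x * clip (real n) (f x)\<bar> \<le> 1 * \<bar>f x\<bar>"
        unfolding abs_mult using cut01[of "real n" x] clip_le[of "real n" "f x"]
        by (intro mult_mono) auto
      then show "norm \<bar>f x - cut (real n) x * clip (real n) (f x)\<bar> \<le> 2 * \<bar>f x\<bar>"
        by simp
    qed
  qed (use f in auto)
  then have "\<forall>\<^sub>F n in sequentially. (\<integral>x. \<bar>f x - cut (real n) x * clip (real n) (f x)\<bar> \<partial>lebesgue) < e / 2"
    using \<open>e > 0\<close> by (intro order_tendstoD(2)[where y=0]) auto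
  then obtain n where n: "(\<integral>x. \<bar>f x - cut (real n) x * clip (real n) (f x)\<bar> \<partial>lebesgue) < e / 2"
    by (auto dest: eventually_happens)
  define R where "R = real n"
  have R: "R \<ge> 0" by (simp add: R_def)
  have cut0: "cut R x = 0" if "norm x > R" for x
    using that by (simp add: cut_def)
  have "f measurable_on UNIV"
    using lebesgue_measurable_imp_measurable_on[of f UNIV] by simp
  then obtain N g where N: "negligible N" "\<And>n. continuous_on UNIV (g n)"
    "\<And>x. x \<notin> N \<Longrightarrow> (\<lambda>n. g n x) \<longlonglongrightarrow> f x"
    unfolding measurable_on_def by auto
  have [measurable]: "g m \<in> borel_measurable lebesgue" for m
    by (rule continuous_on_imp_borel_measurable_lebesgue[OF N(2)])
  have ball: "integrable lebesgue (\<lambda>x. R * indicator (cball 0 R) x :: real)"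
    using integrable_indicator_cball by (intro integrable_mult_right)
  have dom: "\<bar>cut R x * clip R t\<bar> \<le> R * indicator (cball 0 R) x" for x t
  proof (cases "norm x > R")
    case False
    then show ?thesis
      using cut01[of R x] clip_abs[OF R, of t] mult_mono[of "cut R x" 1 "\<bar>clip R t\<bar>" R]
      by (simp add: abs_mult)
  qed (simp add: cut0)
  have int_f: "integrable lebesgue (\<lambda>x. cut R x * clip R (f x))"
    by (rule Bochner_Integration.integrable_bound[OF ball]) (auto intro!: AE_I2 order_trans[OF dom])
  have int_g: "integrable lebesgue (\<lambda>x. cut R x * clip R (g m x))" for m
    by (rule Bochner_Integration.integrable_bound[OF ball]) (auto intro!: AE_I2 order_trans[OF dom])
  have "(\<lambda>m. \<integral>x. \<bar>cut R x * clip R (f x) - cut R x * clip R (g m x)\<bar> \<partial>lebesgue) \<longlonglongrightarrow> integral\<^sup>L lebesgue (\<lambda>x::'a. 0::real)"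
  proof (rule integral_dominated_convergence[where w="\<lambda>x. 2 * (R * indicator (cball 0 R) x)"])
    show "AE x in lebesgue. (\<lambda>m. \<bar>cut R x * clip R (f x) - cut R x * clip R (g m x)\<bar>) \<longlonglongrightarrow> 0"
    proof (rule AE_I'[of N])
      have "(\<lambda>m. \<bar>cut R x * clip R (f x) - cut R x * clip R (g m x)\<bar>) \<longlonglongrightarrow> 0" if "x \<notin> N" for x
      proof -
        have "(\<lambda>m. clip R (g m x)) \<longlonglongrightarrow> clip R (f x)"
          by (rule isCont_tendsto_compose[OF clip_cont N(3)[OF that]])
        then have "(\<lambda>m. \<bar>cut R x * clip R (f x) - cut R x * clip R (g m x)\<bar>)
            \<longlonglongrightarrow> \<bar>cut R x * clip R (f x) - cut R x * clip R (f x)\<bar>"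
          by (intro tendsto_intros)
        then show ?thesis by simp
      qed
      then show "{x \<in> space lebesgue. \<not> (\<lambda>m. \<bar>cut R x * clip R (f x) - cut R x * clip R (g m x)\<bar>) \<longlonglongrightarrow> 0} \<subseteq> N"
        by blast
    qed (use N(1) in \<open>simp add: negligible_iff_null_sets\<close>)
    show "AE x in lebesgue. norm \<bar>cut R x * clip R (f x) - cut R x * clip R (g m x)\<bar>
        \<le> 2 * (R * indicator (cball 0 R) x)" for m
      using dom by (intro AE_I2) (smt (verit) real_norm_def)
  qed (use ball in auto)
  then have "\<forall>\<^sub>F m in sequentially. (\<integral>x. \<bar>cut R x * clip R (f x) - cut R x * clip R (g m x)\<bar> \<partial>lebesgue) < e / 2"
    using \<open>e > 0\<close> by (intro order_tendstoD(2)[where y=0]) auto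
  then obtain m where m: "(\<integral>x. \<bar>cut R x * clip R (f x) - cut R x * clip R (g m x)\<bar> \<partial>lebesgue) < e / 2"
    by (auto dest: eventually_happens)
  show ?thesis
  proof (rule that[of "\<lambda>x. cut R x * clip R (g m x)" R])
    show "continuous_on UNIV (\<lambda>x. cut R x * clip R (g m x))"
      using N(2)[of m] cut_cont[of R] by (auto simp: clip_def intro!: continuous_intros)
    show "cut R x * clip R (g m x) = 0" if "norm x > R" for x
      using cut0[OF that] by simp
    show "\<bar>cut R x * clip R (g m x)\<bar> \<le> R" for x
      using order_trans[OF dom, of x R "g m x"] R by (auto simp: indicator_def)
    show "integrable lebesgue (\<lambda>x. cut R x * clip R (g m x))" by (rule int_g)
    have "(\<integral>x. \<bar>f x - cut R x * clip R (g m x)\<bar> \<partial>lebesgue) \<le>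
      (\<integral>x. \<bar>f x - cut R x * clip R (f x)\<bar> + \<bar>cut R x * clip R (f x) - cut R x * clip R (g m x)\<bar> \<partial>lebesgue)"
      using f int_f int_g by (intro integral_mono) auto
    also have "\<dots> = (\<integral>x. \<bar>f x - cut R x * clip R (f x)\<bar> \<partial>lebesgue) +
        (\<integral>x. \<bar>cut R x * clip R (f x) - cut R x * clip R (g m x)\<bar> \<partial>lebesgue)"
      using f int_f int_g by (intro Bochner_Integration.integral_add) auto
    finally show "(\<integral>x. \<bar>f x - cut R x * clip R (g m x)\<bar> \<partial>lebesgue) < e"
      using n m by (simp add: R_def)
  qed
qed

text \<open>For a continuous function of compact support this is dominated convergence; the general
  case follows by approximation, since translation preserves the L^1 norm.\<close>

lemma L1_translation_continuous:
  fixes f :: "'a::euclidean_space \<Rightarrow> real"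
  assumes f: "integrable lebesgue f"
  shows "((\<lambda>h. \<integral>x. \<bar>f (x + h) - f x\<bar> \<partial>lebesgue) \<longlongrightarrow> 0) (at 0)"
  unfolding tendsto_at_iff_sequentially comp_def
proof (intro allI impI)
  fix h :: "nat \<Rightarrow> 'a" assume h: "h \<longlonglongrightarrow> 0"
  show "(\<lambda>n. \<integral>x. \<bar>f (x + h n) - f x\<bar> \<partial>lebesgue) \<longlonglongrightarrow> 0"
  proof (rule LIMSEQ_I)
    fix e :: real assume "e > 0"
    obtain g R where g: "continuous_on UNIV g" "\<And>x. norm x > R \<Longrightarrow> g x = 0" "\<And>x. \<bar>g x\<bar> \<le> R"
        "integrable lebesgue g" "(\<integral>x. \<bar>f x - g x\<bar> \<partial>lebesgue) < e / 3"
      by (rule integrable_continuous_approx[OF f, of "e / 3"]) (use \<open>e > 0\<close> in auto)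
    have [measurable]: "g \<in> borel_measurable lebesgue"
      using g(4) by auto
    note tr = integrable_lebesgue_translation
    \<comment> \<open>Shifts shorter than 1 keep all translates inside the ball of radius
      \<open>R + 1\<close>, which gives the dominating function; the first \<open>n0\<close> terms
      are dropped for that.\<close>
    have "eventually (\<lambda>n. norm (h n) < 1) sequentially"
      using tendstoD[OF h, of 1] by simp
    then obtain n0 where n0: "\<And>n. n \<ge> n0 \<Longrightarrow> norm (h n) < 1"
      by (auto simp: eventually_sequentially)
    have "(\<lambda>n. \<integral>x. \<bar>g (x + h (n + n0)) - g x\<bar> \<partial>lebesgue) \<longlonglongrightarrow> integral\<^sup>L lebesgue (\<lambda>x::'a. 0::real)"
    proof (rule integral_dominated_convergence[where w="\<lambda>x. 2 * R * indicator (cball 0 (R + 1)) x"])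
      show "AE x in lebesgue. (\<lambda>n. \<bar>g (x + h (n + n0)) - g x\<bar>) \<longlonglongrightarrow> 0"
      proof (rule AE_I2)
        fix x
        have "(\<lambda>n. x + h (n + n0)) \<longlonglongrightarrow> x + 0"
          by (intro tendsto_intros LIMSEQ_ignore_initial_segment h)
        moreover have "isCont g x"
          using g(1) continuous_on_eq_continuous_at open_UNIV by blast
        ultimately have "(\<lambda>n. g (x + h (n + n0))) \<longlonglongrightarrow> g x"
          using isCont_tendsto_compose by fastforce
        then have "(\<lambda>n. \<bar>g (x + h (n + n0)) - g x\<bar>) \<longlonglongrightarrow> \<bar>g x - g x\<bar>"
          by (intro tendsto_intros)
        then show "(\<lambda>n. \<bar>g (x + h (n + n0)) - g x\<bar>) \<longlonglongrightarrow> 0" by simp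
      qed
      show "AE x in lebesgue. norm \<bar>g (x + h (n + n0)) - g x\<bar> \<le> 2 * R * indicator (cball 0 (R + 1)) x" for n
      proof (rule AE_I2)
        fix x
        show "norm \<bar>g (x + h (n + n0)) - g x\<bar> \<le> 2 * R * indicator (cball 0 (R + 1)) x"
        proof (cases "norm x \<le> R + 1")
          case True
          then show ?thesis using g(3)[of x] g(3)[of "x + h (n + n0)"] by simp
        next
          case False
          then have "norm (x + h (n + n0)) > R"
            using n0[of "n + n0"] norm_diff_ineq[of x "h (n + n0)"] by auto
          then show ?thesis using False g(2) by auto
        qed
      qed
      show "(\<lambda>x. \<bar>g (x + h (n + n0)) - g x\<bar>) \<in> borel_measurable lebesgue" for n
        using tr[OF g(4)] g(4) by auto
      show "integrable lebesgue (\<lambda>x. 2 * R * indicator (cball 0 (R + 1)) x)"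
        using integrable_indicator_cball by (intro integrable_mult_right)
    qed auto
    then have lim: "(\<lambda>n. \<integral>x. \<bar>g (x + h n) - g x\<bar> \<partial>lebesgue) \<longlonglongrightarrow> 0"
      by - (rule LIMSEQ_offset[where k=n0], simp)
    have "\<forall>\<^sub>F n in sequentially. (\<integral>x. \<bar>g (x + h n) - g x\<bar> \<partial>lebesgue) < e / 3"
      by (rule order_tendstoD(2)[OF lim]) (use \<open>e > 0\<close> in simp)
    then obtain N where N: "\<And>n. n \<ge> N \<Longrightarrow> (\<integral>x. \<bar>g (x + h n) - g x\<bar> \<partial>lebesgue) < e / 3"
      by (auto simp: eventually_sequentially)
    have "norm ((\<integral>x. \<bar>f (x + h n) - f x\<bar> \<partial>lebesgue) - 0) < e" if "n \<ge> N" for n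
    proof -
      have fg: "integrable lebesgue (\<lambda>x. \<bar>f x - g x\<bar>)"
        using f g(4) by auto
      have i: "integrable lebesgue (\<lambda>x. \<bar>f (x + h n) - g (x + h n)\<bar>)"
        using tr[OF fg] .
      have j: "integrable lebesgue (\<lambda>x. \<bar>g (x + h n) - g x\<bar>)"
        using tr[OF g(4)] g(4) by auto
      have "(\<integral>x. \<bar>f (x + h n) - f x\<bar> \<partial>lebesgue) \<le>
        (\<integral>x. \<bar>f (x + h n) - g (x + h n)\<bar> + \<bar>g (x + h n) - g x\<bar> + \<bar>f x - g x\<bar> \<partial>lebesgue)"
        using f fg i j tr[OF f] by (intro integral_mono Bochner_Integration.integrable_add) auto
      also have "\<dots> = (\<integral>x. \<bar>f (x + h n) - g (x + h n)\<bar> \<partial>lebesgue) +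
         (\<integral>x. \<bar>g (x + h n) - g x\<bar> \<partial>lebesgue) + (\<integral>x. \<bar>f x - g x\<bar> \<partial>lebesgue)"
        using fg i j by simp
      also have "(\<integral>x. \<bar>f (x + h n) - g (x + h n)\<bar> \<partial>lebesgue) = (\<integral>x. \<bar>f x - g x\<bar> \<partial>lebesgue)"
        by (rule integral_lebesgue_translation[where f="\<lambda>x. \<bar>f x - g x\<bar>"]) (use fg in auto)
      finally show ?thesis using g(5) N[OF that] by simp
    qed
    then show "\<exists>N. \<forall>n\<ge>N. norm ((\<integral>x. \<bar>f (x + h n) - f x\<bar> \<partial>lebesgue) - 0) < e"
      by blast
  qed
qed

text \<open>Duality: the integral on the left is reached in the limit by pairing \<open>f\<close>
  with test functions that are bounded by 1 and tend to the sign of \<open>f\<close> on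
  \<open>K\<close> and to 0 elsewhere.\<close>

lemma L1_norm_le_test_functions:
  fixes f :: "'a::euclidean_space \<Rightarrow> real"
  assumes f: "integrable lebesgue f" and K: "compact K" "K \<subseteq> U" "open U"
    and le: "\<And>\<phi> D\<phi>. test_function U \<phi> D\<phi> \<Longrightarrow> (\<And>x. \<bar>\<phi> x\<bar> \<le> 1) \<Longrightarrow> (\<integral>x. \<phi> x * f x \<partial>lebesgue) \<le> M"
  shows "(\<integral>x. indicator K x * \<bar>f x\<bar> \<partial>lebesgue) \<le> M"
proof -
  have [measurable]: "f \<in> borel_measurable lebesgue" "K \<in> sets lebesgue"
    using f K by (auto simp: compact_imp_closed)
  define s where "s x = indicator K x * sgn (f x)" for x
  obtain \<phi> D\<phi> where \<phi>: "\<And>n. test_function U (\<phi> n) (D\<phi> n)" "\<And>n x. \<bar>\<phi> n x\<bar> \<le> 1"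
    "AE x in lebesgue. (\<lambda>n. \<phi> n x) \<longlonglongrightarrow> s x"
  proof (rule test_functions_approximate_sign)
    show "s \<in> borel_measurable lebesgue" unfolding s_def by measurable
    show "s x \<in> {-1, 0, 1}" for x by (auto simp: s_def indicator_def sgn_if)
  qed (use K in \<open>auto simp: s_def\<close>)
  have "(\<lambda>n. \<integral>x. \<phi> n x * f x \<partial>lebesgue) \<longlonglongrightarrow> (\<integral>x. s x * f x \<partial>lebesgue)"
  proof (rule integral_dominated_convergence[where w="\<lambda>x. \<bar>f x\<bar>"])
    show "AE x in lebesgue. (\<lambda>n. \<phi> n x * f x) \<longlonglongrightarrow> s x * f x"
      using \<phi>(3) by eventually_elim (intro tendsto_intros)
    show "AE x in lebesgue. norm (\<phi> n x * f x) \<le> \<bar>f x\<bar>" for n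
      using \<phi>(2) by (intro AE_I2) (simp add: abs_mult mult_left_le_one_le)
    show "(\<lambda>x. \<phi> n x * f x) \<in> borel_measurable lebesgue" for n
      using continuous_on_imp_borel_measurable_lebesgue[OF test_function_continuous(1)[OF \<phi>(1)]]
      by measurable
  qed (use f in \<open>auto simp: s_def\<close>)
  moreover have "s x * f x = indicator K x * \<bar>f x\<bar>" for x
    by (auto simp: s_def abs_sgn mult.commute)
  ultimately have "(\<lambda>n. \<integral>x. \<phi> n x * f x \<partial>lebesgue) \<longlonglongrightarrow> (\<integral>x. indicator K x * \<bar>f x\<bar> \<partial>lebesgue)"
    by simp
  then show ?thesis
    by (rule LIMSEQ_le_const2) (intro exI[of _ 0] allI impI le[OF \<phi>(1,2)])
qed

section \<open>Weak gradients\<close>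

lemma integrable_lebesgue_on_iff:
  fixes f :: "'a::euclidean_space \<Rightarrow> 'b::euclidean_space"
  assumes "S \<in> sets lebesgue"
  shows "integrable (lebesgue_on S) f \<longleftrightarrow> integrable lebesgue (\<lambda>x. indicator S x *\<^sub>R f x)"
  using integrable_restrict_space[of S lebesgue f] assms by simp

lemma integral_lebesgue_on_eq:
  fixes f :: "'a::euclidean_space \<Rightarrow> 'b::euclidean_space"
  assumes "S \<in> sets lebesgue"
  shows "integral\<^sup>L (lebesgue_on S) f = (\<integral>x. indicator S x *\<^sub>R f x \<partial>lebesgue)"
  using integral_restrict_space[of S lebesgue f] assms by simp

lemma integrable_imp_locally_integrable_on:
  assumes "open S" "integrable (lebesgue_on S) f"
  shows "locally_integrable_on S f"
  unfolding locally_integrable_on_def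
proof (intro allI impI)
  fix K assume "compact K \<and> K \<subseteq> S"
  moreover have "set_integrable lebesgue S f"
    using assms integrable_lebesgue_on_iff[of S f] by (simp add: set_integrable_def)
  ultimately show "f absolutely_integrable_on K"
    by (auto intro: set_integrable_subset simp: compact_imp_closed)
qed

lemma bounded_times_locally_integrable:
  fixes f :: "'a::euclidean_space \<Rightarrow> 'b::euclidean_space"
  assumes f: "locally_integrable_on S f" and S: "open S" and K: "compact K" "K \<subseteq> S"
    and \<phi>: "\<phi> \<in> borel_measurable lebesgue" "\<And>x. x \<notin> K \<Longrightarrow> \<phi> x = 0" "\<And>x. \<bar>\<phi> x\<bar> \<le> B"
  shows "integrable (lebesgue_on S) (\<lambda>x. \<phi> x *\<^sub>R f x)"
proof -
  have int: "integrable lebesgue (\<lambda>x. indicator K x *\<^sub>R f x)"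
    using f K by (auto simp: locally_integrable_on_def set_integrable_def)
  have "integrable lebesgue (\<lambda>x. \<phi> x *\<^sub>R (indicator K x *\<^sub>R f x))"
  proof (rule Bochner_Integration.integrable_bound)
    show "integrable lebesgue (\<lambda>x. B *\<^sub>R (indicator K x *\<^sub>R f x))"
      by (intro integrable_scaleR_right int)
    show "(\<lambda>x. \<phi> x *\<^sub>R (indicator K x *\<^sub>R f x)) \<in> borel_measurable lebesgue"
      by (intro borel_measurable_scaleR \<phi>(1) borel_measurable_integrable[OF int])
    show "AE x in lebesgue. norm (\<phi> x *\<^sub>R (indicator K x *\<^sub>R f x)) \<le> norm (B *\<^sub>R (indicator K x *\<^sub>R f x))"
      unfolding norm_scaleR[of "\<phi> _"] norm_scaleR[of B]
      using order_trans[OF \<phi>(3) abs_ge_self] by (intro AE_I2 mult_right_mono) auto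
  qed
  also have "(\<lambda>x. \<phi> x *\<^sub>R (indicator K x *\<^sub>R f x)) = (\<lambda>x. indicator S x *\<^sub>R (\<phi> x *\<^sub>R f x))"
    using K(2) \<phi>(2) by (auto simp: fun_eq_iff indicator_def)
  finally show ?thesis
    by (subst integrable_lebesgue_on_iff) (use S in auto)
qed

lemma test_function_times_locally_integrable:
  fixes f :: "'a::euclidean_space \<Rightarrow> 'b::euclidean_space"
  assumes "locally_integrable_on S f" "open S" "test_function S \<phi> D\<phi>"
  shows "integrable (lebesgue_on S) (\<lambda>x. \<phi> x *\<^sub>R f x)"
    and "integrable (lebesgue_on S) (\<lambda>x. (D\<phi> x \<bullet> e) *\<^sub>R f x)"
proof -
  obtain K where K: "compact K" "K \<subseteq> S" "\<And>x. x \<notin> K \<Longrightarrow> \<phi> x = 0" "\<And>x. x \<notin> K \<Longrightarrow> D\<phi> x = 0"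
    by (rule test_functionE[OF assms(3)]) (rule that)
  obtain B where B: "B > 0" "\<And>x. \<bar>\<phi> x\<bar> \<le> B" "\<And>x. norm (D\<phi> x) \<le> B"
    by (rule test_function_bounded[OF assms(3)]) (rule that)
  show "integrable (lebesgue_on S) (\<lambda>x. \<phi> x *\<^sub>R f x)"
    using assms K B test_function_continuous(1)[OF assms(3)]
    by (intro bounded_times_locally_integrable[where K=K and B=B] continuous_on_imp_borel_measurable_lebesgue)
  have "\<bar>D\<phi> x \<bullet> e\<bar> \<le> B * norm e" for x
    using Cauchy_Schwarz_ineq2[of "D\<phi> x" e] mult_right_mono[OF B(3), of "norm e" x] by simp
  then show "integrable (lebesgue_on S) (\<lambda>x. (D\<phi> x \<bullet> e) *\<^sub>R f x)"
    using assms K test_function_continuous(2)[OF assms(3)]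
    by (intro bounded_times_locally_integrable[where K=K and B="B * norm e"]
         continuous_on_imp_borel_measurable_lebesgue continuous_intros) auto
qed

text \<open>The fundamental lemma of the calculus of variations, by exhaustion with compact sets.
  Cutting \<open>f\<close> off outside \<open>C (Suc n)\<close> makes it integrable on the whole
  space, and test functions supported in the interior of \<open>C (Suc n)\<close> do not notice the
  cut.\<close>

lemma AE_zero_if_test_integrals_zero:
  fixes f :: "'a::euclidean_space \<Rightarrow> real"
  assumes S: "open S" and f: "locally_integrable_on S f"
    and zero: "\<And>\<phi> D\<phi>. test_function S \<phi> D\<phi> \<Longrightarrow> (LINT x|lebesgue_on S. \<phi> x * f x) = 0"
  shows "AE x in lebesgue_on S. f x = 0"
proof -
  obtain C where C: "\<And>n. compact (C n)" "\<And>n. C n \<subseteq> S" "\<And>n. C n \<subseteq> interior (C (Suc n))"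
    "\<Union>(range C) = S"
    by (rule open_Union_compact_subsets[OF S]) (rule that)
  have "AE x in lebesgue. x \<in> C n \<longrightarrow> f x = 0" for n
  proof -
    define F where "F x = indicator (C (Suc n)) x * f x" for x
    have F: "integrable lebesgue F"
      using f C(1,2) by (auto simp: locally_integrable_on_def set_integrable_def F_def[abs_def])
    have "(\<integral>x. indicator (C n) x * \<bar>F x\<bar> \<partial>lebesgue) \<le> 0"
    proof (rule L1_norm_le_test_functions[OF F C(1) C(3) open_interior])
      fix \<phi> D\<phi> assume \<phi>: "test_function (interior (C (Suc n))) \<phi> D\<phi>"
      then obtain K where K: "compact K" "K \<subseteq> interior (C (Suc n))" "\<And>x. x \<notin> K \<Longrightarrow> \<phi> x = 0"
        by (meson test_functionE)
      have sub: "interior (C (Suc n)) \<subseteq> S"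
        using C(2) interior_subset by blast
      have "indicator S x *\<^sub>R (\<phi> x * f x) = \<phi> x * F x" for x
        using K C(2)[of "Suc n"] interior_subset[of "C (Suc n)"]
        by (auto simp: F_def indicator_def)
      then have "(\<integral>x. \<phi> x * F x \<partial>lebesgue) = (LINT x|lebesgue_on S. \<phi> x * f x)"
        by (subst integral_lebesgue_on_eq) (use S in \<open>simp_all only: sets_completionI_sets lebesgue_openin open_openin borel_open sets_lborel\<close>)
      then show "(\<integral>x. \<phi> x * F x \<partial>lebesgue) \<le> 0"
        using zero[OF test_function_mono[OF \<phi> sub]] by simp
    qed
    moreover have "C n \<in> sets lebesgue"
      using C(1) by (simp add: compact_imp_closed)
    then have int: "integrable lebesgue (\<lambda>x. indicator (C n) x * \<bar>F x\<bar>)"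
      using F integrable_real_mult_indicator[of "C n" lebesgue "\<lambda>x. \<bar>F x\<bar>"] by (simp add: mult.commute)
    ultimately have "(\<integral>x. indicator (C n) x * \<bar>F x\<bar> \<partial>lebesgue) = 0"
      by (intro antisym integral_nonneg_AE) auto
    then have "AE x in lebesgue. indicator (C n) x * \<bar>F x\<bar> = 0"
      using integral_nonneg_eq_0_iff_AE[OF int] by simp
    then show ?thesis
      by eventually_elim (use C(3)[of n] interior_subset[of "C (Suc n)"] in \<open>auto simp: F_def indicator_def split: if_splits\<close>)
  qed
  then have "AE x in lebesgue. \<forall>n. x \<in> C n \<longrightarrow> f x = 0"
    unfolding AE_all_countable by blast
  then have "AE x in lebesgue. x \<in> S \<longrightarrow> f x = 0"
    by eventually_elim (use C(4) in auto)
  then show ?thesis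
    using S by (simp add: AE_lebesgue_on_iff)
qed

lemma has_weak_gradient_iff:
  "has_weak_gradient S v G \<longleftrightarrow> locally_integrable_on S v \<and> locally_integrable_on S G \<and>
     (\<forall>\<phi> D\<phi>. test_function S \<phi> D\<phi> \<longrightarrow>
       (LINT x|lebesgue_on S. v x *\<^sub>R D\<phi> x) = - (LINT x|lebesgue_on S. \<phi> x *\<^sub>R G x))"
  unfolding has_weak_gradient_def test_function_def by simp

lemma locally_integrable_times_test_gradient:
  fixes v :: "'a::euclidean_space \<Rightarrow> real"
  assumes "locally_integrable_on S v" "open S" "test_function S \<phi> D\<phi>"
  shows "integrable (lebesgue_on S) (\<lambda>x. v x *\<^sub>R D\<phi> x)"
proof -
  have "integrable (lebesgue_on S) (\<lambda>x. \<Sum>b\<in>Basis. ((D\<phi> x \<bullet> b) *\<^sub>R v x) *\<^sub>R b)"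
    using test_function_times_locally_integrable(2)[OF assms]
    by (intro Bochner_Integration.integrable_sum integrable_scaleR_left) auto
  moreover have "(\<Sum>b\<in>Basis. ((D\<phi> x \<bullet> b) *\<^sub>R v x) *\<^sub>R b) = v x *\<^sub>R D\<phi> x" for x
    using euclidean_representation[of "v x *\<^sub>R D\<phi> x"] by (simp add: mult.commute)
  ultimately show ?thesis by simp
qed

lemma has_weak_gradientI_inner:
  fixes v :: "'a::euclidean_space \<Rightarrow> real"
  assumes "open S" "locally_integrable_on S v" "locally_integrable_on S G"
    and "\<And>\<phi> D\<phi> e. test_function S \<phi> D\<phi> \<Longrightarrow> e \<in> Basis \<Longrightarrow>
       (LINT x|lebesgue_on S. v x * (D\<phi> x \<bullet> e)) = - (LINT x|lebesgue_on S. \<phi> x * (G x \<bullet> e))"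
  shows "has_weak_gradient S v G"
  unfolding has_weak_gradient_iff
proof (intro conjI allI impI assms(2,3), rule euclidean_eqI)
  fix \<phi> D\<phi> e assume \<phi>: "test_function S \<phi> D\<phi>" and e: "e \<in> (Basis :: 'a set)"
  show "(LINT x|lebesgue_on S. v x *\<^sub>R D\<phi> x) \<bullet> e = - (LINT x|lebesgue_on S. \<phi> x *\<^sub>R G x) \<bullet> e"
    using assms(4)[OF \<phi> e] locally_integrable_times_test_gradient[OF assms(2,1) \<phi>]
      test_function_times_locally_integrable(1)[OF assms(3,1) \<phi>]
    by (simp flip: integral_inner_left)
qed

lemma has_weak_gradientD_inner:
  fixes v :: "'a::euclidean_space \<Rightarrow> real"
  assumes "open S" "has_weak_gradient S v G" "test_function S \<phi> D\<phi>"
  shows "(LINT x|lebesgue_on S. v x * (D\<phi> x \<bullet> e)) = - (LINT x|lebesgue_on S. \<phi> x * (G x \<bullet> e))"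
proof -
  have G: "locally_integrable_on S v" "locally_integrable_on S G"
    "(LINT x|lebesgue_on S. v x *\<^sub>R D\<phi> x) = - (LINT x|lebesgue_on S. \<phi> x *\<^sub>R G x)"
    using assms(2,3) by (auto simp: has_weak_gradient_iff)
  have "(LINT x|lebesgue_on S. v x *\<^sub>R D\<phi> x) \<bullet> e = - (LINT x|lebesgue_on S. \<phi> x *\<^sub>R G x) \<bullet> e"
    using G(3) by simp
  then show ?thesis
    using locally_integrable_times_test_gradient[OF G(1) assms(1,3)]
      test_function_times_locally_integrable(1)[OF G(2) assms(1,3)]
    by (simp flip: integral_inner_left)
qed

lemma locally_integrable_on_diff:
  assumes "locally_integrable_on S f" "locally_integrable_on S g"
  shows "locally_integrable_on S (\<lambda>x. f x - g x)"
  using assms by (auto simp: locally_integrable_on_def intro: set_integral_diff)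

lemma locally_integrable_on_inner:
  fixes f :: "'a::euclidean_space \<Rightarrow> 'b::euclidean_space"
  assumes "locally_integrable_on S f"
  shows "locally_integrable_on S (\<lambda>x. f x \<bullet> e)"
  unfolding locally_integrable_on_def set_integrable_def
proof (intro allI impI)
  fix K assume "compact K \<and> K \<subseteq> S"
  then have "integrable lebesgue (\<lambda>x. (indicat_real K x *\<^sub>R f x) \<bullet> e)"
    using assms by (intro integrable_inner_left) (auto simp: locally_integrable_on_def set_integrable_def)
  then show "integrable lebesgue (\<lambda>x. indicat_real K x *\<^sub>R (f x \<bullet> e))" by simp
qed

lemma has_weak_gradient_unique:
  fixes v w :: "'a::euclidean_space \<Rightarrow> real"
  assumes S: "open S" and G: "has_weak_gradient S v G" and H: "has_weak_gradient S w H"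
    and eq: "AE x in lebesgue_on S. v x = w x"
  shows "AE x in lebesgue_on S. G x = H x"
proof -
  have GH: "locally_integrable_on S G" "locally_integrable_on S H" "locally_integrable_on S v"
     "locally_integrable_on S w"
    using G H by (auto simp: has_weak_gradient_def)
  have "AE x in lebesgue_on S. (G x - H x) \<bullet> b = 0" for b
  proof (rule AE_zero_if_test_integrals_zero[OF S])
    show "locally_integrable_on S (\<lambda>x. (G x - H x) \<bullet> b)"
      by (intro locally_integrable_on_inner locally_integrable_on_diff GH)
    fix \<phi> D\<phi> assume \<phi>: "test_function S \<phi> D\<phi>"
    have int: "integrable (lebesgue_on S) (\<lambda>x. \<phi> x * (F x \<bullet> b))" if "locally_integrable_on S F" for F
      using test_function_times_locally_integrable(1)[OF locally_integrable_on_inner[OF that] S \<phi>] by simp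
    have meas: "(\<lambda>x. u x * (D\<phi> x \<bullet> b)) \<in> borel_measurable (lebesgue_on S)" if "locally_integrable_on S u" for u
      using test_function_times_locally_integrable(2)[OF that S \<phi>, of b] by (auto simp: mult.commute)
    have "(LINT x|lebesgue_on S. v x * (D\<phi> x \<bullet> b)) = (LINT x|lebesgue_on S. w x * (D\<phi> x \<bullet> b))"
      using eq meas GH(3,4) by (intro integral_cong_AE) auto
    then have "(LINT x|lebesgue_on S. \<phi> x * (G x \<bullet> b)) = (LINT x|lebesgue_on S. \<phi> x * (H x \<bullet> b))"
      using has_weak_gradientD_inner[OF S G \<phi>, of b] has_weak_gradientD_inner[OF S H \<phi>, of b] by simp
    then show "(LINT x|lebesgue_on S. \<phi> x * ((G x - H x) \<bullet> b)) = 0"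
      using int GH by (simp add: inner_diff_left right_diff_distrib)
  qed
  then have "AE x in lebesgue_on S. \<forall>b\<in>Basis. (G x - H x) \<bullet> b = 0"
    by (intro AE_finite_allI) auto
  then show ?thesis
    by eventually_elim (simp add: euclidean_eq_iff[of "G _"] inner_diff_left)
qed

section \<open>Difference quotients and the weak derivative\<close>

lemma test_function_translation:
  assumes "test_function U \<phi> D\<phi>" "\<And>x. x \<in> U \<Longrightarrow> x + h \<in> V"
  shows "test_function V (\<lambda>x. \<phi> (x - h)) (\<lambda>x. D\<phi> (x - h))"
proof -
  obtain K where K: "compact K" "K \<subseteq> U" "\<And>x. x \<notin> K \<Longrightarrow> \<phi> x = 0" "\<And>x. x \<notin> K \<Longrightarrow> D\<phi> x = 0"
    by (rule test_functionE[OF assms(1)]) (rule that)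
  show ?thesis
  proof (rule test_functionI)
    show "GDERIV (\<lambda>x. \<phi> (x - h)) x :> D\<phi> (x - h)" for x
    proof -
      have *: "((\<lambda>x. x - h) has_derivative (\<lambda>y. y)) (at x)"
        by (auto intro!: derivative_eq_intros)
      have "(\<phi> has_derivative (\<lambda>y. y \<bullet> D\<phi> (x - h))) (at (x - h))"
        using assms(1) by (simp add: test_function_def gderiv_def)
      from has_derivative_compose[OF * this] show ?thesis
        by (simp add: gderiv_def)
    qed
    show "continuous_on UNIV (\<lambda>x. D\<phi> (x - h))"
      using test_function_continuous(2)[OF assms(1)]
      by (auto intro!: continuous_intros continuous_on_compose2[of UNIV D\<phi>])
    show "compact ((\<lambda>x. x + h) ` K)"
      using K(1) by (auto intro!: compact_continuous_image continuous_intros)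
    show "(\<lambda>x. x + h) ` K \<subseteq> V"
      using K(2) assms(2) by auto
    show "\<phi> (x - h) = 0" if "x \<notin> (\<lambda>x. x + h) ` K" for x
      using K(3)[of "x - h"] that by (metis diff_add_cancel imageI)
  qed
qed

lemma test_function_lipschitz:
  assumes "test_function U \<phi> D\<phi>" "\<And>x. norm (D\<phi> x) \<le> B"
  shows "\<bar>\<phi> x - \<phi> y\<bar> \<le> B * norm (x - y)"
proof -
  have "norm (\<phi> x - \<phi> y) \<le> B * norm (x - y)"
  proof (rule differentiable_bound[of UNIV \<phi> "\<lambda>x h. h \<bullet> D\<phi> x"])
    show "(\<phi> has_derivative (\<lambda>h. h \<bullet> D\<phi> x)) (at x within UNIV)" for x
      using assms(1) by (simp add: test_function_def gderiv_def)
    show "onorm (\<lambda>h. h \<bullet> D\<phi> x) \<le> B" for x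
    proof (rule onorm_le)
      show "norm (h \<bullet> D\<phi> x) \<le> B * norm h" for h
        using Cauchy_Schwarz_ineq2[of h "D\<phi> x"] mult_right_mono[OF assms(2)[of x], of "norm h"]
        by (simp add: mult.commute)
    qed
  qed auto
  then show ?thesis by simp
qed

lemma integrable_mult_bounded:
  fixes f :: "'a \<Rightarrow> real"
  assumes "integrable M f" "g \<in> borel_measurable M" "\<And>x. \<bar>g x\<bar> \<le> B"
  shows "integrable M (\<lambda>x. f x * g x)"
proof (rule Bochner_Integration.integrable_bound)
  show "integrable M (\<lambda>x. B * f x)"
    using assms(1) by simp
  show "AE x in M. norm (f x * g x) \<le> norm (B * f x)"
  proof (rule AE_I2)
    fix x
    have "\<bar>g x\<bar> \<le> \<bar>B\<bar>" using assms(3)[of x] by simp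
    then have "\<bar>g x\<bar> * \<bar>f x\<bar> \<le> \<bar>B\<bar> * \<bar>f x\<bar>" by (intro mult_right_mono) auto
    then show "norm (f x * g x) \<le> norm (B * f x)" by (simp add: abs_mult mult.commute)
  qed
qed (use assms in auto)

text \<open>Differentiation under the integral sign, with the translation on the smooth factor; the
  Lipschitz bound on \<open>\<phi>\<close> gives the dominating function. \<open>V\<close> is only
  integrable, so this serves for a field extended by 0, for its positive part and for the indicator
  of a ball.\<close>

lemma integral_against_translated_test_function_deriv:
  fixes V :: "'a::euclidean_space \<Rightarrow> real"
  assumes V: "integrable lebesgue V" and \<phi>: "test_function U \<phi> D\<phi>"
  shows "((\<lambda>s. \<integral>x. V x * \<phi> (x - s *\<^sub>R e) \<partial>lebesgue) has_real_derivative
     - (\<integral>x. V x * (D\<phi> (x - s *\<^sub>R e) \<bullet> e) \<partial>lebesgue)) (at s)"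
proof -
  obtain B where B: "B > 0" "\<And>x. \<bar>\<phi> x\<bar> \<le> B" "\<And>x. norm (D\<phi> x) \<le> B"
    by (rule test_function_bounded[OF \<phi>]) (rule that)
  have c: "continuous_on UNIV \<phi>" "continuous_on UNIV D\<phi>"
    using test_function_continuous[OF \<phi>] by auto
  have m: "(\<lambda>x. \<phi> (x - h)) \<in> borel_measurable lebesgue" for h
    using c(1) by (intro continuous_on_imp_borel_measurable_lebesgue)
      (auto intro!: continuous_intros continuous_on_compose2[of UNIV \<phi>])
  have md: "(\<lambda>x. D\<phi> (x - h) \<bullet> e) \<in> borel_measurable lebesgue" for h
    using c(2) by (intro continuous_on_imp_borel_measurable_lebesgue)
      (auto intro!: continuous_intros continuous_on_compose2[of UNIV D\<phi>])
  have [measurable]: "V \<in> borel_measurable lebesgue" using V by auto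
  have int: "integrable lebesgue (\<lambda>x. V x * \<phi> (x - h))" for h
    using V m B(2) by (rule integrable_mult_bounded)
  show ?thesis
    unfolding DERIV_def tendsto_at_iff_sequentially comp_def
  proof (intro allI impI)
    fix t :: "nat \<Rightarrow> real"
    assume t0: "\<forall>i. t i \<in> UNIV - {0}" and t: "t \<longlonglongrightarrow> 0"
    have lim: "(\<lambda>n. \<integral>x. V x * ((\<phi> (x - (s + t n) *\<^sub>R e) - \<phi> (x - s *\<^sub>R e)) / t n) \<partial>lebesgue) \<longlonglongrightarrow>
       (\<integral>x. V x * (- (D\<phi> (x - s *\<^sub>R e) \<bullet> e)) \<partial>lebesgue)"
    proof (rule integral_dominated_convergence[where w="\<lambda>x. (B * norm e) * \<bar>V x\<bar>"])
      show "(\<lambda>x. V x * - (D\<phi> (x - s *\<^sub>R e) \<bullet> e)) \<in> borel_measurable lebesgue"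
        using md[of "s *\<^sub>R e"] by measurable
      show "(\<lambda>x. V x * ((\<phi> (x - (s + t n) *\<^sub>R e) - \<phi> (x - s *\<^sub>R e)) / t n)) \<in> borel_measurable lebesgue" for n
        using m[of "s *\<^sub>R e"] m[of "(s + t n) *\<^sub>R e"] by measurable
      show "integrable lebesgue (\<lambda>x. (B * norm e) * \<bar>V x\<bar>)"
        using V by simp
      show "AE x in lebesgue. (\<lambda>n. V x * ((\<phi> (x - (s + t n) *\<^sub>R e) - \<phi> (x - s *\<^sub>R e)) / t n)) \<longlonglongrightarrow>
          V x * - (D\<phi> (x - s *\<^sub>R e) \<bullet> e)"
      proof (rule AE_I2)
        fix x
        have "((\<lambda>r. x - r *\<^sub>R e) has_derivative (\<lambda>r. - (r *\<^sub>R e))) (at s)"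
          by (auto intro!: derivative_eq_intros)
        moreover have "(\<phi> has_derivative (\<lambda>y. y \<bullet> D\<phi> (x - s *\<^sub>R e))) (at (x - s *\<^sub>R e))"
          using \<phi> by (simp add: test_function_def gderiv_def)
        ultimately have "((\<lambda>r. \<phi> (x - r *\<^sub>R e)) has_derivative (\<lambda>r. (- (r *\<^sub>R e)) \<bullet> D\<phi> (x - s *\<^sub>R e))) (at s)"
          by (rule has_derivative_compose)
        moreover have "(\<lambda>r. (- (r *\<^sub>R e)) \<bullet> D\<phi> (x - s *\<^sub>R e)) = (*) (- (D\<phi> (x - s *\<^sub>R e) \<bullet> e))"
          by (auto simp: inner_commute)
        ultimately have "((\<lambda>r. \<phi> (x - r *\<^sub>R e)) has_real_derivative - (D\<phi> (x - s *\<^sub>R e) \<bullet> e)) (at s)"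
          by (simp add: has_field_derivative_def)
        then have "(\<lambda>n. (\<phi> (x - (s + t n) *\<^sub>R e) - \<phi> (x - s *\<^sub>R e)) / t n) \<longlonglongrightarrow> - (D\<phi> (x - s *\<^sub>R e) \<bullet> e)"
          using t0 t unfolding DERIV_def tendsto_at_iff_sequentially comp_def by blast
        then show "(\<lambda>n. V x * ((\<phi> (x - (s + t n) *\<^sub>R e) - \<phi> (x - s *\<^sub>R e)) / t n)) \<longlonglongrightarrow>
          V x * - (D\<phi> (x - s *\<^sub>R e) \<bullet> e)"
          by (intro tendsto_intros)
      qed
      show "AE x in lebesgue. norm (V x * ((\<phi> (x - (s + t n) *\<^sub>R e) - \<phi> (x - s *\<^sub>R e)) / t n)) \<le> (B * norm e) * \<bar>V x\<bar>" for n
      proof (rule AE_I2)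
        fix x
        have "(x - (s + t n) *\<^sub>R e) - (x - s *\<^sub>R e) = - (t n *\<^sub>R e)"
          by (simp add: algebra_simps)
        then have "\<bar>\<phi> (x - (s + t n) *\<^sub>R e) - \<phi> (x - s *\<^sub>R e)\<bar> \<le> B * (\<bar>t n\<bar> * norm e)"
          using test_function_lipschitz[OF \<phi> B(3), of "x - (s + t n) *\<^sub>R e" "x - s *\<^sub>R e"] by simp
        then have "\<bar>(\<phi> (x - (s + t n) *\<^sub>R e) - \<phi> (x - s *\<^sub>R e)) / t n\<bar> \<le> B * norm e"
          using t0 by (simp add: abs_divide divide_le_eq mult_ac)
        from mult_left_mono[OF this abs_ge_zero[of "V x"]]
        show "norm (V x * ((\<phi> (x - (s + t n) *\<^sub>R e) - \<phi> (x - s *\<^sub>R e)) / t n)) \<le> (B * norm e) * \<bar>V x\<bar>"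
          by (simp add: abs_mult abs_divide mult_ac)
      qed
    qed
    have eq: "(\<integral>x. V x * ((\<phi> (x - (s + t n) *\<^sub>R e) - \<phi> (x - s *\<^sub>R e)) / t n) \<partial>lebesgue) =
       ((\<integral>x. V x * \<phi> (x - (s + t n) *\<^sub>R e) \<partial>lebesgue) - (\<integral>x. V x * \<phi> (x - s *\<^sub>R e) \<partial>lebesgue)) / t n" for n
      using int by (simp add: right_diff_distrib diff_divide_distrib)
    show "(\<lambda>n. ((\<integral>x. V x * \<phi> (x - (s + t n) *\<^sub>R e) \<partial>lebesgue) -
         (\<integral>x. V x * \<phi> (x - s *\<^sub>R e) \<partial>lebesgue)) / t n) \<longlonglongrightarrow>
      - (\<integral>x. V x * (D\<phi> (x - s *\<^sub>R e) \<bullet> e) \<partial>lebesgue)"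
      using lim unfolding eq mult_minus_right Bochner_Integration.integral_minus .
  qed
qed

text \<open>Duality reduces the claim to pairings of the error with test functions
  \<open>\<phi>\<close>, uniformly in \<open>\<phi>\<close>. The difference quotient of
  \<open>V\<close> paired with \<open>\<phi>\<close> is that of s \<mapsto> \<integral> V(x)
  \<phi>(x - s e), whose derivative is \<integral> d(x) \<phi>(x - s e) by the weak gradient
  identity. The mean value theorem gives \<integral> d(x + s e) \<phi>(x) for some s below the step,
  and this differs from \<integral> d \<phi> by at most the L^1 modulus of continuity of
  \<open>d\<close>.\<close>

lemma difference_quotient_tendsto_weak_gradient:
  fixes v :: "'a::euclidean_space \<Rightarrow> real" and e :: 'a
  assumes S: "open S" and int: "integrable (lebesgue_on S) v" "integrable (lebesgue_on S) G"
    and wg: "has_weak_gradient S v G" and K: "compact K" "K \<subseteq> S"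
  defines "V \<equiv> \<lambda>x. indicator S x * v x"
  defines "d \<equiv> \<lambda>x. indicator S x * (G x \<bullet> e)"
  shows "(\<lambda>n. \<integral>x. indicator K x * \<bar>(V (x + (1 / Suc n) *\<^sub>R e) - V x) / (1 / Suc n) - d x\<bar> \<partial>lebesgue) \<longlonglongrightarrow> 0"
proof -
  have S': "S \<in> sets lebesgue" using S by simp
  have V: "integrable lebesgue V"
    using int(1) integrable_lebesgue_on_iff[OF S', of v] by (simp add: V_def)
  have "integrable (lebesgue_on S) (\<lambda>x. G x \<bullet> e)"
    using int(2) by simp
  then have d: "integrable lebesgue d"
    using integrable_lebesgue_on_iff[OF S', of "\<lambda>x. G x \<bullet> e"] by (simp add: d_def)
  obtain \<rho> where \<rho>: "\<rho> > 0" "(\<Union>x\<in>K. cball x \<rho>) \<subseteq> S"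
    by (rule compact_subset_open_imp_cball_epsilon_subset[OF K(1) S K(2)]) (rule that)
  \<comment> \<open>Half of the margin \<rho> is spent on the neighbourhood \<open>U\<close> of
    \<open>K\<close>, the other half on translations: test functions on \<open>U\<close> shifted by
    at most \<rho>/2 still live in \<open>S\<close>.\<close>
  define U where "U = (\<Union>x\<in>K. ball x (\<rho> / 2))"
  have U: "open U" "K \<subseteq> U"
    using \<rho>(1) by (auto simp: U_def)
  have US: "x + h \<in> S" if x: "x \<in> U" and h: "norm h \<le> \<rho> / 2" for x h
  proof -
    obtain y where y: "y \<in> K" "dist y x < \<rho> / 2" using x by (auto simp: U_def)
    have "dist y (x + h) \<le> dist y x + norm h"
      using norm_triangle_ineq4[of "y - x" h] by (simp add: dist_norm algebra_simps)
    then have "x + h \<in> cball y \<rho>" using y h by simp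
    then show ?thesis using \<rho>(2) y(1) by blast
  qed
  have J': "((\<lambda>s. \<integral>x. V x * \<phi> (x - s *\<^sub>R e) \<partial>lebesgue) has_real_derivative
       (\<integral>x. d x * \<phi> (x - s *\<^sub>R e) \<partial>lebesgue)) (at s)"
    if \<phi>: "test_function U \<phi> D\<phi>" and s: "norm (s *\<^sub>R e) \<le> \<rho> / 2" for \<phi> D\<phi> s
  proof -
    have "test_function S (\<lambda>x. \<phi> (x - s *\<^sub>R e)) (\<lambda>x. D\<phi> (x - s *\<^sub>R e))"
      by (rule test_function_translation[OF \<phi>]) (rule US[OF _ s])
    from has_weak_gradientD_inner[OF S wg this, of e]
    have "(\<integral>x. V x * (D\<phi> (x - s *\<^sub>R e) \<bullet> e) \<partial>lebesgue) = - (\<integral>x. d x * \<phi> (x - s *\<^sub>R e) \<partial>lebesgue)"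
      by (simp add: integral_lebesgue_on_eq[OF S'] V_def d_def mult_ac)
    then show ?thesis
      using integral_against_translated_test_function_deriv[OF V \<phi>, of e s] by simp
  qed
  show ?thesis
  proof (rule LIMSEQ_I)
    fix \<epsilon> :: real assume "\<epsilon> > 0"
    have "\<forall>\<^sub>F h in at 0. (\<integral>x. \<bar>d (x + h) - d x\<bar> \<partial>lebesgue) < \<epsilon> / 2"
      by (rule order_tendstoD(2)[OF L1_translation_continuous[OF d]]) (use \<open>\<epsilon> > 0\<close> in simp)
    then obtain \<delta> where \<delta>: "\<delta> > 0"
      "\<And>h. h \<noteq> 0 \<Longrightarrow> norm h < \<delta> \<Longrightarrow> (\<integral>x. \<bar>d (x + h) - d x\<bar> \<partial>lebesgue) < \<epsilon> / 2"
      by (auto simp: eventually_at)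
    then have \<delta>': "(\<integral>x. \<bar>d (x + h) - d x\<bar> \<partial>lebesgue) < \<epsilon> / 2" if "norm h < \<delta>" for h
      using that \<open>\<epsilon> > 0\<close> by (cases "h = 0") auto
    \<comment> \<open>Steps below \<eta> move points by less than \<delta> and by at most \<rho>/2;
      the summand 1 covers \<open>e = 0\<close>.\<close>
    define \<eta> where "\<eta> = min \<delta> (\<rho> / 2) / (norm e + 1)"
    have "\<eta> > 0" using \<delta>(1) \<rho>(1) by (simp add: \<eta>_def add_nonneg_pos)
    then obtain N :: nat where N: "1 / real (Suc N) < \<eta>"
      using nat_approx_posE by blast
    have "norm ((\<integral>x. indicator K x * \<bar>(V (x + (1 / Suc n) *\<^sub>R e) - V x) / (1 / Suc n) - d x\<bar> \<partial>lebesgue) - 0) < \<epsilon>"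
      if n: "n \<ge> N" for n
    proof -
      define t where "t = 1 / real (Suc n)"
      have t: "t > 0" by (simp add: t_def)
      have small: "norm (s *\<^sub>R e) < \<delta>" "norm (s *\<^sub>R e) \<le> \<rho> / 2" if "0 \<le> s" "s \<le> t" for s
      proof -
        have "t \<le> 1 / real (Suc N)"
          using n by (simp add: t_def frac_le)
        then have "s < \<eta>" using N that by linarith
        then have "s * (norm e + 1) < \<eta> * (norm e + 1)"
          by (intro mult_strict_right_mono) (auto simp: add_nonneg_pos)
        also have "\<dots> = min \<delta> (\<rho> / 2)"
          using add_nonneg_pos[OF norm_ge_zero[of e] zero_less_one] by (simp add: \<eta>_def)
        finally have "s * (norm e + 1) < min \<delta> (\<rho> / 2)" .
        moreover have "norm (s *\<^sub>R e) \<le> s * (norm e + 1)"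
          using that by (simp add: algebra_simps)
        ultimately show "norm (s *\<^sub>R e) < \<delta>" "norm (s *\<^sub>R e) \<le> \<rho> / 2" by auto
      qed
      define q where "q x = (V (x + t *\<^sub>R e) - V x) / t - d x" for x
      have Vt: "integrable lebesgue (\<lambda>x. V (x + t *\<^sub>R e))"
        by (rule integrable_lebesgue_translation[OF V])
      have q: "integrable lebesgue q"
        unfolding q_def using V d Vt by simp
      have "(\<integral>x. indicator K x * \<bar>q x\<bar> \<partial>lebesgue) \<le> \<epsilon> / 2"
      proof (rule L1_norm_le_test_functions[OF q K(1) U(2,1)])
        fix \<phi> D\<phi> assume \<phi>: "test_function U \<phi> D\<phi>" and \<phi>1: "\<And>x. \<bar>\<phi> x\<bar> \<le> 1"
        have m: "(\<lambda>x. \<phi> (x - h)) \<in> borel_measurable lebesgue" for h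
          using test_function_continuous(1)[OF \<phi>] by (intro continuous_on_imp_borel_measurable_lebesgue)
            (auto intro!: continuous_intros continuous_on_compose2[of UNIV \<phi>])
        have i: "integrable lebesgue (\<lambda>x. f x * \<phi> (x - h))" if "integrable lebesgue f" for f h
          using that m \<phi>1 by (rule integrable_mult_bounded)
        have shift: "(\<integral>x. f x * \<phi> (x - h) \<partial>lebesgue) = (\<integral>x. f (x + h) * \<phi> x \<partial>lebesgue)"
          if "integrable lebesgue f" for f h
          using integral_lebesgue_translation[of "\<lambda>x. f x * \<phi> (x - h)" h] i[OF that, of h] by simp
        obtain s where s: "0 < s" "s < t" and mvt:
          "(\<integral>x. V x * \<phi> (x - t *\<^sub>R e) \<partial>lebesgue) - (\<integral>x. V x * \<phi> (x - 0 *\<^sub>R e) \<partial>lebesgue) =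
            (t - 0) * (\<integral>x. d x * \<phi> (x - s *\<^sub>R e) \<partial>lebesgue)"
          using MVT2[OF t, of "\<lambda>s. \<integral>x. V x * \<phi> (x - s *\<^sub>R e) \<partial>lebesgue"
             "\<lambda>s. \<integral>x. d x * \<phi> (x - s *\<^sub>R e) \<partial>lebesgue"] J'[OF \<phi> small(2)] by blast
        have "(\<integral>x. \<phi> x * q x \<partial>lebesgue) =
          ((\<integral>x. V (x + t *\<^sub>R e) * \<phi> x \<partial>lebesgue) - (\<integral>x. V x * \<phi> x \<partial>lebesgue)) / t - (\<integral>x. d x * \<phi> x \<partial>lebesgue)"
        proof -
          have "(\<integral>x. \<phi> x * q x \<partial>lebesgue) = (\<integral>x. (V (x + t *\<^sub>R e) * \<phi> x - V x * \<phi> x) / t - d x * \<phi> x \<partial>lebesgue)"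
            by (intro Bochner_Integration.integral_cong) (auto simp: q_def algebra_simps diff_divide_distrib)
          then show ?thesis
            using i[OF Vt, of 0] i[OF V, of 0] i[OF d, of 0] by simp
        qed
        also have "\<dots> = (\<integral>x. d x * \<phi> (x - s *\<^sub>R e) \<partial>lebesgue) - (\<integral>x. d x * \<phi> x \<partial>lebesgue)"
          using mvt t shift[OF V, of "t *\<^sub>R e"] by (simp add: field_simps)
        also have "\<dots> = (\<integral>x. (d (x + s *\<^sub>R e) - d x) * \<phi> x \<partial>lebesgue)"
          using i[OF integrable_lebesgue_translation[OF d, of "s *\<^sub>R e"], of 0] i[OF d, of 0]
          by (simp add: shift[OF d] left_diff_distrib)
        also have "\<dots> \<le> (\<integral>x. \<bar>d (x + s *\<^sub>R e) - d x\<bar> \<partial>lebesgue)"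
        proof (rule integral_mono)
          have dd: "integrable lebesgue (\<lambda>x. d (x + s *\<^sub>R e) - d x)"
            using integrable_lebesgue_translation[OF d, of "s *\<^sub>R e"] d by simp
          show "integrable lebesgue (\<lambda>x. \<bar>d (x + s *\<^sub>R e) - d x\<bar>)" using dd by simp
          show "integrable lebesgue (\<lambda>x. (d (x + s *\<^sub>R e) - d x) * \<phi> x)" using i[OF dd, of 0] by simp
          show "(d (x + s *\<^sub>R e) - d x) * \<phi> x \<le> \<bar>d (x + s *\<^sub>R e) - d x\<bar>" for x
            using abs_ge_self[of "(d (x + s *\<^sub>R e) - d x) * \<phi> x"] mult_left_le[OF \<phi>1[of x] abs_ge_zero[of "d (x + s *\<^sub>R e) - d x"]]
            by (simp add: abs_mult)
        qed
        also have "\<dots> \<le> \<epsilon> / 2"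
          using \<delta>'[OF small(1)[of s]] s by simp
        finally show "(\<integral>x. \<phi> x * q x \<partial>lebesgue) \<le> \<epsilon> / 2" .
      qed
      moreover have "(\<integral>x. indicator K x * \<bar>q x\<bar> \<partial>lebesgue) \<ge> 0"
        by (intro integral_nonneg_AE) auto
      ultimately show ?thesis
        using \<open>\<epsilon> > 0\<close> by (simp add: q_def t_def)
    qed
    then show "\<exists>N. \<forall>n\<ge>N. norm ((\<integral>x. indicator K x * \<bar>(V (x + (1 / Suc n) *\<^sub>R e) - V x) / (1 / Suc n) - d x\<bar> \<partial>lebesgue) - 0) < \<epsilon>"
      by blast
  qed
qed

text \<open>The steps are positive, so these are one-sided quotients. At \<open>a = 0\<close> the
  limit keeps only the positive part of \<open>d\<close>; opposite directions then give limits that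
  do not cancel, which is what \<open>weak_gradient_zero_on_level_set\<close> exploits.\<close>

lemma pos_part_difference_quotient:
  fixes t D :: "nat \<Rightarrow> real" and a d :: real
  assumes "\<And>n. t n > 0" "t \<longlonglongrightarrow> 0" "D \<longlonglongrightarrow> d"
  shows "(\<lambda>n. (max 0 (a + t n * D n) - max 0 a) / t n) \<longlonglongrightarrow>
    (if a > 0 then d else if a = 0 then max 0 d else 0)"
proof -
  have nz: "t n \<noteq> 0" for n using assms(1)[of n] by simp
  have lim: "(\<lambda>n. a + t n * D n) \<longlonglongrightarrow> a + 0 * d"
    by (intro tendsto_intros assms)
  consider "a > 0" | "a = 0" | "a < 0" by linarith
  then show ?thesis
  proof cases
    case 1
    have "\<forall>\<^sub>F n in sequentially. a + t n * D n > 0"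
      using order_tendstoD(1)[OF lim, of 0] 1 by simp
    then have "\<forall>\<^sub>F n in sequentially. D n = (max 0 (a + t n * D n) - max 0 a) / t n"
      using 1 nz by (auto elim!: eventually_mono)
    then show ?thesis using 1 tendsto_cong[THEN iffD1, OF _ assms(3)] by force
  next
    case 2
    have "(max 0 (a + t n * D n) - max 0 a) / t n = max 0 (D n)" for n
      using 2 assms(1)[of n] by (auto simp: max_def zero_le_mult_iff)
    then show ?thesis using 2 by (auto intro!: tendsto_intros assms(3))
  next
    case 3
    have "\<forall>\<^sub>F n in sequentially. a + t n * D n < 0"
      using order_tendstoD(2)[OF lim, of 0] 3 by simp
    then have "\<forall>\<^sub>F n in sequentially. (max 0 (a + t n * D n) - max 0 a) / t n = 0"
      using 3 by (auto elim!: eventually_mono)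
    then show ?thesis using 3 by (simp add: tendsto_eventually)
  qed
qed

text \<open>The quotients \<open>R n\<close> of the positive part converge almost everywhere on
  \<open>K\<close> along a subsequence, but no integrable bound for them is at hand: they are
  bounded by the quotients \<open>D n\<close>, which converge in L^1 only. Clipping to [-|d|, |d|]
  produces \<open>R' n\<close> with the bound |d|. As |R n| \<le> |D n|, the clipping changes them
  by at most |D n - d|, which tends to 0 in L^1 on \<open>K\<close>.\<close>

lemma pos_part_directional:
  fixes v :: "'a::euclidean_space \<Rightarrow> real" and e :: 'a
  assumes S: "open S" and int: "integrable (lebesgue_on S) v" "integrable (lebesgue_on S) G"
    and wg: "has_weak_gradient S v G" and \<phi>: "test_function S \<phi> D\<phi>"
  shows "(LINT x|lebesgue_on S. max 0 (v x) * (D\<phi> x \<bullet> e)) =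
    - (LINT x|lebesgue_on S. \<phi> x * (if v x > 0 then G x \<bullet> e else if v x = 0 then max 0 (G x \<bullet> e) else 0))"
proof -
  have S': "S \<in> sets lebesgue" using S by simp
  define V where "V x = indicator S x * v x" for x
  define d where "d x = indicator S x * (G x \<bullet> e)" for x
  define p where "p x = max 0 (V x)" for x
  define r where "r x = (if V x > 0 then d x else if V x = 0 then max 0 (d x) else 0)" for x
  define t where "t n = 1 / real (Suc n)" for n
  define D where "D n x = (V (x + t n *\<^sub>R e) - V x) / t n" for n x
  define R where "R n x = (p (x + t n *\<^sub>R e) - p x) / t n" for n x
  define R' where "R' n x = max (- \<bar>d x\<bar>) (min \<bar>d x\<bar> (R n x))" for n x
  have t: "t n > 0" for n by (simp add: t_def)
  have t0: "t \<longlonglongrightarrow> 0"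
    unfolding t_def using LIMSEQ_inverse_real_of_nat by (simp add: inverse_eq_divide)
  have V: "integrable lebesgue V"
    using int(1) integrable_lebesgue_on_iff[OF S', of v] by (simp add: V_def[abs_def])
  have "integrable (lebesgue_on S) (\<lambda>x. G x \<bullet> e)"
    using int(2) by simp
  then have d: "integrable lebesgue d"
    using integrable_lebesgue_on_iff[OF S', of "\<lambda>x. G x \<bullet> e"] by (simp add: d_def[abs_def])
  have p: "integrable lebesgue p"
    unfolding p_def using V by simp
  have [measurable]: "V \<in> borel_measurable lebesgue" "d \<in> borel_measurable lebesgue"
    "p \<in> borel_measurable lebesgue"
    using V d p by auto
  obtain K where K: "compact K" "K \<subseteq> S" "\<And>x. x \<notin> K \<Longrightarrow> \<phi> x = 0" "\<And>x. x \<notin> K \<Longrightarrow> D\<phi> x = 0"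
    by (rule test_functionE[OF \<phi>]) (rule that)
  have [measurable]: "K \<in> sets lebesgue" using K(1) by (simp add: compact_imp_closed)
  obtain B where B: "B > 0" "\<And>x. \<bar>\<phi> x\<bar> \<le> B" "\<And>x. norm (D\<phi> x) \<le> B"
    by (rule test_function_bounded[OF \<phi>]) (rule that)
  have m: "(\<lambda>x. \<phi> (x - h)) \<in> borel_measurable lebesgue" for h
    using test_function_continuous(1)[OF \<phi>] by (intro continuous_on_imp_borel_measurable_lebesgue)
      (auto intro!: continuous_intros continuous_on_compose2[of UNIV \<phi>])
  from m[of 0] have [measurable]: "\<phi> \<in> borel_measurable lebesgue" by simp
  have i: "integrable lebesgue (\<lambda>x. f x * \<phi> (x - h))" if "integrable lebesgue f" for f h
    using that m B(2) by (rule integrable_mult_bounded)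
  have shift: "(\<integral>x. f x * \<phi> (x - h) \<partial>lebesgue) = (\<integral>x. f (x + h) * \<phi> x \<partial>lebesgue)"
    if "integrable lebesgue f" for f h
    using integral_lebesgue_translation[of "\<lambda>x. f x * \<phi> (x - h)" h] i[OF that, of h] by simp
  note tr = integrable_lebesgue_translation
  have R: "integrable lebesgue (R n)" for n
    unfolding R_def using p tr[OF p] by simp
  have Dq: "integrable lebesgue (D n)" for n
    unfolding D_def using V tr[OF V] by simp
  have [measurable]: "R n \<in> borel_measurable lebesgue" "D n \<in> borel_measurable lebesgue" for n
    using R Dq by auto
  have R': "integrable lebesgue (R' n)" for n
    unfolding R'_def using R d by simp
  have one: "(\<lambda>n. \<integral>x. R n x * \<phi> x \<partial>lebesgue) \<longlonglongrightarrow> - (\<integral>x. p x * (D\<phi> x \<bullet> e) \<partial>lebesgue)"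
  proof -
    have t_at: "filterlim t (at 0) sequentially"
      using t0 t by (auto simp: filterlim_at intro!: always_eventually less_imp_neq[symmetric])
    from integral_against_translated_test_function_deriv[OF p \<phi>, of e 0]
    have "((\<lambda>h. ((\<integral>x. p x * \<phi> (x - (0 + h) *\<^sub>R e) \<partial>lebesgue) - (\<integral>x. p x * \<phi> (x - 0 *\<^sub>R e) \<partial>lebesgue)) / h)
        \<longlongrightarrow> - (\<integral>x. p x * (D\<phi> (x - 0 *\<^sub>R e) \<bullet> e) \<partial>lebesgue)) (at 0)"
      by (simp add: DERIV_def)
    from filterlim_compose[OF this t_at]
    have "(\<lambda>n. ((\<integral>x. p x * \<phi> (x - t n *\<^sub>R e) \<partial>lebesgue) - (\<integral>x. p x * \<phi> x \<partial>lebesgue)) / t n)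
        \<longlonglongrightarrow> - (\<integral>x. p x * (D\<phi> x \<bullet> e) \<partial>lebesgue)"
      by simp
    moreover have "((\<integral>x. p x * \<phi> (x - t n *\<^sub>R e) \<partial>lebesgue) - (\<integral>x. p x * \<phi> x \<partial>lebesgue)) / t n =
       (\<integral>x. R n x * \<phi> x \<partial>lebesgue)" for n
    proof -
      have "(\<integral>x. R n x * \<phi> x \<partial>lebesgue) = (\<integral>x. (p (x + t n *\<^sub>R e) * \<phi> x - p x * \<phi> x) / t n \<partial>lebesgue)"
        by (intro Bochner_Integration.integral_cong) (auto simp: R_def algebra_simps diff_divide_distrib)
      then show ?thesis
        using i[OF p, of 0] i[OF tr[OF p, of "t n *\<^sub>R e"], of 0] shift[OF p, of "t n *\<^sub>R e"] by simp
    qed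
    ultimately show ?thesis by simp
  qed
  have L1: "(\<lambda>n. \<integral>x. indicator K x * \<bar>D n x - d x\<bar> \<partial>lebesgue) \<longlonglongrightarrow> 0"
    using difference_quotient_tendsto_weak_gradient[OF S int wg K(1,2), of e]
    unfolding D_def t_def V_def d_def .
  have Dint: "integrable lebesgue (\<lambda>x. indicator K x * \<bar>D n x - d x\<bar>)" for n
    using Dq d integrable_real_mult_indicator[of K lebesgue "\<lambda>x. \<bar>D n x - d x\<bar>"]
    by (simp add: mult.commute)
  have two: "(\<lambda>n. \<integral>x. (R n x - R' n x) * \<phi> x \<partial>lebesgue) \<longlonglongrightarrow> 0"
  proof (rule Lim_null_comparison)
    show "\<forall>\<^sub>F n in sequentially. norm (\<integral>x. (R n x - R' n x) * \<phi> x \<partial>lebesgue) \<le>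
        B * (\<integral>x. indicator K x * \<bar>D n x - d x\<bar> \<partial>lebesgue)"
    proof (rule always_eventually, rule allI)
      fix n
      have "norm (\<integral>x. (R n x - R' n x) * \<phi> x \<partial>lebesgue) \<le> (\<integral>x. B * (indicator K x * \<bar>D n x - d x\<bar>) \<partial>lebesgue)"
      proof (rule order_trans[OF integral_norm_bound integral_mono])
        show "integrable lebesgue (\<lambda>x. norm ((R n x - R' n x) * \<phi> x))"
          using R R' i[of "\<lambda>x. R n x - R' n x" 0] by (intro integrable_norm) simp
        show "integrable lebesgue (\<lambda>x. B * (indicator K x * \<bar>D n x - d x\<bar>))"
          using Dint by simp
        fix x
        show "norm ((R n x - R' n x) * \<phi> x) \<le> B * (indicator K x * \<bar>D n x - d x\<bar>)"
        proof (cases "x \<in> K")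
          case True
          have "\<bar>p (x + t n *\<^sub>R e) - p x\<bar> \<le> \<bar>V (x + t n *\<^sub>R e) - V x\<bar>"
            by (auto simp: p_def)
          then have "\<bar>R n x\<bar> \<le> \<bar>D n x\<bar>"
            using t[of n] by (simp add: R_def D_def abs_divide divide_right_mono)
          then have "\<bar>R n x - R' n x\<bar> \<le> \<bar>D n x - d x\<bar>"
            by (auto simp: R'_def)
          then have "\<bar>R n x - R' n x\<bar> * \<bar>\<phi> x\<bar> \<le> \<bar>D n x - d x\<bar> * B"
            using B by (intro mult_mono) auto
          then show ?thesis using True by (simp add: abs_mult mult.commute)
        qed (simp add: K(3))
      qed
      then show "norm (\<integral>x. (R n x - R' n x) * \<phi> x \<partial>lebesgue) \<le>
        B * (\<integral>x. indicator K x * \<bar>D n x - d x\<bar> \<partial>lebesgue)" by simp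
    qed
    show "(\<lambda>n. B * (\<integral>x. indicator K x * \<bar>D n x - d x\<bar> \<partial>lebesgue)) \<longlonglongrightarrow> 0"
      using tendsto_mult[OF tendsto_const[of B] L1] by simp
  qed
  from tendsto_diff[OF one two]
  have three: "(\<lambda>n. \<integral>x. R' n x * \<phi> x \<partial>lebesgue) \<longlonglongrightarrow> - (\<integral>x. p x * (D\<phi> x \<bullet> e) \<partial>lebesgue)"
    using i[OF R, of _ 0] i[OF R', of _ 0] by (simp add: left_diff_distrib)
  \<comment> \<open>L^1 convergence gives pointwise convergence along a subsequence, which is enough
    because the limit of the full sequence of integrals is already known from
    \<open>three\<close>.\<close>
  have "\<exists>k. strict_mono k \<and> (AE x in lebesgue. (\<lambda>n. indicator K x * \<bar>D (k n) x - d x\<bar>) \<longlonglongrightarrow> 0)"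
    using tendsto_L1_AE_subseq[of lebesgue "\<lambda>n x. indicator K x * \<bar>D n x - d x\<bar>"] Dint L1
    by (simp add: abs_mult)
  then obtain k where k: "strict_mono k"
    "AE x in lebesgue. (\<lambda>n. indicator K x * \<bar>D (k n) x - d x\<bar>) \<longlonglongrightarrow> 0"
    by blast
  have "(\<lambda>n. \<integral>x. R' (k n) x * \<phi> x \<partial>lebesgue) \<longlonglongrightarrow> (\<integral>x. r x * \<phi> x \<partial>lebesgue)"
  proof (rule integral_dominated_convergence[where w="\<lambda>x. \<bar>d x\<bar> * B"])
    show "(\<lambda>x. r x * \<phi> x) \<in> borel_measurable lebesgue"
      unfolding r_def by measurable
    show "(\<lambda>x. R' (k n) x * \<phi> x) \<in> borel_measurable lebesgue" for n
      unfolding R'_def by measurable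
    show "integrable lebesgue (\<lambda>x. \<bar>d x\<bar> * B)" using d by simp
    show "AE x in lebesgue. norm (R' (k n) x * \<phi> x) \<le> \<bar>d x\<bar> * B" for n
    proof (rule AE_I2)
      fix x
      have "\<bar>R' (k n) x\<bar> \<le> \<bar>d x\<bar>" by (auto simp: R'_def)
      then show "norm (R' (k n) x * \<phi> x) \<le> \<bar>d x\<bar> * B"
        using B unfolding real_norm_def abs_mult by (intro mult_mono) auto
    qed
    show "AE x in lebesgue. (\<lambda>n. R' (k n) x * \<phi> x) \<longlonglongrightarrow> r x * \<phi> x"
      using k(2)
    proof eventually_elim
      case (elim x)
      show ?case
      proof (cases "x \<in> K")
        case True
        with elim have "(\<lambda>n. D (k n) x - d x) \<longlonglongrightarrow> 0"
          by (simp add: tendsto_rabs_zero_iff)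
        then have Dd: "(\<lambda>n. D (k n) x) \<longlonglongrightarrow> d x"
          by (simp add: LIM_zero_iff)
        have tk: "(\<lambda>n. t (k n)) \<longlonglongrightarrow> 0"
          using LIMSEQ_subseq_LIMSEQ[OF t0 k(1)] by (simp add: o_def)
        have "R (k n) x = (max 0 (V x + t (k n) * D (k n) x) - max 0 (V x)) / t (k n)" for n
          using t[of "k n"] by (simp add: R_def p_def D_def)
        then have "(\<lambda>n. R (k n) x) \<longlonglongrightarrow> r x"
          using pos_part_difference_quotient[of "\<lambda>n. t (k n)" "\<lambda>n. D (k n) x", OF t tk Dd, of "V x"]
          by (simp add: r_def)
        then have "(\<lambda>n. R' (k n) x) \<longlonglongrightarrow> max (- \<bar>d x\<bar>) (min \<bar>d x\<bar> (r x))"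
          unfolding R'_def by (intro tendsto_intros)
        moreover have "max (- \<bar>d x\<bar>) (min \<bar>d x\<bar> (r x)) = r x"
          by (auto simp: r_def)
        ultimately show ?thesis by (auto intro: tendsto_intros)
      qed (simp add: K(3))
    qed
  qed
  from LIMSEQ_unique[OF this]
  have eq: "(\<integral>x. r x * \<phi> x \<partial>lebesgue) = - (\<integral>x. p x * (D\<phi> x \<bullet> e) \<partial>lebesgue)"
    using LIMSEQ_subseq_LIMSEQ[OF three k(1)] by (simp add: o_def)
  have "(LINT x|lebesgue_on S. max 0 (v x) * (D\<phi> x \<bullet> e)) = (\<integral>x. p x * (D\<phi> x \<bullet> e) \<partial>lebesgue)"
    unfolding integral_lebesgue_on_eq[OF S']
    by (intro Bochner_Integration.integral_cong) (auto simp: p_def V_def indicator_def)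
  moreover have "(LINT x|lebesgue_on S. \<phi> x * (if v x > 0 then G x \<bullet> e else if v x = 0 then max 0 (G x \<bullet> e) else 0))
      = (\<integral>x. r x * \<phi> x \<partial>lebesgue)"
    unfolding integral_lebesgue_on_eq[OF S']
    using K(2,3) by (intro Bochner_Integration.integral_cong) (auto simp: r_def V_def d_def indicator_def)
  ultimately show ?thesis using eq by simp
qed

text \<open>One-sided difference quotients in the directions \<open>e\<close> and \<open>-e\<close> give two values for the weak
  derivative of the positive part, which differ by \<open>\<bar>G \<bullet> e\<bar>\<close> on the zero set.\<close>

lemma weak_gradient_zero_on_level_set:
  fixes v :: "'a::euclidean_space \<Rightarrow> real"
  assumes S: "open S" and int: "integrable (lebesgue_on S) v" "integrable (lebesgue_on S) G"
    and wg: "has_weak_gradient S v G"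
  shows "AE x in lebesgue_on S. v x = 0 \<longrightarrow> G x = 0"
proof -
  have [measurable]: "v \<in> borel_measurable (lebesgue_on S)" "G \<in> borel_measurable (lebesgue_on S)"
    using int by auto
  define r where "r e x = (if v x > 0 then G x \<bullet> e else if v x = 0 then max 0 (G x \<bullet> e) else 0)" for e x
  have r_int: "integrable (lebesgue_on S) (r e)" for e
  proof (rule Bochner_Integration.integrable_bound)
    show "integrable (lebesgue_on S) (\<lambda>x. G x \<bullet> e)" using int(2) by simp
    show "r e \<in> borel_measurable (lebesgue_on S)" unfolding r_def by measurable
  qed (auto simp: r_def)
  have "AE x in lebesgue_on S. r e x + r (- e) x = 0" for e
  proof (rule AE_zero_if_test_integrals_zero[OF S])
    show "locally_integrable_on S (\<lambda>x. r e x + r (- e) x)"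
      using r_int by (intro integrable_imp_locally_integrable_on[OF S]) simp
    fix \<phi> D\<phi> assume \<phi>: "test_function S \<phi> D\<phi>"
    have i: "integrable (lebesgue_on S) (\<lambda>x. \<phi> x * r e x)" for e
      using test_function_times_locally_integrable(1)[OF integrable_imp_locally_integrable_on[OF S r_int] S \<phi>]
      by simp
    have "(LINT x|lebesgue_on S. \<phi> x * r e x) = - (LINT x|lebesgue_on S. max 0 (v x) * (D\<phi> x \<bullet> e))" for e
      using pos_part_directional[OF S int wg \<phi>, of e] unfolding r_def by simp
    from this[of e] this[of "- e"] show "(LINT x|lebesgue_on S. \<phi> x * (r e x + r (- e) x)) = 0"
      using i by (simp add: distrib_left)
  qed
  then have "AE x in lebesgue_on S. \<forall>b\<in>Basis. r b x + r (- b) x = 0"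
    by (intro AE_finite_allI) auto
  then show ?thesis
  proof eventually_elim
    case (elim x)
    show ?case
    proof (intro impI, rule euclidean_eqI)
      fix b :: 'a assume "v x = 0" "b \<in> Basis"
      with elim show "G x \<bullet> b = 0 \<bullet> b" by (force simp: r_def max_def split: if_splits)
    qed
  qed
qed

text \<open>On the zero set the formula of \<open>pos_part_directional\<close> contains
  \<open>max 0 (G x \<bullet> e)\<close>, which is not linear in the direction; it vanishes because
  \<open>G\<close> is 0 almost everywhere there.\<close>

lemma has_weak_gradient_pos_part:
  fixes v :: "'a::euclidean_space \<Rightarrow> real"
  assumes S: "open S" and int: "integrable (lebesgue_on S) v" "integrable (lebesgue_on S) G"
    and wg: "has_weak_gradient S v G"
  shows "has_weak_gradient S (\<lambda>x. max 0 (v x)) (\<lambda>x. if v x > 0 then G x else 0)"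
proof (rule has_weak_gradientI_inner[OF S])
  have [measurable]: "v \<in> borel_measurable (lebesgue_on S)" "G \<in> borel_measurable (lebesgue_on S)"
    using int by auto
  show "locally_integrable_on S (\<lambda>x. max 0 (v x))"
    using int by (intro integrable_imp_locally_integrable_on[OF S]) simp
  have "integrable (lebesgue_on S) (\<lambda>x. if v x > 0 then G x else 0)"
  proof (rule Bochner_Integration.integrable_bound[OF int(2)])
    show "(\<lambda>x. if v x > 0 then G x else 0) \<in> borel_measurable (lebesgue_on S)"
      by (intro measurable_If) measurable
  qed auto
  then show "locally_integrable_on S (\<lambda>x. if v x > 0 then G x else 0)"
    by (intro integrable_imp_locally_integrable_on[OF S])
  fix \<phi> D\<phi> and e :: 'a assume \<phi>: "test_function S \<phi> D\<phi>"
  have [measurable]: "\<phi> \<in> borel_measurable (lebesgue_on S)"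
    using continuous_on_imp_borel_measurable_lebesgue[OF test_function_continuous(1)[OF \<phi>]]
    by (rule measurable_restrict_space1)
  have "(LINT x|lebesgue_on S. \<phi> x * (if v x > 0 then G x \<bullet> e else if v x = 0 then max 0 (G x \<bullet> e) else 0)) =
     (LINT x|lebesgue_on S. \<phi> x * ((if v x > 0 then G x else 0) \<bullet> e))"
  proof (rule integral_cong_AE)
    show "AE x in lebesgue_on S. \<phi> x * (if v x > 0 then G x \<bullet> e else if v x = 0 then max 0 (G x \<bullet> e) else 0) =
        \<phi> x * ((if v x > 0 then G x else 0) \<bullet> e)"
      using weak_gradient_zero_on_level_set[OF assms] by eventually_elim auto
  qed measurable
  then show "(LINT x|lebesgue_on S. max 0 (v x) * (D\<phi> x \<bullet> e)) =
      - (LINT x|lebesgue_on S. \<phi> x * ((if v x > 0 then G x else 0) \<bullet> e))"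
    using pos_part_directional[OF S int wg \<phi>, of e] by simp
qed

section \<open>An abstract minimax theorem\<close>

text \<open>Almost minimisers of \<open>q\<close> over the sets \<open>C n\<close> form a Cauchy sequence by the parallelogram identity.\<close>

lemma nested_midconvex_Cauchy:
  fixes q :: "'a \<Rightarrow> real" and D :: "'a \<Rightarrow> 'a \<Rightarrow> real" and mid :: "'a \<Rightarrow> 'a \<Rightarrow> 'a" and C :: "nat \<Rightarrow> 'a set"
  assumes par: "\<And>x y. x \<in> C 0 \<Longrightarrow> y \<in> C 0 \<Longrightarrow> D x y = 2 * q x + 2 * q y - 4 * q (mid x y)"
    and dec: "\<And>n. C (Suc n) \<subseteq> C n" and ne: "\<And>n. C n \<noteq> {}"
    and mid: "\<And>n x y. x \<in> C n \<Longrightarrow> y \<in> C n \<Longrightarrow> mid x y \<in> C n"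
    and q0: "\<And>x. x \<in> C 0 \<Longrightarrow> 0 \<le> q x" and qM: "\<And>x. x \<in> C 0 \<Longrightarrow> q x \<le> M"
  obtains y where "\<And>n. y n \<in> C n" "\<And>e. e > 0 \<Longrightarrow> \<exists>N. \<forall>m\<ge>N. \<forall>n\<ge>N. D (y m) (y n) < e"
proof -
  have sub: "C n \<subseteq> C m" if "m \<le> n" for m n
    using lift_Suc_antimono_le[of C, OF dec that] .
  have sub0: "x \<in> C 0" if "x \<in> C n" for x n
    using sub[of 0 n] that by auto
  define I where "I n = Inf (q ` C n)" for n
  have bdd: "bdd_below (q ` C n)" for n
    using q0 sub0 by (auto intro!: bdd_belowI[of _ 0])
  have I_le: "I n \<le> q x" if "x \<in> C n" for n x
    unfolding I_def using that bdd by (auto intro: cInf_lower)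
  have "\<exists>x\<in>C n. q x < I n + 1 / real (Suc n)" for n
    using cInf_lessD[of "q ` C n" "I n + 1 / real (Suc n)"] ne[of n] by (auto simp: I_def)
  then obtain y where y: "\<And>n. y n \<in> C n" "\<And>n. q (y n) < I n + 1 / real (Suc n)"
    by metis
  have I_mono: "incseq I"
    unfolding incseq_def I_def by (intro allI impI cInf_superset_mono image_mono sub bdd) (use ne in auto)
  have "I n \<le> M" for n
    using I_le[OF y(1)] qM[OF sub0[OF y(1)]] by (meson order_trans)
  then obtain l where l: "I \<longlonglongrightarrow> l" "\<And>n. I n \<le> l"
    using incseq_convergent[OF I_mono] by metis
  show ?thesis
  proof (rule that[OF y(1)])
    fix e :: real assume "e > 0"
    have "(\<lambda>n. 4 * (l + inverse (real (Suc n))) - 4 * I n) \<longlonglongrightarrow> 4 * (l + 0) - 4 * l"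
      by (intro tendsto_intros l LIMSEQ_inverse_real_of_nat)
    then have "\<forall>\<^sub>F n in sequentially. 4 * (l + inverse (real (Suc n))) - 4 * I n < e"
      using \<open>e > 0\<close> by (intro order_tendstoD(2)[where y=0]) simp_all
    then obtain N where N': "4 * (l + inverse (real (Suc N))) - 4 * I N < e"
      by (auto dest: eventually_happens)
    define r where "r = 1 / real (Suc N)"
    have N: "4 * (l + r) - 4 * I N < e"
      using N' by (simp add: r_def inverse_eq_divide)
    have q_le: "q (y n) \<le> l + r" if "n \<ge> N" for n
    proof -
      have "1 / real (Suc n) \<le> r" using that by (simp add: r_def frac_le)
      then show ?thesis using y(2)[of n] l(2)[of n] by linarith
    qed
    \<comment> \<open>Midpoints stay in \<open>C N\<close>, so \<open>q\<close> is at least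
      \<open>I N\<close> there, while \<open>q\<close> is at most \<open>l + r\<close> at both end
      points: the parallelogram identity leaves at most 4 (l + r) - 4 I N.\<close>
    have "D (y m) (y n) < e" if "m \<ge> N" "n \<ge> N" for m n
    proof -
      have "y m \<in> C N" "y n \<in> C N" using sub that y(1) by blast+
      then have "I N \<le> q (mid (y m) (y n))" by (intro I_le mid)
      then show ?thesis
        using par[OF sub0[OF y(1)[of m]] sub0[OF y(1)[of n]]] q_le[OF that(1)] q_le[OF that(2)] N by argo
    qed
    then show "\<exists>N. \<forall>m\<ge>N. \<forall>n\<ge>N. D (y m) (y n) < e" by blast
  qed
qed

text \<open>\<open>q\<close> plays the squared norm and \<open>D\<close> the squared distance.
  Midpoints and convex combinations are given as operations, and \<open>D\<close> may vanish for
  distinct elements, because the elements will be functions that are not identified up to null sets.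
  \<open>D\<close> is a square, so its triangle inequality carries the factor 2.
  \<open>X_compact\<close> stands for weak compactness of \<open>X\<close>: from nested non-empty
  midpoint-convex subsets one can pick elements whose payoffs converge, against every
  \<open>v\<close>, to those of a single \<open>z\<close>; this \<open>z\<close> is only asked to
  lie in \<open>X\<close>.\<close>

locale quadratic_game =
  fixes W :: "'a set" and mid :: "'a \<Rightarrow> 'a \<Rightarrow> 'a" and q :: "'a \<Rightarrow> real" and D :: "'a \<Rightarrow> 'a \<Rightarrow> real"
    and X :: "'b set" and cv :: "real \<Rightarrow> 'b \<Rightarrow> 'b \<Rightarrow> 'b" and L :: "'a \<Rightarrow> 'b \<Rightarrow> real"
  assumes W_ne: "W \<noteq> {}" and X_ne: "X \<noteq> {}"
    and W_mid: "v \<in> W \<Longrightarrow> w \<in> W \<Longrightarrow> mid v w \<in> W"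
    and W_par: "v \<in> W \<Longrightarrow> w \<in> W \<Longrightarrow> D v w = 2 * q v + 2 * q w - 4 * q (mid v w)"
    and q_nonneg: "v \<in> W \<Longrightarrow> 0 \<le> q v"
    and D_nonneg: "v \<in> W \<Longrightarrow> w \<in> W \<Longrightarrow> 0 \<le> D v w"
    and D_triangle: "v \<in> W \<Longrightarrow> w \<in> W \<Longrightarrow> z \<in> W \<Longrightarrow> D v z \<le> 2 * D v w + 2 * D w z"
    and W_complete: "(\<And>n. y n \<in> W) \<Longrightarrow> (\<And>e. e > 0 \<Longrightarrow> \<exists>N. \<forall>m\<ge>N. \<forall>n\<ge>N. D (y m) (y n) < e) \<Longrightarrow>
      \<exists>z\<in>W. (\<lambda>n. D (y n) z) \<longlonglongrightarrow> 0"
    and q_cont: "(\<And>n. y n \<in> W) \<Longrightarrow> z \<in> W \<Longrightarrow> (\<lambda>n. D (y n) z) \<longlonglongrightarrow> 0 \<Longrightarrow> (\<lambda>n. q (y n)) \<longlonglongrightarrow> q z"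
    and L_cont: "(\<And>n. y n \<in> W) \<Longrightarrow> z \<in> W \<Longrightarrow> (\<lambda>n. D (y n) z) \<longlonglongrightarrow> 0 \<Longrightarrow> chi \<in> X \<Longrightarrow>
      (\<lambda>n. L (y n) chi) \<longlonglongrightarrow> L z chi"
    and coercive: "\<exists>M. \<forall>v\<in>W. \<forall>chi\<in>X. L v chi \<le> b \<longrightarrow> q v \<le> M"
    and L_bdd_below: "\<exists>m. \<forall>v\<in>W. \<forall>chi\<in>X. m \<le> L v chi"
    and L_bdd_above: "v \<in> W \<Longrightarrow> \<exists>b. \<forall>chi\<in>X. L v chi \<le> b"
    and L_midconvex: "v \<in> W \<Longrightarrow> w \<in> W \<Longrightarrow> chi \<in> X \<Longrightarrow> L (mid v w) chi \<le> (L v chi + L w chi) / 2"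
    and X_cv: "0 \<le> t \<Longrightarrow> t \<le> 1 \<Longrightarrow> chi \<in> X \<Longrightarrow> xi \<in> X \<Longrightarrow> cv t chi xi \<in> X"
    and L_concave: "0 \<le> t \<Longrightarrow> t \<le> 1 \<Longrightarrow> v \<in> W \<Longrightarrow> chi \<in> X \<Longrightarrow> xi \<in> X \<Longrightarrow>
      (1 - t) * L v chi + t * L v xi \<le> L v (cv t chi xi)"
    and X_compact: "(\<And>n. C n \<subseteq> X) \<Longrightarrow> (\<And>n. C n \<noteq> {}) \<Longrightarrow> (\<And>n. C (Suc n) \<subseteq> C n) \<Longrightarrow>
      (\<And>n chi xi. chi \<in> C n \<Longrightarrow> xi \<in> C n \<Longrightarrow> cv (1/2) chi xi \<in> C n) \<Longrightarrow>
      \<exists>y. \<exists>z\<in>X. (\<forall>n. y n \<in> C n) \<and> (\<forall>v\<in>W. (\<lambda>n. L v (y n)) \<longlonglongrightarrow> L v z)"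
begin

lemma D_tendsto_0_triangle:
  assumes "\<And>n. y n \<in> W" "\<And>n. w n \<in> W" "z \<in> W"
    and "(\<lambda>n. D (w n) (y n)) \<longlonglongrightarrow> 0" "(\<lambda>n. D (y n) z) \<longlonglongrightarrow> 0"
  shows "(\<lambda>n. D (w n) z) \<longlonglongrightarrow> 0"
proof (rule tendsto_sandwich)
  show "\<forall>\<^sub>F n in sequentially. 0 \<le> D (w n) z"
    using assms D_nonneg by simp
  show "\<forall>\<^sub>F n in sequentially. D (w n) z \<le> 2 * D (w n) (y n) + 2 * D (y n) z"
    using assms D_triangle by simp
  show "(\<lambda>n. 2 * D (w n) (y n) + 2 * D (y n) z) \<longlonglongrightarrow> 0"
    using tendsto_add[OF tendsto_mult[OF tendsto_const[of 2] assms(4)] tendsto_mult[OF tendsto_const[of 2] assms(5)]]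
    by simp
qed simp

text \<open>With the strictly convex perturbation \<open>\<epsilon> q\<close> near-minimisers converge, so that the classical
  argument works: vary the maximiser \<open>\<chi>\<close> of the dual problem towards \<open>\<xi>\<close>.\<close>

lemma perturbed_saddle_point:
  assumes eps: "\<epsilon> > 0"
  shows "\<exists>v\<in>W. \<exists>chi\<in>X. \<exists>c. (\<forall>xi\<in>X. L v xi + \<epsilon> * q v \<le> c) \<and> (\<forall>w\<in>W. c \<le> L w chi + \<epsilon> * q w)"
proof -
  define Le where "Le v chi = L v chi + \<epsilon> * q v" for v chi
  obtain m where m: "\<And>v chi. v \<in> W \<Longrightarrow> chi \<in> X \<Longrightarrow> m \<le> L v chi"
    using L_bdd_below by blast
  have m': "m \<le> Le v chi" if "v \<in> W" "chi \<in> X" for v chi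
    using m[OF that] q_nonneg[OF that(1)] eps by (simp add: Le_def add_increasing2)
  obtain v0 where v0: "v0 \<in> W" using W_ne by blast
  obtain b where b: "\<And>chi. chi \<in> X \<Longrightarrow> L v0 chi \<le> b" using L_bdd_above[OF v0] by blast
  define f where "f chi = (INF v\<in>W. Le v chi)" for chi
  have bdd: "bdd_below ((\<lambda>v. Le v chi) ` W)" if "chi \<in> X" for chi
    using m' that by (auto intro!: bdd_belowI[of _ m])
  have f_le: "f chi \<le> Le v chi" if "v \<in> W" "chi \<in> X" for v chi
    unfolding f_def using that bdd by (intro cINF_lower) auto
  have f_ge: "r \<le> f chi" if "\<And>v. v \<in> W \<Longrightarrow> r \<le> Le v chi" for r chi
    unfolding f_def using that W_ne by (intro cINF_greatest) auto
  have near: "\<exists>v\<in>W. Le v chi \<le> f chi + r" if "r > 0" "chi \<in> X" for r chi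
  proof -
    have "\<exists>x\<in>(\<lambda>v. Le v chi) ` W. x < f chi + r"
      using that W_ne by (intro cInf_lessD) (auto simp: f_def)
    then show ?thesis by force
  qed
  have Le_conc: "(1 - t) * Le v chi + t * Le v xi \<le> Le v (cv t chi xi)"
    if "0 \<le> t" "t \<le> 1" "v \<in> W" "chi \<in> X" "xi \<in> X" for t v chi xi
    using L_concave[OF that] by (simp add: Le_def algebra_simps)
  \<comment> \<open>The parallelogram identity turns \<epsilon> \<open>q\<close> into a modulus of
    convexity: the midpoint gains \<epsilon> D / 4.\<close>
  have Le_conv: "Le (mid v w) chi \<le> (Le v chi + Le w chi) / 2 - \<epsilon> * D v w / 4"
    if "v \<in> W" "w \<in> W" "chi \<in> X" for v w chi
  proof -
    have q_mid: "q (mid v w) = (q v + q w) / 2 - D v w / 4"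
      using W_par[OF that(1,2)] by (simp add: field_simps)
    then show ?thesis
      using L_midconvex[OF that] unfolding Le_def q_mid
      by (simp add: algebra_simps add_divide_distrib)
  qed
  define c where "c = (SUP chi\<in>X. f chi)"
  have fb: "f chi \<le> b + \<epsilon> * q v0" if "chi \<in> X" for chi
    using f_le[OF v0 that] b[OF that] by (simp add: Le_def)
  have f_c: "f chi \<le> c" if "chi \<in> X" for chi
    unfolding c_def using that fb by (intro cSUP_upper bdd_aboveI[of _ "b + \<epsilon> * q v0"]) auto
  \<comment> \<open>Superlevel sets of the dual functional \<open>f\<close>. They are convex,
    \<open>f\<close> being an infimum of concave functions, and the payoffs of elements picked from
    them converge to those of a maximiser.\<close>
  define C where "C n = {chi \<in> X. c - 1 / real (Suc n) \<le> f chi}" for n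
  have "\<exists>y. \<exists>z\<in>X. (\<forall>n. y n \<in> C n) \<and> (\<forall>v\<in>W. (\<lambda>n. L v (y n)) \<longlonglongrightarrow> L v z)"
  proof (rule X_compact)
    show "C n \<noteq> {}" for n
    proof -
      have "\<exists>x\<in>f ` X. c - 1 / real (Suc n) < x"
        using X_ne by (intro less_cSupD) (auto simp: c_def)
      then show ?thesis by (auto simp: C_def intro: less_imp_le)
    qed
    show "C (Suc n) \<subseteq> C n" for n
    proof -
      have "1 / real (Suc (Suc n)) \<le> 1 / real (Suc n)" by (intro divide_left_mono) auto
      then show ?thesis by (auto simp: C_def)
    qed
    show "cv (1/2) chi xi \<in> C n" if "chi \<in> C n" "xi \<in> C n" for n chi xi
    proof -
      have X: "chi \<in> X" "xi \<in> X" using that by (auto simp: C_def)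
      have "c - 1 / real (Suc n) \<le> Le v (cv (1/2) chi xi)" if v: "v \<in> W" for v
        using Le_conc[of "1/2", OF _ _ v X] f_le[OF v X(1)] f_le[OF v X(2)]
          \<open>chi \<in> C n\<close> \<open>xi \<in> C n\<close> by (simp add: C_def)
      then show ?thesis using X_cv[of "1/2", OF _ _ X] f_ge by (auto simp: C_def)
    qed
  qed (auto simp: C_def)
  then obtain y chi where chi: "chi \<in> X" and y: "\<And>n. y n \<in> C n"
    and lim: "\<And>v. v \<in> W \<Longrightarrow> (\<lambda>n. L v (y n)) \<longlonglongrightarrow> L v chi"
    by blast
  have inv0: "(\<lambda>n. 1 / real (Suc n)) \<longlonglongrightarrow> 0"
    using LIMSEQ_inverse_real_of_nat by (simp add: inverse_eq_divide)
  have chi_max: "c \<le> Le v chi" if v: "v \<in> W" for v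
  proof (rule LIMSEQ_le)
    show "(\<lambda>n. c - 1 / real (Suc n)) \<longlonglongrightarrow> c"
      using tendsto_diff[OF tendsto_const[of c] inv0] by simp
    show "(\<lambda>n. Le v (y n)) \<longlonglongrightarrow> Le v chi"
      unfolding Le_def by (intro tendsto_intros lim v)
    show "\<exists>N. \<forall>n\<ge>N. c - 1 / real (Suc n) \<le> Le v (y n)"
    proof (intro exI[of _ 0] allI impI)
      fix n
      show "c - 1 / real (Suc n) \<le> Le v (y n)"
        using y[of n] f_le[OF v, of "y n"] by (simp add: C_def)
    qed
  qed
  have fchi: "f chi = c"
    using f_ge[of c chi] chi_max f_c[OF chi] by force
  \<comment> \<open>For two states within \<open>r\<close> of the minimum the midpoint is not below
    \<open>c\<close>, so the gain in \<open>Le_conv\<close> is at most \<open>r\<close>.\<close>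
  have D_le: "D v w \<le> (4 / \<epsilon>) * r" if "v \<in> W" "w \<in> W" "Le v chi \<le> c + r" "Le w chi \<le> c + r" for v w r
  proof -
    have "c \<le> Le (mid v w) chi" using chi_max[OF W_mid[OF that(1,2)]] .
    with Le_conv[OF that(1,2) chi] that(3,4) have "\<epsilon> * D v w \<le> 4 * r" by argo
    then show ?thesis using eps by (simp add: field_simps)
  qed
  have "\<exists>v\<in>W. Le v chi \<le> c + 1 / real (Suc n)" for n
    using near[of "1 / real (Suc n)" chi] chi fchi by simp
  then obtain w where w: "\<And>n. w n \<in> W" "\<And>n. Le (w n) chi \<le> c + 1 / real (Suc n)"
    by metis
  have "\<exists>z\<in>W. (\<lambda>n. D (w n) z) \<longlonglongrightarrow> 0"
  proof (rule W_complete[OF w(1)])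
    fix e :: real assume "e > 0"
    then obtain N :: nat where N: "1 / real (Suc N) < e * \<epsilon> / 4"
      using nat_approx_posE[of "e * \<epsilon> / 4"] eps by auto
    have "D (w k) (w n) < e" if "k \<ge> N" "n \<ge> N" for k n
    proof -
      have "Le (w i) chi \<le> c + 1 / real (Suc N)" if "i \<ge> N" for i
        using w(2)[of i] frac_le[of 1 1 "real (Suc N)" "real (Suc i)"] that by auto
      then have "D (w k) (w n) \<le> (4 / \<epsilon>) * (1 / real (Suc N))"
        using that by (intro D_le w(1))
      also have "\<dots> < (4 / \<epsilon>) * (e * \<epsilon> / 4)"
        using N eps by (intro mult_strict_left_mono) auto
      finally show ?thesis using eps by simp
    qed
    then show "\<exists>N. \<forall>k\<ge>N. \<forall>n\<ge>N. D (w k) (w n) < e" by blast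
  qed
  then obtain z where z: "z \<in> W" "(\<lambda>n. D (w n) z) \<longlonglongrightarrow> 0" by blast
  have "Le z xi \<le> c" if xi: "xi \<in> X" for xi
  proof -
    \<comment> \<open>Starting at 1/2 keeps \<open>1 - t n\<close> positive, by which
      \<open>r\<close> divides.\<close>
    define t where "t n = 1 / real (Suc (Suc n))" for n
    have t: "0 < t n" "t n < 1" for n by (auto simp: t_def)
    have t0: "t \<longlonglongrightarrow> 0"
      unfolding t_def using LIMSEQ_Suc[OF inv0] by simp
    have X_t: "cv (t n) chi xi \<in> X" for n
      using X_cv chi xi t[of n] by simp
    \<comment> \<open>The tolerance \<open>t n * t n\<close> is of second order, so that it still
      tends to 0 after the division by \<open>t n\<close> in \<open>le1\<close>.\<close>
    have "\<exists>v\<in>W. Le v (cv (t n) chi xi) \<le> f (cv (t n) chi xi) + t n * t n" for n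
      using near[OF _ X_t, of "t n * t n"] t by simp
    then obtain v where v: "\<And>n. v n \<in> W"
      "\<And>n. Le (v n) (cv (t n) chi xi) \<le> f (cv (t n) chi xi) + t n * t n"
      by metis
    have main: "(1 - t n) * Le (v n) chi + t n * Le (v n) xi \<le> c + t n * t n" for n
      using Le_conc[OF _ _ v(1) chi xi, of "t n" n] v(2)[of n] f_c[OF X_t[of n]] t[of n] by simp
    have le1: "Le (v n) xi \<le> c + t n" for n
    proof -
      have "(1 - t n) * c \<le> (1 - t n) * Le (v n) chi"
        using chi_max[OF v(1)] t[of n] by (intro mult_left_mono) auto
      with main[of n] have "t n * Le (v n) xi \<le> t n * (c + t n)" by (simp add: algebra_simps)
      then show ?thesis using t(1)[of n] by (simp add: mult_le_cancel_left_pos)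
    qed
    \<comment> \<open>What remains of \<open>main\<close> when the term with \<open>xi\<close> is
      bounded below by \<open>m\<close>: \<open>v n\<close> is a near-minimiser for
      \<open>chi\<close> itself, so it has the same limit \<open>z\<close> as
      \<open>w n\<close>.\<close>
    define r where "r n = (c + t n * t n - t n * m) / (1 - t n) - c" for n
    have le2: "Le (v n) chi \<le> c + r n" for n
    proof -
      have "t n * m \<le> t n * Le (v n) xi"
        using m'[OF v(1) xi] t[of n] by (intro mult_left_mono) auto
      with main[of n] have "(1 - t n) * Le (v n) chi \<le> c + t n * t n - t n * m" by linarith
      then show ?thesis using t[of n] by (simp add: r_def pos_le_divide_eq mult.commute)
    qed
    have "r \<longlonglongrightarrow> (c + 0 * 0 - 0 * m) / (1 - 0) - c"
      unfolding r_def by (intro tendsto_intros t0) auto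
    then have r0: "r \<longlonglongrightarrow> 0" by simp
    have "(\<lambda>n. D (v n) (w n)) \<longlonglongrightarrow> 0"
    proof (rule tendsto_sandwich)
      show "\<forall>\<^sub>F n in sequentially. 0 \<le> D (v n) (w n)"
        using D_nonneg v(1) w(1) by simp
      show "\<forall>\<^sub>F n in sequentially. D (v n) (w n) \<le> (4 / \<epsilon>) * max (r n) (1 / real (Suc n))"
      proof (intro always_eventually allI D_le v(1) w(1))
        show "Le (v n) chi \<le> c + max (r n) (1 / real (Suc n))" for n
          by (rule order_trans[OF le2]) simp
        show "Le (w n) chi \<le> c + max (r n) (1 / real (Suc n))" for n
          by (rule order_trans[OF w(2)]) simp
      qed
      have "(\<lambda>n. (4 / \<epsilon>) * max (r n) (1 / real (Suc n))) \<longlonglongrightarrow> (4 / \<epsilon>) * max 0 0"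
        by (intro tendsto_intros r0 inv0)
      then show "(\<lambda>n. (4 / \<epsilon>) * max (r n) (1 / real (Suc n))) \<longlonglongrightarrow> 0" by simp
    qed simp
    from D_tendsto_0_triangle[OF w(1) v(1) z(1) this z(2)]
    have "(\<lambda>n. D (v n) z) \<longlonglongrightarrow> 0" .
    then have "(\<lambda>n. Le (v n) xi) \<longlonglongrightarrow> Le z xi"
      unfolding Le_def using v(1) z(1) xi by (intro tendsto_intros L_cont q_cont)
    moreover have "(\<lambda>n. c + t n) \<longlonglongrightarrow> c"
      using tendsto_add[OF tendsto_const[of c] t0] by simp
    ultimately show ?thesis
      by (rule LIMSEQ_le) (use le1 in blast)
  qed
  then show ?thesis
    using z(1) chi chi_max unfolding Le_def by blast
qed

text \<open>The perturbed values \<open>c n\<close> decrease to some \<open>c0\<close>. A design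
  \<open>z\<close> with L w z \<ge> c0 for all \<open>w\<close> and a state \<open>u\<close> with L
  u xi \<le> c0 for all \<open>xi\<close> form a saddle point, since both inequalities meet at (u,
  z). Each of the two is found on its own as a limit from nested convex sets, which the perturbed
  saddle points show to be non-empty.\<close>

theorem saddle_point:
  "\<exists>v\<in>W. \<exists>chi\<in>X. (\<forall>xi\<in>X. L v xi \<le> L v chi) \<and> (\<forall>w\<in>W. L v chi \<le> L w chi)"
proof -
  define eps where "eps n = 1 / real (Suc n)" for n
  have eps: "eps n > 0" for n by (simp add: eps_def)
  have eps_dec: "eps n \<le> eps k" if "k \<le> n" for k n
    using that by (simp add: eps_def frac_le)
  have eps0: "eps \<longlonglongrightarrow> 0"
    using LIMSEQ_inverse_real_of_nat by (simp add: eps_def[abs_def] inverse_eq_divide)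
  obtain m where m: "\<And>v chi. v \<in> W \<Longrightarrow> chi \<in> X \<Longrightarrow> m \<le> L v chi"
    using L_bdd_below by blast
  obtain v chi c where v: "\<And>n. v n \<in> W" and chi: "\<And>n. chi n \<in> X"
    and le: "\<And>n xi. xi \<in> X \<Longrightarrow> L (v n) xi + eps n * q (v n) \<le> c n"
    and ge: "\<And>n w. w \<in> W \<Longrightarrow> c n \<le> L w (chi n) + eps n * q w"
    using perturbed_saddle_point[OF eps] by metis
  have eps_q: "0 \<le> eps n * q w" if "w \<in> W" for n w
    using eps[of n] q_nonneg[OF that] by simp
  \<comment> \<open>Play the state of stage \<open>k\<close> against the design of stage
    \<open>n\<close>: c n \<le> L (v k) (chi n) + eps n q (v k) \<le> c k, as eps n \<le> eps
    k.\<close>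
  have dec: "decseq c"
    unfolding decseq_def
  proof (intro allI impI)
    fix k n :: nat assume "k \<le> n"
    have "eps n * q (v k) \<le> eps k * q (v k)"
      using eps_dec[OF \<open>k \<le> n\<close>] q_nonneg[OF v] by (intro mult_right_mono) auto
    then show "c n \<le> c k"
      using ge[OF v, of n k] le[OF chi, of k n] by linarith
  qed
  have m_le: "m \<le> c n" for n
    using le[OF chi, of n n] m[OF v chi, of n n] eps_q[OF v, of n n] by linarith
  obtain c0 where c0: "c \<longlonglongrightarrow> c0" "\<And>n. c0 \<le> c n"
    by (rule decseq_convergent[OF dec, of m]) (use m_le in auto)
  \<comment> \<open>The level is \<open>c0\<close> and not \<open>c n\<close>: with the level fixed,
    the sets shrink as \<open>eps n\<close> decreases.\<close>
  have "\<exists>y. \<exists>z\<in>X. (\<forall>n. y n \<in> {xi \<in> X. \<forall>w\<in>W. c0 \<le> L w xi + eps n * q w}) \<and>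
      (\<forall>v\<in>W. (\<lambda>n. L v (y n)) \<longlonglongrightarrow> L v z)"
  proof (rule X_compact)
    show "{xi \<in> X. \<forall>w\<in>W. c0 \<le> L w xi + eps n * q w} \<noteq> {}" for n
      using chi ge order_trans[OF c0(2)] by blast
    show "{xi \<in> X. \<forall>w\<in>W. c0 \<le> L w xi + eps (Suc n) * q w} \<subseteq> {xi \<in> X. \<forall>w\<in>W. c0 \<le> L w xi + eps n * q w}" for n
    proof -
      have "eps (Suc n) * q w \<le> eps n * q w" if "w \<in> W" for w
        using eps_dec[of n "Suc n"] q_nonneg[OF that] by (intro mult_right_mono) auto
      then show ?thesis by fastforce
    qed
    show "cv (1/2) x y \<in> {xi \<in> X. \<forall>w\<in>W. c0 \<le> L w xi + eps n * q w}"
      if x: "x \<in> {xi \<in> X. \<forall>w\<in>W. c0 \<le> L w xi + eps n * q w}"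
        and y: "y \<in> {xi \<in> X. \<forall>w\<in>W. c0 \<le> L w xi + eps n * q w}" for n x y
    proof -
      have X: "x \<in> X" "y \<in> X" using x y by auto
      have "c0 \<le> L w (cv (1/2) x y) + eps n * q w" if w: "w \<in> W" for w
      proof -
        have "c0 \<le> L w x + eps n * q w" "c0 \<le> L w y + eps n * q w" using x y w by auto
        then show ?thesis using L_concave[of "1/2", OF _ _ w X] by simp
      qed
      then show ?thesis using X_cv[of "1/2", OF _ _ X] by simp
    qed
  qed auto
  then obtain y z where z: "z \<in> X" and y: "\<And>n w. w \<in> W \<Longrightarrow> c0 \<le> L w (y n) + eps n * q w"
    and lim: "\<And>v. v \<in> W \<Longrightarrow> (\<lambda>n. L v (y n)) \<longlonglongrightarrow> L v z"
    by blast
  have lower: "c0 \<le> L w z" if w: "w \<in> W" for w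
  proof (rule LIMSEQ_le_const)
    have "(\<lambda>n. L w (y n) + eps n * q w) \<longlonglongrightarrow> L w z + 0 * q w"
      by (intro tendsto_intros lim w eps0)
    then show "(\<lambda>n. L w (y n) + eps n * q w) \<longlonglongrightarrow> L w z" by simp
  qed (use y w in blast)
  \<comment> \<open>On this side the perturbation is dropped: eps q is non-negative, so
    \<open>v n\<close> lies in \<open>F n\<close>, and coercivity bounds \<open>q\<close> on
    \<open>F 0\<close>.\<close>
  define F where "F n = {w \<in> W. \<forall>xi\<in>X. L w xi \<le> c n}" for n
  obtain M where M: "\<And>w xi. w \<in> W \<Longrightarrow> xi \<in> X \<Longrightarrow> L w xi \<le> c 0 \<Longrightarrow> q w \<le> M"
    using coercive[of "c 0"] by blast
  obtain x0 where x0: "x0 \<in> X" using X_ne by blast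
  obtain w where w: "\<And>n. w n \<in> F n" "\<And>e. e > 0 \<Longrightarrow> \<exists>N. \<forall>m\<ge>N. \<forall>n\<ge>N. D (w m) (w n) < e"
  proof (rule nested_midconvex_Cauchy[where C=F and q=q and D=D and mid=mid and M=M])
    show "D x y = 2 * q x + 2 * q y - 4 * q (mid x y)" if "x \<in> F 0" "y \<in> F 0" for x y
      using that by (intro W_par) (auto simp: F_def)
    show "F (Suc n) \<subseteq> F n" for n
      using decseq_SucD[OF dec, of n] by (force simp: F_def)
    show "F n \<noteq> {}" for n
    proof -
      have "L (v n) xi \<le> c n" if "xi \<in> X" for xi
        using le[OF that, of n] eps_q[OF v, of n n] by linarith
      then show ?thesis using v by (auto simp: F_def)
    qed
    show "mid x y \<in> F n" if "x \<in> F n" "y \<in> F n" for n x y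
    proof -
      have "L (mid x y) xi \<le> c n" if "xi \<in> X" for xi
        using L_midconvex[of x y xi] \<open>x \<in> F n\<close> \<open>y \<in> F n\<close> that by (force simp: F_def)
      then show ?thesis using W_mid that by (auto simp: F_def)
    qed
    show "0 \<le> q x" if "x \<in> F 0" for x using that q_nonneg by (auto simp: F_def)
    show "q x \<le> M" if "x \<in> F 0" for x using that M[OF _ x0] x0 by (auto simp: F_def)
  qed blast
  have wW: "w n \<in> W" for n using w(1)[of n] by (simp add: F_def)
  obtain u where u: "u \<in> W" "(\<lambda>n. D (w n) u) \<longlonglongrightarrow> 0"
    using W_complete[OF wW w(2)] by blast
  have upper: "L u xi \<le> c0" if xi: "xi \<in> X" for xi
    using L_cont[OF wW u xi] c0(1) by (rule LIMSEQ_le) (use w(1) xi in \<open>auto simp: F_def\<close>)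
  show ?thesis
    using u(1) z lower upper order_trans by meson
qed

end

section \<open>Hausdorff measure and Lipschitz boundaries\<close>

lemma hausdorff_gauge_empty [simp]: "hausdorff_gauge s {} = 0"
  by (simp add: hausdorff_gauge_def)

lemma hausdorff_content_le:
  assumes "A \<subseteq> (\<Union>i. C i)" "\<And>i. bounded (C i)" "\<And>i. diameter (C i) \<le> \<delta>"
  shows "hausdorff_content s \<delta> A \<le> (\<Sum>i. hausdorff_gauge s (C i))"
  unfolding hausdorff_content_def using assms by (intro INF_lower) auto

lemma hausdorff_content_antimono:
  assumes "\<delta> \<le> \<delta>'"
  shows "hausdorff_content s \<delta>' A \<le> hausdorff_content s \<delta> A"
  unfolding hausdorff_content_def using assms by (intro INF_superset_mono) (auto intro: order_trans)

lemma hausdorff_content_mono: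
  assumes "A \<subseteq> B"
  shows "hausdorff_content s \<delta> A \<le> hausdorff_content s \<delta> B"
  unfolding hausdorff_content_def using assms by (intro INF_superset_mono) auto

lemma hausdorff_content_approx:
  assumes "hausdorff_content s \<delta> A < top" "e > 0"
  obtains C where "A \<subseteq> (\<Union>i. C i)" "\<And>i. bounded (C i)" "\<And>i. diameter (C i) \<le> \<delta>"
    "(\<Sum>i. hausdorff_gauge s (C i)) \<le> hausdorff_content s \<delta> A + ennreal e"
proof -
  have "hausdorff_content s \<delta> A < hausdorff_content s \<delta> A + ennreal e"
    using assms by (cases "hausdorff_content s \<delta> A") (auto simp: ennreal_less_iff simp flip: ennreal_plus)
  then obtain C where "A \<subseteq> (\<Union>i. C i)" "\<forall>i. bounded (C i) \<and> diameter (C i) \<le> \<delta>"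
    "(\<Sum>i. hausdorff_gauge s (C i)) < hausdorff_content s \<delta> A + ennreal e"
    unfolding hausdorff_content_def INF_less_iff by auto
  then show ?thesis
    by (intro that) auto
qed

lemma hausdorff_content_le_outer: "\<delta> > 0 \<Longrightarrow> hausdorff_content s \<delta> A \<le> hausdorff_outer s A"
  unfolding hausdorff_outer_def by (intro SUP_upper) auto

lemma hausdorff_outer_mono:
  assumes "A \<subseteq> B"
  shows "hausdorff_outer s A \<le> hausdorff_outer s B"
  unfolding hausdorff_outer_def by (intro SUP_mono) (auto intro: hausdorff_content_mono[OF assms])

lemma hausdorff_outer_leI:
  assumes "\<And>\<delta>. \<delta> > 0 \<Longrightarrow> hausdorff_content s \<delta> A \<le> M"
  shows "hausdorff_outer s A \<le> M"
  unfolding hausdorff_outer_def using assms by (intro SUP_least) auto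

text \<open>The supremum over \<delta> is a limit along \<delta> = 1/(n+1), so inequalities between
  sums of contents pass to the outer measure.\<close>

lemma hausdorff_content_tendsto_outer:
  "(\<lambda>n. hausdorff_content s (1 / real (Suc n)) A) \<longlonglongrightarrow> hausdorff_outer s A"
proof -
  let ?c = "\<lambda>n. hausdorff_content s (1 / real (Suc n)) A"
  have inc: "incseq ?c"
    by (intro incseq_SucI hausdorff_content_antimono) (auto intro: divide_left_mono)
  have "hausdorff_outer s A = (SUP n. ?c n)"
  proof (rule antisym)
    show "hausdorff_outer s A \<le> (SUP n. ?c n)"
    proof (rule hausdorff_outer_leI)
      fix \<delta> :: real assume "\<delta> > 0"
      then obtain n where "1 / real (Suc n) < \<delta>" using nat_approx_posE by blast
      then have "hausdorff_content s \<delta> A \<le> ?c n" by (intro hausdorff_content_antimono) simp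
      also have "\<dots> \<le> (SUP n. ?c n)" by (rule SUP_upper) simp
      finally show "hausdorff_content s \<delta> A \<le> (SUP n. ?c n)" .
    qed
    show "(SUP n. ?c n) \<le> hausdorff_outer s A"
      by (intro SUP_least hausdorff_content_le_outer) simp
  qed
  then show ?thesis
    using LIMSEQ_SUP[OF inc] by simp
qed

text \<open>Coverings of the sets \<open>A n\<close> with errors e / 2^(n+1) are merged into one
  sequence by \<open>prod_decode\<close>; the bound \<delta> on the diameters is respected.\<close>

lemma hausdorff_content_countable_subadditive:
  "hausdorff_content s \<delta> (\<Union>n::nat. A n) \<le> (\<Sum>n. hausdorff_content s \<delta> (A n))"
proof (rule ennreal_le_epsilon)
  fix e :: real assume fin: "(\<Sum>n. hausdorff_content s \<delta> (A n)) < top" and e: "0 < e"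
  have "hausdorff_content s \<delta> (A n) < top" for n
    using ennreal_suminf_lessD[OF fin] .
  then have "\<exists>C. A n \<subseteq> (\<Union>i. C i) \<and> (\<forall>i. bounded (C i)) \<and> (\<forall>i. diameter (C i) \<le> \<delta>) \<and>
     (\<Sum>i. hausdorff_gauge s (C i)) \<le> hausdorff_content s \<delta> (A n) + ennreal (e * (1/2) ^ Suc n)" for n
    using hausdorff_content_approx[of s \<delta> "A n" "e * (1/2) ^ Suc n"] e by (metis mult_pos_pos zero_less_power half_gt_zero_iff zero_less_one)
  then obtain C where C: "\<And>n. A n \<subseteq> (\<Union>i. C n i)" "\<And>n i. bounded (C n i)" "\<And>n i. diameter (C n i) \<le> \<delta>"
     "\<And>n. (\<Sum>i. hausdorff_gauge s (C n i)) \<le> hausdorff_content s \<delta> (A n) + ennreal (e * (1/2) ^ Suc n)"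
    by metis
  define f where "f p = hausdorff_gauge s (C (fst p) (snd p))" for p
  have "hausdorff_content s \<delta> (\<Union>n. A n) \<le> (\<Sum>k. hausdorff_gauge s (C (fst (prod_decode k)) (snd (prod_decode k))))"
  proof (rule hausdorff_content_le)
    show "(\<Union>n. A n) \<subseteq> (\<Union>k. C (fst (prod_decode k)) (snd (prod_decode k)))"
    proof
      fix x assume "x \<in> (\<Union>n. A n)"
      then obtain n i where "x \<in> C n i" using C(1) by blast
      then show "x \<in> (\<Union>k. C (fst (prod_decode k)) (snd (prod_decode k)))"
        by (intro UN_I[of "prod_encode (n, i)"]) auto
    qed
  qed (use C in auto)
  also have "\<dots> = (\<Sum>k. f (prod_decode k))" by (simp add: f_def)
  also have "\<dots> = (\<Sum>n. \<Sum>i. hausdorff_gauge s (C n i))"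
    by (rule suminf_ennreal_2dimen) (simp add: f_def)
  also have "\<dots> \<le> (\<Sum>n. hausdorff_content s \<delta> (A n) + ennreal (e * (1/2) ^ Suc n))"
    by (intro suminf_le C(4)) auto
  also have "\<dots> = (\<Sum>n. hausdorff_content s \<delta> (A n)) + (\<Sum>n. ennreal (e * (1/2) ^ Suc n))"
    by (intro suminf_add[symmetric]) auto
  also have "(\<Sum>n. ennreal (e * (1/2) ^ Suc n)) = ennreal e"
  proof (rule sums_unique[symmetric])
    have "(\<lambda>n. e * (1/2) ^ Suc n) sums (e * 1)"
      by (intro sums_mult power_half_series)
    then show "(\<lambda>n. ennreal (e * (1/2) ^ Suc n)) sums ennreal e"
      using e by simp
  qed
  finally show "hausdorff_content s \<delta> (\<Union>n. A n) \<le> (\<Sum>n. hausdorff_content s \<delta> (A n)) + ennreal e" .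
qed

lemma hausdorff_outer_countable_subadditive:
  "hausdorff_outer s (\<Union>n::nat. A n) \<le> (\<Sum>n. hausdorff_outer s (A n))"
proof (rule hausdorff_outer_leI)
  fix \<delta> :: real assume "\<delta> > 0"
  have "hausdorff_content s \<delta> (\<Union>n. A n) \<le> (\<Sum>n. hausdorff_content s \<delta> (A n))"
    by (rule hausdorff_content_countable_subadditive)
  also have "\<dots> \<le> (\<Sum>n. hausdorff_outer s (A n))"
    by (intro suminf_le hausdorff_content_le_outer \<open>\<delta> > 0\<close>) auto
  finally show "hausdorff_content s \<delta> (\<Union>n. A n) \<le> (\<Sum>n. hausdorff_outer s (A n))" .
qed

lemma hausdorff_outer_empty [simp]: "hausdorff_outer s {} = 0"
proof -
  have "hausdorff_outer s ({}::'a set) \<le> 0"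
  proof (rule hausdorff_outer_leI)
    fix \<delta> :: real assume "\<delta> > 0"
    have "hausdorff_content s \<delta> ({}::'a set) \<le> (\<Sum>i::nat. hausdorff_gauge s ({}::'a set))"
      using \<open>\<delta> > 0\<close> by (intro hausdorff_content_le) auto
    then show "hausdorff_content s \<delta> ({}::'a set) \<le> 0" by simp
  qed
  then show ?thesis by simp
qed

lemma hausdorff_outer_Un: "hausdorff_outer s (A \<union> B) \<le> hausdorff_outer s A + hausdorff_outer s B"
proof -
  have "hausdorff_outer s (A \<union> B) \<le> (\<Sum>n. hausdorff_outer s (binaryset A B n))"
    using hausdorff_outer_countable_subadditive[of s "binaryset A B"] by (simp add: UN_binaryset_eq)
  also have "\<dots> = hausdorff_outer s A + hausdorff_outer s B"
    by (rule suminf_binaryset_eq) simp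
  finally show ?thesis .
qed

text \<open>A covering set of diameter below \<open>d\<close> meets at most one of \<open>A\<close>
  and \<open>B\<close>, so every fine covering of the union splits into a covering of each. The
  contents are compared for \<delta> < d, and then \<delta> tends to 0.\<close>

lemma hausdorff_outer_separated:
  assumes "d > 0" and sep: "\<And>x y. x \<in> A \<Longrightarrow> y \<in> B \<Longrightarrow> d \<le> dist x y"
  shows "hausdorff_outer s A + hausdorff_outer s B \<le> hausdorff_outer s (A \<union> B)"
proof -
  have content: "hausdorff_content s \<delta> A + hausdorff_content s \<delta> B \<le> hausdorff_content s \<delta> (A \<union> B)"
    if \<delta>: "0 < \<delta>" "\<delta> < d" for \<delta>
    unfolding hausdorff_content_def[of s \<delta> "A \<union> B"]
  proof (rule INF_greatest)
    fix C assume "C \<in> {C :: nat \<Rightarrow> 'a set. A \<union> B \<subseteq> (\<Union>i. C i) \<and> (\<forall>i. bounded (C i) \<and> diameter (C i) \<le> \<delta>)}"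
    then have C: "A \<union> B \<subseteq> (\<Union>i. C i)" "\<And>i. bounded (C i)" "\<And>i. diameter (C i) \<le> \<delta>" by auto
    define CA where "CA i = (if C i \<inter> A = {} then {} else C i)" for i
    define CB where "CB i = (if C i \<inter> B = {} then {} else C i)" for i
    have "hausdorff_content s \<delta> A \<le> (\<Sum>i. hausdorff_gauge s (CA i))"
    proof (rule hausdorff_content_le)
      show "A \<subseteq> (\<Union>i. CA i)"
      proof
        fix x assume "x \<in> A"
        then obtain i where "x \<in> C i" using C(1) by blast
        then have "x \<in> CA i" using \<open>x \<in> A\<close> by (auto simp: CA_def)
        then show "x \<in> (\<Union>i. CA i)" by blast
      qed
    qed (use C(2,3) \<delta> in \<open>auto simp: CA_def\<close>)
    moreover have "hausdorff_content s \<delta> B \<le> (\<Sum>i. hausdorff_gauge s (CB i))"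
    proof (rule hausdorff_content_le)
      show "B \<subseteq> (\<Union>i. CB i)"
      proof
        fix x assume "x \<in> B"
        then obtain i where "x \<in> C i" using C(1) by blast
        then have "x \<in> CB i" using \<open>x \<in> B\<close> by (auto simp: CB_def)
        then show "x \<in> (\<Union>i. CB i)" by blast
      qed
    qed (use C(2,3) \<delta> in \<open>auto simp: CB_def\<close>)
    ultimately have "hausdorff_content s \<delta> A + hausdorff_content s \<delta> B \<le>
        (\<Sum>i. hausdorff_gauge s (CA i)) + (\<Sum>i. hausdorff_gauge s (CB i))"
      by (rule add_mono)
    also have "\<dots> = (\<Sum>i. hausdorff_gauge s (CA i) + hausdorff_gauge s (CB i))"
      by (intro suminf_add) auto
    also have "\<dots> \<le> (\<Sum>i. hausdorff_gauge s (C i))"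
    proof (intro suminf_le)
      fix i
      have "C i \<inter> A = {} \<or> C i \<inter> B = {}"
      proof (rule ccontr)
        assume "\<not> ?thesis"
        then obtain x y where "x \<in> C i" "x \<in> A" "y \<in> C i" "y \<in> B" by blast
        then show False
          using sep[of x y] diameter_bounded_bound[OF C(2), of x i y] C(3)[of i] \<delta> by simp
      qed
      then show "hausdorff_gauge s (CA i) + hausdorff_gauge s (CB i) \<le> hausdorff_gauge s (C i)"
        by (auto simp: CA_def CB_def)
    qed auto
    finally show "hausdorff_content s \<delta> A + hausdorff_content s \<delta> B \<le> (\<Sum>i. hausdorff_gauge s (C i))" .
  qed
  obtain N :: nat where N: "1 / real (Suc N) < d"
    using nat_approx_posE[OF \<open>d > 0\<close>] by blast
  show ?thesis
  proof (rule LIMSEQ_le_const2)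
    show "(\<lambda>n. hausdorff_content s (1 / real (Suc n)) A + hausdorff_content s (1 / real (Suc n)) B)
        \<longlonglongrightarrow> hausdorff_outer s A + hausdorff_outer s B"
      by (intro tendsto_add hausdorff_content_tendsto_outer)
    show "\<exists>N. \<forall>n\<ge>N. hausdorff_content s (1 / real (Suc n)) A + hausdorff_content s (1 / real (Suc n)) B
        \<le> hausdorff_outer s (A \<union> B)"
    proof (intro exI[of _ N] allI impI)
      fix n assume "N \<le> n"
      then have "1 / real (Suc n) \<le> 1 / real (Suc N)" by (simp add: frac_le)
      then have "1 / real (Suc n) < d" using N by linarith
      then show "hausdorff_content s (1 / real (Suc n)) A + hausdorff_content s (1 / real (Suc n)) B
        \<le> hausdorff_outer s (A \<union> B)"
        by (intro order_trans[OF content hausdorff_content_le_outer]) auto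
    qed
  qed
qed

text \<open>Caratheodory's criterion. Off a closed set \<open>A\<close>, the test set \<open>E\<close> is exhausted by the sets \<open>B k\<close>
  at positive distance from \<open>A\<close>. Shells \<open>R i\<close>, \<open>R j\<close> with \<open>j \<ge> i + 2\<close> are separated, which makes the
  measures of the shells summable.\<close>

lemma hausdorff_outer_closed_split:
  fixes A E :: "'a::metric_space set"
  assumes A: "closed A" "A \<noteq> {}"
  shows "hausdorff_outer s (A \<inter> E) + hausdorff_outer s (E - A) \<le> hausdorff_outer s E"
proof (cases "hausdorff_outer s E = top")
  case False
  define B where "B k = {x \<in> E. 1 / real (Suc k) \<le> infdist x A}" for k
  define R where "R k = B (Suc k) - B k" for k
  have R_lower: "1 / real (Suc (Suc k)) \<le> infdist x A" and R_upper: "infdist x A < 1 / real (Suc k)"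
    if "x \<in> R k" for x k
    using that by (auto simp: R_def B_def)
  have RE: "R k \<subseteq> E" for k by (auto simp: R_def B_def)
  have sep: "hausdorff_outer s S + hausdorff_outer s T \<le> hausdorff_outer s (S \<union> T)"
    if "b < a" "\<And>x. x \<in> S \<Longrightarrow> a \<le> infdist x A" "\<And>x. x \<in> T \<Longrightarrow> infdist x A < b" for a b S T
  proof (rule hausdorff_outer_separated[of "a - b"])
    fix x y assume "x \<in> S" "y \<in> T"
    then show "a - b \<le> dist x y"
      using that(2,3)[of x] that(2,3)[of y] infdist_triangle[of x A y] by force
  qed (use that in simp)
  \<comment> \<open>Shells of the same parity are pairwise separated, so their measures add up to at
    most that of their union; the two parities give the factor 2 in \<open>R_sum\<close>.\<close>
  have par: "(\<Sum>i<n. hausdorff_outer s (R (2 * i + p))) \<le> hausdorff_outer s (\<Union>i<n. R (2 * i + p))" for n p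
  proof (induction n)
    case (Suc n)
    have "(\<Sum>i<Suc n. hausdorff_outer s (R (2 * i + p))) \<le>
       hausdorff_outer s (\<Union>i<n. R (2 * i + p)) + hausdorff_outer s (R (2 * n + p))"
      using Suc by (simp add: add_right_mono)
    also have "\<dots> \<le> hausdorff_outer s ((\<Union>i<n. R (2 * i + p)) \<union> R (2 * n + p))"
    proof (cases "n = 0")
      case False
      show ?thesis
      proof (rule sep[of "1 / real (Suc (2 * n + p))" "1 / real (2 * n + p)"])
        show "1 / real (Suc (2 * n + p)) < 1 / real (2 * n + p)"
          using False by (intro divide_strict_left_mono) auto
        fix x assume "x \<in> (\<Union>i<n. R (2 * i + p))"
        then obtain i where i: "i < n" "x \<in> R (2 * i + p)" by blast
        have "1 / real (2 * n + p) \<le> 1 / real (Suc (Suc (2 * i + p)))"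
          using i(1) by (intro divide_left_mono) auto
        then show "1 / real (2 * n + p) \<le> infdist x A" using R_lower[OF i(2)] by linarith
      qed (rule R_upper)
    qed simp
    finally show ?case by (simp add: lessThan_Suc Un_commute)
  qed simp
  have R_sum: "(\<Sum>i<n. hausdorff_outer s (R i)) \<le> 2 * hausdorff_outer s E" for n
  proof -
    have "(\<Sum>i<n. hausdorff_outer s (R i)) \<le> (\<Sum>i<2 * n. hausdorff_outer s (R i))"
      by (intro sum_mono2) auto
    also have "\<dots> = (\<Sum>i<n. hausdorff_outer s (R (2 * i + 0))) + (\<Sum>i<n. hausdorff_outer s (R (2 * i + 1)))"
      by (induction n) (simp_all add: algebra_simps)
    also have "\<dots> \<le> hausdorff_outer s E + hausdorff_outer s E"
      using RE by (intro add_mono order_trans[OF par] hausdorff_outer_mono) auto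
    finally show ?thesis by (simp add: mult_2)
  qed
  have R_suminf: "(\<Sum>i. hausdorff_outer s (R i)) < top"
  proof -
    have "(\<Sum>i. hausdorff_outer s (R i)) \<le> 2 * hausdorff_outer s E"
      by (intro suminf_le_const R_sum) auto
    also have "\<dots> < top" using False by (simp add: ennreal_mult_less_top less_top)
    finally show ?thesis .
  qed
  define \<rho> where "\<rho> i = enn2real (hausdorff_outer s (R i))" for i
  have \<rho>: "hausdorff_outer s (R i) = ennreal (\<rho> i)" for i
    using ennreal_suminf_lessD[OF R_suminf, of i] by (simp add: \<rho>_def)
  have \<rho>0: "\<rho> i \<ge> 0" for i by (simp add: \<rho>_def)
  have summable: "summable \<rho>"
    using R_suminf \<rho>0 by (intro summable_suminf_not_top) (auto simp: \<rho>)
  show ?thesis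
  proof (rule ennreal_le_epsilon)
    fix e :: real assume "0 < e"
    obtain k where k: "(\<Sum>i. \<rho> (i + k)) < e"
      using suminf_exist_split[OF \<open>0 < e\<close> summable]
      by (metis abs_ge_self le_less_trans order_refl real_norm_def)
    \<comment> \<open>Since \<open>A\<close> is closed, a point of \<open>E - A\<close> lies in
      \<open>B j0\<close> for a least \<open>j0\<close>; if j0 > k, it lies in the shell
      \<open>R (j0 - 1)\<close>.\<close>
    have sub: "E - A \<subseteq> B k \<union> (\<Union>i. R (i + k))"
    proof
      fix x assume x: "x \<in> E - A"
      then have "infdist x A > 0"
        using A in_closed_iff_infdist_zero[OF A, of x] infdist_nonneg[of x A] by auto
      then obtain j where "1 / real (Suc j) < infdist x A" using nat_approx_posE by blast
      then have "x \<in> B j" using x by (auto simp: B_def)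
      then have "\<exists>j. x \<in> B j" ..
      define j0 where "j0 = (LEAST j. x \<in> B j)"
      have j0: "x \<in> B j0" using \<open>\<exists>j. x \<in> B j\<close> LeastI_ex unfolding j0_def by metis
      show "x \<in> B k \<union> (\<Union>i. R (i + k))"
      proof (cases "j0 \<le> k")
        case True
        have "1 / real (Suc k) \<le> 1 / real (Suc j0)" using True by (simp add: frac_le)
        then show ?thesis using j0 by (auto simp: B_def)
      next
        case False
        then obtain i where i: "j0 = Suc (i + k)"
          by (metis add.commute less_imp_Suc_add not_less)
        have "x \<notin> B (i + k)" using not_less_Least[of "i + k" "\<lambda>j. x \<in> B j"] i unfolding j0_def by auto
        then show ?thesis using j0 i by (auto simp: R_def)
      qed
    qed
    have "hausdorff_outer s (A \<inter> E) + hausdorff_outer s (E - A) \<le>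
        hausdorff_outer s (A \<inter> E) + (hausdorff_outer s (B k) + (\<Sum>i. hausdorff_outer s (R (i + k))))"
      by (intro add_left_mono order_trans[OF hausdorff_outer_mono[OF sub]]
          order_trans[OF hausdorff_outer_Un] hausdorff_outer_countable_subadditive)
    also have "(\<Sum>i. hausdorff_outer s (R (i + k))) = ennreal (\<Sum>i. \<rho> (i + k))"
      unfolding \<rho> using \<rho>0 summable by (intro suminf_ennreal2) auto
    also have "\<dots> \<le> ennreal e" using k by (intro ennreal_leI) simp
    also have "hausdorff_outer s (A \<inter> E) + (hausdorff_outer s (B k) + ennreal e) =
       (hausdorff_outer s (B k) + hausdorff_outer s (A \<inter> E)) + ennreal e"
      by (simp add: ac_simps)
    also have "hausdorff_outer s (B k) + hausdorff_outer s (A \<inter> E) \<le> hausdorff_outer s (B k \<union> (A \<inter> E))"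
      by (rule sep[of "1 / (2 * real (Suc k))" "1 / real (Suc k)"]) (auto simp: B_def field_simps)
    also have "\<dots> \<le> hausdorff_outer s E"
      by (intro hausdorff_outer_mono) (auto simp: B_def)
    finally show "hausdorff_outer s (A \<inter> E) + hausdorff_outer s (E - A) \<le> hausdorff_outer s E + ennreal e"
      by (simp add: add_left_mono add_right_mono)
  qed
qed simp

lemma sets_borel_subset_hausdorff_measure: "sets borel \<subseteq> sets (hausdorff_measure s :: 'a::metric_space measure)"
proof -
  have "A \<in> lambda_system UNIV (Pow UNIV) (hausdorff_outer s)" if "closed A" for A :: "'a set"
  proof -
    have "hausdorff_outer s (A \<inter> E) + hausdorff_outer s (E - A) = hausdorff_outer s E" for E
    proof (rule antisym)
      show "hausdorff_outer s (A \<inter> E) + hausdorff_outer s (E - A) \<le> hausdorff_outer s E"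
        using hausdorff_outer_closed_split[OF that, of s E] by (cases "A = {}") auto
      have "E = (A \<inter> E) \<union> (E - A)" by blast
      then show "hausdorff_outer s E \<le> hausdorff_outer s (A \<inter> E) + hausdorff_outer s (E - A)"
        by (metis hausdorff_outer_Un)
    qed
    moreover have "(UNIV - A) \<inter> E = E - A" for E by blast
    ultimately show ?thesis by (simp add: lambda_system_def)
  qed
  then have "sigma_sets UNIV (Collect closed) \<subseteq> sigma_sets UNIV (lambda_system UNIV (Pow UNIV) (hausdorff_outer s :: 'a set \<Rightarrow> ennreal))"
    by (intro sigma_sets_mono') auto
  moreover have "sets (borel :: 'a measure) = sigma_sets UNIV (Collect closed)"
    unfolding borel_eq_closed by (rule sets_measure_of) simp
  moreover have "sets (hausdorff_measure s :: 'a measure) =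
      sigma_sets UNIV (lambda_system UNIV (Pow UNIV) (hausdorff_outer s))"
    unfolding hausdorff_measure_def by (rule sets_measure_of) simp
  ultimately show ?thesis by simp
qed

text \<open>The construction \<open>measure_of\<close> returns on each set either the value of the
  outer measure or the default 0; the bound holds in both cases, and an upper bound is all that
  finiteness requires.\<close>

lemma emeasure_hausdorff_le_outer: "emeasure (hausdorff_measure s) A \<le> hausdorff_outer s A"
  unfolding hausdorff_measure_def emeasure_measure_of_conv by simp

section \<open>Surface measure of a Lipschitz boundary\<close>

lemma frontier_in_sets_hausdorff: "frontier \<Omega> \<in> sets (hausdorff_measure s)"
  using sets_borel_subset_hausdorff_measure[of s] by auto

text \<open>Continuity on the closure gives Borel measurability on the frontier, and Borel sets are
  measurable for the Hausdorff measure.\<close>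

lemma borel_measurable_surface_measure:
  fixes w :: "'a::euclidean_space \<Rightarrow> 'b::topological_space"
  assumes "continuous_on (closure \<Omega>) w"
  shows "w \<in> borel_measurable (surface_measure \<Omega>)"
proof -
  have "continuous_on (frontier \<Omega>) w"
    using assms by (rule continuous_on_subset) (auto simp: frontier_def)
  then have "w \<in> borel_measurable (restrict_space borel (frontier \<Omega>))"
    by (rule borel_measurable_continuous_on_restrict)
  have "space (hausdorff_measure s :: 'a measure) = UNIV" for s
    by (simp add: hausdorff_measure_def)
  then have space: "space (surface_measure \<Omega>) = frontier \<Omega>"
    by (simp add: surface_measure_def space_restrict_space)
  show ?thesis
  proof (rule measurableI)
    fix S :: "'b set" assume "S \<in> sets borel"
    with \<open>w \<in> borel_measurable (restrict_space borel (frontier \<Omega>))\<close>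
    have "w -` S \<inter> frontier \<Omega> \<in> sets (restrict_space borel (frontier \<Omega>))"
      by (metis inf_top.right_neutral measurable_sets space_borel space_restrict_space)
    then show "w -` S \<inter> space (surface_measure \<Omega>) \<in> sets (surface_measure \<Omega>)"
      using sets_borel_subset_hausdorff_measure[where 'a='a]
      unfolding space unfolding surface_measure_def sets_restrict_space by blast
  qed simp
qed

text \<open>A grid of \<open>N ^ card B\<close> cells on the hyperplane, for an orthonormal basis \<open>B\<close> of it, lifts to a
  covering of a Lipschitz graph by \<open>N ^ card B\<close> sets of diameter \<open>O(1 / N)\<close>.\<close>

lemma hausdorff_outer_lipschitz_graph_finite:
  fixes \<gamma> :: "'a::euclidean_space \<Rightarrow> real" and e x :: 'a
  assumes e: "norm e = 1" and \<gamma>: "C-lipschitz_on {y. y \<bullet> e = 0} \<gamma>" and "r > 0"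
  shows "hausdorff_outer (DIM('a) - 1) {y \<in> ball x r. y \<bullet> e = \<gamma> (y - (y \<bullet> e) *\<^sub>R e)} < top"
proof -
  define P where "P y = y - (y \<bullet> e) *\<^sub>R e" for y
  define A where "A = {y \<in> ball x r. y \<bullet> e = \<gamma> (P y)}"
  define s where "s = DIM('a) - 1"
  have "e \<bullet> e = 1" using e by (simp add: norm_eq_1)
  then have P: "P y \<in> {y. y \<bullet> e = 0}" for y by (simp add: P_def inner_diff_left)
  have "e \<noteq> 0" using e by auto
  obtain B where B: "B \<subseteq> {y. y \<bullet> e = 0}" "pairwise orthogonal B" "\<And>b. b \<in> B \<Longrightarrow> norm b = 1"
    "independent B" "card B = dim {y. y \<bullet> e = 0}" "span B = {y. y \<bullet> e = 0}"
    by (rule orthonormal_basis_subspace[OF subspace_hyperplane2[of e]]) (rule that)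
  have cardB: "card B = s"
    using B(5) dim_hyperplane[OF \<open>e \<noteq> 0\<close>] by (simp add: inner_commute s_def)
  have finB: "finite B" using B(4) independent_imp_finite by blast
  have C0: "C \<ge> 0" using \<gamma> lipschitz_on_nonneg by blast
  \<comment> \<open>In a cell of a grid with \<open>N\<close> steps per axis each of the
    \<open>s\<close> coordinates of the projection varies by at most 2 r / N, and lifting to the
    graph multiplies lengths by at most 1 + C: the cells have diameter at most K / N. In
    \<open>M\<close> the number \<open>N ^ s\<close> of cells has cancelled the factor N^(-s) of the
    gauge.\<close>
  define K where "K = (1 + C) * (real s * (2 * r))"
  have K0: "K \<ge> 0" using C0 \<open>r > 0\<close> by (simp add: K_def)
  define M where "M = unit_ball_vol (real s) * (K / 2) ^ s"
  have bound: "hausdorff_content s \<delta> A \<le> ennreal M" if "\<delta> > 0" for \<delta>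
  proof -
    obtain N0 :: nat where N0: "real N0 > K / \<delta>" using reals_Archimedean2 by blast
    define N where "N = Suc N0"
    have N: "K / real N \<le> \<delta>"
    proof -
      have "K \<le> real N0 * \<delta>" using N0 \<open>\<delta> > 0\<close> by (simp add: field_simps)
      also have "\<dots> \<le> real N * \<delta>" using \<open>\<delta> > 0\<close> by (simp add: N_def)
      finally show ?thesis by (simp add: N_def field_simps)
    qed
    have Npos: "real N > 0" by (simp add: N_def)
    define I where "I = PiE B (\<lambda>_. {..<N})"
    \<comment> \<open>The coordinates of points of the ball are rescaled to [0, 1) before this
      interval is cut into \<open>N\<close> parts.\<close>
    define cell where "cell k = {y \<in> A. \<forall>b\<in>B. real (k b) \<le> real N * ((y \<bullet> b - x \<bullet> b + r) / (2 * r)) \<and>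
        real N * ((y \<bullet> b - x \<bullet> b + r) / (2 * r)) \<le> real (k b) + 1}" for k :: "'a \<Rightarrow> nat"
    have finI: "finite I" unfolding I_def using finB by (intro finite_PiE) auto
    have cardI: "card I = N ^ s" unfolding I_def using finB by (simp add: card_PiE cardB)
    have cover: "A \<subseteq> (\<Union>k\<in>I. cell k)"
    proof
      fix y assume y: "y \<in> A"
      define k where "k = restrict (\<lambda>b. nat \<lfloor>real N * ((y \<bullet> b - x \<bullet> b + r) / (2 * r))\<rfloor>) B"
      have rng: "0 \<le> (y \<bullet> b - x \<bullet> b + r) / (2 * r)" "(y \<bullet> b - x \<bullet> b + r) / (2 * r) < 1" if "b \<in> B" for b
      proof -
        have "\<bar>(y - x) \<bullet> b\<bar> \<le> norm (y - x)"
          using Cauchy_Schwarz_ineq2[of "y - x" b] B(3)[OF that] by simp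
        also have "\<dots> < r" using y by (simp add: A_def dist_norm norm_minus_commute)
        finally have "\<bar>y \<bullet> b - x \<bullet> b\<bar> < r" by (simp add: inner_diff_left)
        then show "0 \<le> (y \<bullet> b - x \<bullet> b + r) / (2 * r)" "(y \<bullet> b - x \<bullet> b + r) / (2 * r) < 1"
          using \<open>r > 0\<close> by (auto simp: field_simps)
      qed
      have kb: "real (k b) \<le> real N * ((y \<bullet> b - x \<bullet> b + r) / (2 * r))"
        "real N * ((y \<bullet> b - x \<bullet> b + r) / (2 * r)) \<le> real (k b) + 1" "k b < N" if "b \<in> B" for b
      proof -
        define t where "t = real N * ((y \<bullet> b - x \<bullet> b + r) / (2 * r))"
        have "0 \<le> t" unfolding t_def by (intro mult_nonneg_nonneg rng(1)[OF that]) simp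
        have "t < real N"
          using mult_strict_left_mono[OF rng(2)[OF that] Npos] by (simp add: t_def)
        have "k b = nat \<lfloor>t\<rfloor>" using that by (simp add: k_def t_def)
        then have "real (k b) = of_int \<lfloor>t\<rfloor>" using \<open>0 \<le> t\<close> by simp
        then have "real (k b) \<le> t" "t \<le> real (k b) + 1" by linarith+
        then show "real (k b) \<le> real N * ((y \<bullet> b - x \<bullet> b + r) / (2 * r))"
          "real N * ((y \<bullet> b - x \<bullet> b + r) / (2 * r)) \<le> real (k b) + 1" "k b < N"
          using \<open>t < real N\<close> by (auto simp: t_def)
      qed
      have "k \<in> I" using kb(3) by (auto simp: I_def k_def)
      moreover have "y \<in> cell k" using y kb(1,2) by (auto simp: cell_def)
      ultimately show "y \<in> (\<Union>k\<in>I. cell k)" by blast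
    qed
    have diam: "diameter (cell k) \<le> K / real N" for k
    proof (rule diameter_le)
      show "cell k \<noteq> {} \<or> 0 \<le> K / real N" using K0 by simp
      fix y z assume y: "y \<in> cell k" and z: "z \<in> cell k"
      have coord: "\<bar>(P y - P z) \<bullet> b\<bar> \<le> 2 * r / real N" if "b \<in> B" for b
      proof -
        have "e \<bullet> b = 0" using B(1) that by (auto simp: inner_commute)
        then have eq: "(P y - P z) \<bullet> b = y \<bullet> b - z \<bullet> b" by (simp add: P_def inner_diff_left)
        have "\<bar>real N * ((y \<bullet> b - x \<bullet> b + r) / (2 * r)) - real N * ((z \<bullet> b - x \<bullet> b + r) / (2 * r))\<bar> \<le> 1"
          using y z that by (auto simp: cell_def abs_le_iff) (smt (verit))+
        also have "real N * ((y \<bullet> b - x \<bullet> b + r) / (2 * r)) - real N * ((z \<bullet> b - x \<bullet> b + r) / (2 * r)) =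
            real N / (2 * r) * (y \<bullet> b - z \<bullet> b)"
          by (simp add: field_simps diff_divide_distrib add_divide_distrib)
        finally have "real N / (2 * r) * \<bar>y \<bullet> b - z \<bullet> b\<bar> \<le> 1"
          using Npos \<open>r > 0\<close> by (simp add: abs_mult)
        then show ?thesis
          unfolding eq using Npos \<open>r > 0\<close> by (simp add: field_simps)
      qed
      have "P y - P z \<in> span B"
        using P[of y] P[of z] unfolding B(6) by (simp add: inner_diff_left)
      from orthonormal_basis_expand[OF B(2,3) this finB]
      have "norm (P y - P z) = norm (\<Sum>b\<in>B. ((P y - P z) \<bullet> b) *\<^sub>R b)" by simp
      also have "\<dots> \<le> (\<Sum>b\<in>B. norm (((P y - P z) \<bullet> b) *\<^sub>R b))" by (rule norm_sum)
      also have "\<dots> \<le> (\<Sum>b\<in>B. 2 * r / real N)"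
        using coord B(3) by (intro sum_mono) simp
      finally have PP: "norm (P y - P z) \<le> real s * (2 * r) / real N" by (simp add: cardB)
      have "\<bar>y \<bullet> e - z \<bullet> e\<bar> = dist (\<gamma> (P y)) (\<gamma> (P z))"
        using y z by (simp add: cell_def A_def dist_real_def)
      also have "\<dots> \<le> C * norm (P y - P z)"
        using lipschitz_onD[OF \<gamma> P P, of y z] by (simp add: dist_norm)
      finally have "\<bar>y \<bullet> e - z \<bullet> e\<bar> \<le> C * norm (P y - P z)" .
      moreover have "y - z = (P y - P z) + (y \<bullet> e - z \<bullet> e) *\<^sub>R e" by (simp add: P_def algebra_simps)
      then have "norm (y - z) \<le> norm (P y - P z) + \<bar>y \<bullet> e - z \<bullet> e\<bar>"
        using norm_triangle_ineq[of "P y - P z" "(y \<bullet> e - z \<bullet> e) *\<^sub>R e"] e by simp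
      ultimately have "norm (y - z) \<le> (1 + C) * norm (P y - P z)" by (simp add: algebra_simps)
      also have "\<dots> \<le> (1 + C) * (real s * (2 * r) / real N)"
        using PP C0 by (intro mult_left_mono) auto
      finally show "norm (y - z) \<le> K / real N" by (simp add: K_def)
    qed
    have bdd: "bounded (cell k)" for k
      by (rule bounded_subset[OF bounded_ball[of x r]]) (auto simp: cell_def A_def)
    obtain h where h: "bij_betw h {0..<card I} I"
      using ex_bij_betw_nat_finite[OF finI] by blast
    define Cs where "Cs i = (if i < card I then cell (h i) else {})" for i
    have "hausdorff_content s \<delta> A \<le> (\<Sum>i. hausdorff_gauge s (Cs i))"
    proof (rule hausdorff_content_le)
      show "A \<subseteq> (\<Union>i. Cs i)"
      proof
        fix y assume "y \<in> A"
        then obtain k where "k \<in> I" "y \<in> cell k" using cover by blast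
        then have "k \<in> h ` {0..<card I}" using h by (simp add: bij_betw_def)
        then obtain i where "i < card I" "h i = k" by auto
        then show "y \<in> (\<Union>i. Cs i)" using \<open>y \<in> cell k\<close> by (auto simp: Cs_def)
      qed
      show "bounded (Cs i)" for i using bdd by (simp add: Cs_def)
      show "diameter (Cs i) \<le> \<delta>" for i
        using order_trans[OF diam N] \<open>\<delta> > 0\<close> by (auto simp: Cs_def)
    qed
    also have "\<dots> = (\<Sum>i<card I. hausdorff_gauge s (Cs i))"
      by (rule suminf_finite) (auto simp: Cs_def)
    also have "\<dots> \<le> (\<Sum>i<card I. ennreal (unit_ball_vol (real s) * (K / real N / 2) ^ s))"
    proof (rule sum_mono)
      fix i assume "i \<in> {..<card I}"
      have "diameter (Cs i) \<ge> 0" "diameter (Cs i) \<le> K / real N"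
        using bdd diam[of "h i"] K0 diameter_ge_0 by (auto simp: Cs_def)
      then have "unit_ball_vol (real s) * (diameter (Cs i) / 2) ^ s \<le> unit_ball_vol (real s) * (K / real N / 2) ^ s"
        by (intro mult_left_mono power_mono) (auto intro: unit_ball_vol_nonneg)
      then show "hausdorff_gauge s (Cs i) \<le> ennreal (unit_ball_vol (real s) * (K / real N / 2) ^ s)"
        by (auto simp: hausdorff_gauge_def intro: ennreal_leI)
    qed
    also have "\<dots> = ennreal (real (card I) * (unit_ball_vol (real s) * (K / real N / 2) ^ s))"
      using K0 Npos by (simp add: ennreal_of_nat_eq_real_of_nat ennreal_mult'' unit_ball_vol_nonneg)
    also have "real (card I) * (unit_ball_vol (real s) * (K / real N / 2) ^ s) = M"
      using Npos by (simp add: cardI M_def power_divide)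
    finally show ?thesis .
  qed
  have "hausdorff_outer s A \<le> ennreal M"
    using bound by (rule hausdorff_outer_leI)
  also have "\<dots> < top" by simp
  finally show ?thesis by (simp add: A_def s_def P_def)
qed

text \<open>The points of the ball above the graph lie in the open set \<open>\<Omega>\<close>, and
  those below form an open set disjoint from \<open>\<Omega>\<close>; neither can be frontier
  points.\<close>

lemma lipschitz_boundary_frontier_in_graph:
  fixes \<Omega> :: "'a::euclidean_space set"
  assumes \<Omega>: "open \<Omega>" and e: "norm e = 1" and \<gamma>: "C-lipschitz_on {y. y \<bullet> e = 0} \<gamma>"
    and eq: "\<Omega> \<inter> ball x r = {y \<in> ball x r. y \<bullet> e > \<gamma> (y - (y \<bullet> e) *\<^sub>R e)}"
  shows "frontier \<Omega> \<inter> ball x r \<subseteq> {y \<in> ball x r. y \<bullet> e = \<gamma> (y - (y \<bullet> e) *\<^sub>R e)}"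
proof
  fix y assume y: "y \<in> frontier \<Omega> \<inter> ball x r"
  define P where "P y = y - (y \<bullet> e) *\<^sub>R e" for y
  have "e \<bullet> e = 1" using e by (simp add: norm_eq_1)
  then have P: "P y \<in> {y. y \<bullet> e = 0}" for y by (simp add: P_def inner_diff_left)
  have cont: "continuous_on UNIV (\<lambda>y. \<gamma> (P y))"
    by (rule continuous_on_compose2[OF lipschitz_on_continuous_on[OF \<gamma>]])
      (use P in \<open>auto simp: P_def intro!: continuous_intros\<close>)
  have "y \<notin> \<Omega>" using y \<Omega> by (auto simp: frontier_def interior_open)
  then have "\<not> y \<bullet> e > \<gamma> (P y)" using y eq by (auto simp: P_def)
  moreover have "\<not> y \<bullet> e < \<gamma> (P y)"
  proof
    assume less: "y \<bullet> e < \<gamma> (P y)"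
    define T where "T = ball x r \<inter> {z. z \<bullet> e < \<gamma> (P z)}"
    have "open T"
      unfolding T_def using cont by (intro open_Int open_ball open_Collect_less) (auto intro!: continuous_intros)
    moreover have "\<Omega> \<inter> T = {}"
    proof -
      have "z \<bullet> e > \<gamma> (P z)" if "z \<in> \<Omega>" "z \<in> ball x r" for z
        using that eq unfolding P_def by blast
      then show ?thesis unfolding T_def by force
    qed
    ultimately have "closure \<Omega> \<inter> T = {}" by (metis Int_commute open_Int_closure_eq_empty)
    then show False using y less by (auto simp: T_def frontier_def)
  qed
  ultimately show "y \<in> {y \<in> ball x r. y \<bullet> e = \<gamma> (y - (y \<bullet> e) *\<^sub>R e)}"
    using y by (simp add: P_def)
qed

text \<open>The frontier is compact, so finitely many of the balls of the Lipschitz condition cover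
  it, and in each of them the frontier lies in a graph of finite outer measure.\<close>

lemma finite_measure_surface_measure:
  fixes \<Omega> :: "'a::euclidean_space set"
  assumes \<Omega>: "open \<Omega>" "bounded \<Omega>" "lipschitz_boundary \<Omega>"
  shows "finite_measure (surface_measure \<Omega>)"
proof -
  let ?o = "hausdorff_outer (DIM('a) - 1) :: 'a set \<Rightarrow> ennreal"
  have "\<exists>r>0. ?o (frontier \<Omega> \<inter> ball x r) < top" if "x \<in> frontier \<Omega>" for x
  proof -
    obtain r e \<gamma> C where *: "r > 0" "norm e = 1" "C-lipschitz_on {y. y \<bullet> e = 0} \<gamma>"
        "\<Omega> \<inter> ball x r = {y \<in> ball x r. y \<bullet> e > \<gamma> (y - (y \<bullet> e) *\<^sub>R e)}"
      using \<Omega>(3) \<open>x \<in> frontier \<Omega>\<close> unfolding lipschitz_boundary_def by blast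
    have "?o (frontier \<Omega> \<inter> ball x r) < top"
      using hausdorff_outer_mono[OF lipschitz_boundary_frontier_in_graph[OF \<Omega>(1) *(2-4)]]
        hausdorff_outer_lipschitz_graph_finite[OF *(2,3,1), of x] by (rule le_less_trans)
    then show ?thesis using *(1) by blast
  qed
  then obtain r where r: "\<And>x. x \<in> frontier \<Omega> \<Longrightarrow> r x > 0"
    "\<And>x. x \<in> frontier \<Omega> \<Longrightarrow> ?o (frontier \<Omega> \<inter> ball x (r x)) < top"
    by metis
  have "compact (frontier \<Omega>)" using \<Omega>(2) by (rule compact_frontier_bounded)
  then obtain F where F: "F \<subseteq> frontier \<Omega>" "finite F" "frontier \<Omega> \<subseteq> (\<Union>x\<in>F. ball x (r x))"
  proof (rule compactE_image[of "frontier \<Omega>" "frontier \<Omega>" "\<lambda>x. ball x (r x)"])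
    show "frontier \<Omega> \<subseteq> (\<Union>x\<in>frontier \<Omega>. ball x (r x))" using r(1) by force
  qed auto
  have "?o (\<Union>x\<in>F. frontier \<Omega> \<inter> ball x (r x)) < top"
    using F(2,1)
  proof (induction F)
    case (insert x F)
    have "?o (\<Union>y\<in>insert x F. frontier \<Omega> \<inter> ball y (r y)) \<le>
       ?o (frontier \<Omega> \<inter> ball x (r x)) + ?o (\<Union>y\<in>F. frontier \<Omega> \<inter> ball y (r y))"
      by (simp add: hausdorff_outer_Un)
    also have "\<dots> < top" using insert r(2) by auto
    finally show ?case .
  qed simp
  moreover have "frontier \<Omega> \<subseteq> (\<Union>x\<in>F. frontier \<Omega> \<inter> ball x (r x))" using F(3) by blast
  ultimately have fin: "?o (frontier \<Omega>) < top"
    by (meson hausdorff_outer_mono le_less_trans)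
  have sp: "space (hausdorff_measure s :: 'a measure) = UNIV" for s
    by (simp add: hausdorff_measure_def)
  have "emeasure (surface_measure \<Omega>) (space (surface_measure \<Omega>)) =
      emeasure (hausdorff_measure (DIM('a) - 1)) (frontier \<Omega>)"
    unfolding surface_measure_def space_restrict_space sp
    using frontier_in_sets_hausdorff by (subst emeasure_restrict_space) (auto simp: sp)
  also have "\<dots> \<le> ?o (frontier \<Omega>)" by (rule emeasure_hausdorff_le_outer)
  finally show ?thesis
    using fin by (intro finite_measureI) (auto simp: top_unique)
qed

section \<open>Square integrable functions\<close>

text \<open>The squared norm is used throughout: the parallelogram identity is linear in it, and the
  triangle inequality only costs a factor 2.\<close>

definition L2_sq :: "'a measure \<Rightarrow> ('a \<Rightarrow> 'b::euclidean_space) \<Rightarrow> real" where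
  "L2_sq M f = (LINT x|M. (norm (f x))\<^sup>2)"

lemma L2_spaceD:
  assumes "f \<in> L2_space M"
  shows "f \<in> borel_measurable M" "integrable M (\<lambda>x. (norm (f x))\<^sup>2)"
  using assms by (auto simp: L2_space_def)

lemma L2_sq_nonneg [simp]: "0 \<le> L2_sq M f"
  by (simp add: L2_sq_def)

lemma L2_sq_zero [simp]: "L2_sq M (\<lambda>_. 0) = 0"
  by (simp add: L2_sq_def)

lemma L2_space_bound:
  assumes "f \<in> L2_space M" "g \<in> borel_measurable M" "AE x in M. norm (g x) \<le> c * norm (f x)"
  shows "g \<in> L2_space M"
proof -
  have "integrable M (\<lambda>x. (norm (g x))\<^sup>2)"
  proof (rule Bochner_Integration.integrable_bound)
    show "integrable M (\<lambda>x. c\<^sup>2 * (norm (f x))\<^sup>2)"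
      using L2_spaceD[OF assms(1)] by simp
    show "AE x in M. norm ((norm (g x))\<^sup>2) \<le> norm (c\<^sup>2 * (norm (f x))\<^sup>2)"
      using assms(3)
    proof eventually_elim
      case (elim x)
      then have "(norm (g x))\<^sup>2 \<le> (c * norm (f x))\<^sup>2" by (intro power_mono) auto
      then show ?case by (simp add: power_mult_distrib)
    qed
  qed (use assms(2) in measurable)
  then show ?thesis using assms by (simp add: L2_space_def)
qed

lemma norm_add_sq_le:
  fixes x y :: "'b::real_inner"
  shows "(norm (x + y))\<^sup>2 \<le> 2 * (norm x)\<^sup>2 + 2 * (norm y)\<^sup>2"
proof -
  have "(norm (x + y))\<^sup>2 + (norm (x - y))\<^sup>2 = 2 * (norm x)\<^sup>2 + 2 * (norm y)\<^sup>2"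
    by (simp add: power2_norm_eq_inner inner_add_left inner_add_right inner_diff_left inner_diff_right inner_commute)
  then show ?thesis using zero_le_power2[of "norm (x - y)"] by linarith
qed

lemma L2_space_add:
  assumes "f \<in> L2_space M" "g \<in> L2_space M"
  shows "(\<lambda>x. f x + g x) \<in> L2_space M"
proof -
  have [measurable]: "f \<in> borel_measurable M" "g \<in> borel_measurable M" using assms L2_spaceD by auto
  have "integrable M (\<lambda>x. (norm (f x + g x))\<^sup>2)"
  proof (rule Bochner_Integration.integrable_bound)
    show "integrable M (\<lambda>x. 2 * (norm (f x))\<^sup>2 + 2 * (norm (g x))\<^sup>2)"
      using L2_spaceD(2)[OF assms(1)] L2_spaceD(2)[OF assms(2)] by simp
  qed (auto intro!: AE_I2 norm_add_sq_le)
  then show ?thesis by (simp add: L2_space_def)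
qed

lemma L2_space_scaleR:
  assumes "f \<in> L2_space M"
  shows "(\<lambda>x. c *\<^sub>R f x) \<in> L2_space M"
  using assms L2_spaceD(1)[OF assms] by (intro L2_space_bound[OF assms, where c="\<bar>c\<bar>"]) auto

lemma L2_space_minus:
  assumes "f \<in> L2_space M"
  shows "(\<lambda>x. - f x) \<in> L2_space M"
  using L2_space_scaleR[OF assms, of "-1"] by simp

lemma L2_space_diff:
  assumes "f \<in> L2_space M" "g \<in> L2_space M"
  shows "(\<lambda>x. f x - g x) \<in> L2_space M"
  using L2_space_add[OF assms(1) L2_space_minus[OF assms(2)]] by simp

lemma L2_space_const:
  assumes "finite_measure M"
  shows "(\<lambda>_. c) \<in> L2_space M"
  using finite_measure.integrable_const[OF assms] by (simp add: L2_space_def)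

lemma L2_space_bounded_linear:
  assumes "bounded_linear h" "f \<in> L2_space M"
  shows "(\<lambda>x. h (f x)) \<in> L2_space M"
proof -
  interpret bounded_linear h by (rule assms)
  obtain K where K: "\<And>x. norm (h x) \<le> norm x * K" using bounded by blast
  have [measurable]: "h \<in> borel_measurable borel"
    by (intro borel_measurable_continuous_onI linear_continuous_on assms)
  show ?thesis
    using K L2_spaceD(1)[OF assms(2)]
    by (intro L2_space_bound[OF assms(2), where c=K]) (auto simp: mult.commute)
qed

lemma L2_sq_mono:
  assumes "g \<in> L2_space M" "f \<in> L2_space M" "\<And>x. norm (f x) \<le> norm (g x)"
  shows "L2_sq M f \<le> L2_sq M g"
  unfolding L2_sq_def using L2_spaceD(2)[OF assms(1)] L2_spaceD(2)[OF assms(2)] assms(3)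
  by (intro integral_mono power_mono) auto

lemma L2_sq_add_le:
  assumes "f \<in> L2_space M" "g \<in> L2_space M"
  shows "L2_sq M (\<lambda>x. f x + g x) \<le> 2 * L2_sq M f + 2 * L2_sq M g"
proof -
  have "L2_sq M (\<lambda>x. f x + g x) \<le> (LINT x|M. 2 * (norm (f x))\<^sup>2 + 2 * (norm (g x))\<^sup>2)"
    unfolding L2_sq_def
    using L2_spaceD(2)[OF L2_space_add[OF assms]] L2_spaceD(2)[OF assms(1)] L2_spaceD(2)[OF assms(2)]
    by (intro integral_mono norm_add_sq_le) auto
  also have "\<dots> = 2 * L2_sq M f + 2 * L2_sq M g"
    unfolding L2_sq_def using L2_spaceD(2)[OF assms(1)] L2_spaceD(2)[OF assms(2)] by simp
  finally show ?thesis .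
qed

lemma L2_sq_triangle:
  assumes "f \<in> L2_space M" "g \<in> L2_space M" "h \<in> L2_space M"
  shows "L2_sq M (\<lambda>x. f x - h x) \<le> 2 * L2_sq M (\<lambda>x. f x - g x) + 2 * L2_sq M (\<lambda>x. g x - h x)"
  using L2_sq_add_le[OF L2_space_diff[OF assms(1,2)] L2_space_diff[OF assms(2,3)]] by simp

lemma L2_sq_minus_commute: "L2_sq M (\<lambda>x. f x - g x) = L2_sq M (\<lambda>x. g x - f x)"
  by (simp add: L2_sq_def norm_minus_commute)

lemma L2_sq_parallelogram:
  assumes "f \<in> L2_space M" "g \<in> L2_space M"
  shows "L2_sq M (\<lambda>x. f x - g x) = 2 * L2_sq M f + 2 * L2_sq M g - 4 * L2_sq M (\<lambda>x. (1/2) *\<^sub>R (f x + g x))"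
proof -
  have eq: "(norm (a - b))\<^sup>2 = 2 * (norm a)\<^sup>2 + 2 * (norm b)\<^sup>2 - 4 * (norm ((1/2) *\<^sub>R (a + b)))\<^sup>2" for a b :: 'b
    by (simp add: power2_norm_eq_inner inner_add_left inner_add_right inner_diff_left inner_diff_right
        inner_commute power_mult_distrib field_simps)
  have i: "integrable M (\<lambda>x. (norm (f x))\<^sup>2)" "integrable M (\<lambda>x. (norm (g x))\<^sup>2)"
    "integrable M (\<lambda>x. (norm ((1/2) *\<^sub>R (f x + g x)))\<^sup>2)"
    using L2_spaceD(2)[OF L2_space_scaleR[OF L2_space_add[OF assms], of "1/2"]] assms L2_spaceD(2) by auto
  show ?thesis
    unfolding L2_sq_def eq using i by simp
qed

lemma nn_integral_L2_sq:
  assumes "f \<in> L2_space M"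
  shows "(\<integral>\<^sup>+x. ennreal ((norm (f x))\<^sup>2) \<partial>M) = ennreal (L2_sq M f)"
  unfolding L2_sq_def using L2_spaceD[OF assms] by (intro nn_integral_eq_integral) auto

lemma L2_sq_le_nn_integral:
  assumes "f \<in> borel_measurable M" "(\<integral>\<^sup>+x. ennreal ((norm (f x))\<^sup>2) \<partial>M) \<le> ennreal c" "c \<ge> 0"
  shows "f \<in> L2_space M" "L2_sq M f \<le> c"
proof -
  have "integrable M (\<lambda>x. (norm (f x))\<^sup>2)"
  proof (rule integrableI_bounded)
    show "(\<integral>\<^sup>+x. ennreal (norm ((norm (f x))\<^sup>2)) \<partial>M) < \<infinity>"
      using le_less_trans[OF assms(2) ennreal_less_top] by simp
  qed (use assms(1) in measurable)
  then show "f \<in> L2_space M" using assms(1) by (simp add: L2_space_def)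
  from nn_integral_L2_sq[OF this] show "L2_sq M f \<le> c" using assms(2,3) by (simp add: ennreal_le_iff)
qed

lemma ennreal_le_suminf: "(t k :: ennreal) \<le> suminf t"
  using sum_le_suminf[OF summableI, of "{k}" t] by simp

text \<open>Riesz-Fischer. Along \<open>r\<close> the integral of |d k|^2 is below 8^(-k), so that
  the sum of 2^k |d k|^2 has a finite integral; where this sum is finite, |d k| is at most a
  constant times 2^(-k/2), and the subsequence converges. Fatou's lemma then turns the pointwise
  limit of the subsequence into an L^2 limit of the whole sequence.\<close>

lemma L2_complete:
  fixes f :: "nat \<Rightarrow> 'a \<Rightarrow> 'b::euclidean_space"
  assumes f: "\<And>n. f n \<in> L2_space M"
    and Cauchy: "\<And>e. e > 0 \<Longrightarrow> \<exists>N. \<forall>m\<ge>N. \<forall>n\<ge>N. L2_sq M (\<lambda>x. f m x - f n x) < e"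
  obtains g where "g \<in> L2_space M" "(\<lambda>n. L2_sq M (\<lambda>x. f n x - g x)) \<longlonglongrightarrow> 0"
proof -
  have [measurable]: "f n \<in> borel_measurable M" for n using f L2_spaceD(1) by blast
  have "\<exists>N. \<forall>m\<ge>N. \<forall>n\<ge>N. L2_sq M (\<lambda>x. f m x - f n x) < (1/8)^k" for k :: nat
    by (rule Cauchy) simp
  then obtain N0 where N0: "\<And>k m n. m \<ge> N0 k \<Longrightarrow> n \<ge> N0 k \<Longrightarrow> L2_sq M (\<lambda>x. f m x - f n x) < (1/8)^k"
    by metis
  \<comment> \<open>The sum makes \<open>r (Suc k) \<ge> N0 k\<close> hold as well as
    \<open>r k \<ge> N0 k\<close>, so that \<open>d k\<close> compares two late terms; the summand
    \<open>k\<close> makes \<open>r\<close> unbounded.\<close>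
  define r where "r k = k + (\<Sum>j\<le>k. N0 j)" for k
  have r: "r k \<ge> N0 k" "r k \<ge> k" "r (Suc k) \<ge> N0 k" for k
  proof -
    have "N0 k \<le> (\<Sum>j\<le>k. N0 j)" by (rule member_le_sum) auto
    then show "r k \<ge> N0 k" "r k \<ge> k" "r (Suc k) \<ge> N0 k" unfolding r_def by auto
  qed
  define d where "d k x = f (r (Suc k)) x - f (r k) x" for k x
  have d: "d k \<in> L2_space M" "L2_sq M (d k) < (1/8)^k" for k
    unfolding d_def using L2_space_diff[OF f f] N0[OF r(3) r(1)] by auto
  have [measurable]: "d k \<in> borel_measurable M" for k unfolding d_def by measurable
  define h where "h x = (\<Sum>k. ennreal (2^k * (norm (d k x))\<^sup>2))" for x
  have [measurable]: "h \<in> borel_measurable M" unfolding h_def by measurable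
  have "(\<integral>\<^sup>+x. h x \<partial>M) = (\<Sum>k. \<integral>\<^sup>+x. ennreal (2^k * (norm (d k x))\<^sup>2) \<partial>M)"
    unfolding h_def by (rule nn_integral_suminf) measurable
  also have "\<dots> = (\<Sum>k. ennreal (2^k * L2_sq M (d k)))"
    by (simp add: ennreal_mult nn_integral_cmult nn_integral_L2_sq[OF d(1)])
  also have "\<dots> \<le> (\<Sum>k. ennreal ((1/4)^k))"
  proof (intro suminf_le ennreal_leI)
    fix k :: nat
    have "2^k * L2_sq M (d k) \<le> 2^k * (1/8)^k" using d(2)[of k] by (intro mult_left_mono) auto
    also have "\<dots> = (1/4::real)^k" by (simp add: power_mult_distrib[symmetric])
    finally show "2^k * L2_sq M (d k) \<le> (1/4)^k" .
  qed auto
  also have "\<dots> < \<infinity>"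
    by (subst suminf_ennreal2) (auto intro: summable_geometric)
  finally have "AE x in M. h x \<noteq> \<infinity>"
    by (intro nn_integral_PInf_AE) auto
  then have conv: "AE x in M. convergent (\<lambda>k. f (r k) x)"
  proof eventually_elim
    case (elim x)
    then obtain c where c: "h x = ennreal c" "c \<ge> 0" by (cases "h x") auto
    have bound: "norm (d k x) \<le> sqrt c * (sqrt (1/2))^k" for k
    proof -
      have "ennreal (2^k * (norm (d k x))\<^sup>2) \<le> h x"
        unfolding h_def by (rule ennreal_le_suminf)
      then have "2^k * (norm (d k x))\<^sup>2 \<le> c" using c by (simp add: ennreal_le_iff)
      then have "(norm (d k x))\<^sup>2 \<le> c * (1/2)^k" by (simp add: power_divide pos_le_divide_eq mult.commute)
      then have "norm (d k x) \<le> sqrt (c * (1/2)^k)" by (simp add: real_le_rsqrt)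
      then show ?thesis by (simp only: real_sqrt_mult real_sqrt_power)
    qed
    have "summable (\<lambda>k. sqrt c * (sqrt (1/2))^k)"
      by (intro summable_mult summable_geometric) (simp add: real_sqrt_divide)
    then have "summable (\<lambda>k. d k x)"
      by (rule summable_comparison_test'[where N=0]) (rule bound)
    then have "convergent (\<lambda>n. \<Sum>k<n. d k x)" by (simp add: summable_iff_convergent)
    moreover have "(\<Sum>k<n. d k x) = f (r n) x - f (r 0) x" for n
      unfolding d_def by (rule sum_lessThan_telescope)
    ultimately have "convergent (\<lambda>n. (f (r n) x - f (r 0) x) + f (r 0) x)"
      by (intro convergent_add) (auto intro: convergent_const)
    then show ?case by simp
  qed
  define g where "g x = lim (\<lambda>k. f (r k) x)" for x
  have [measurable]: "g \<in> borel_measurable M" unfolding g_def by measurable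
  have lim: "AE x in M. (\<lambda>k. f (r k) x) \<longlonglongrightarrow> g x"
    using conv unfolding g_def by eventually_elim (simp add: convergent_LIMSEQ_iff)
  have Fatou: "(\<lambda>x. f n x - g x) \<in> L2_space M" "L2_sq M (\<lambda>x. f n x - g x) \<le> (1/8)^k" if "n \<ge> N0 k" for n k
  proof -
    have "(\<integral>\<^sup>+x. ennreal ((norm (f n x - g x))\<^sup>2) \<partial>M) \<le> (\<integral>\<^sup>+x. liminf (\<lambda>j. ennreal ((norm (f n x - f (r j) x))\<^sup>2)) \<partial>M)"
    proof (rule nn_integral_mono_AE)
      show "AE x in M. ennreal ((norm (f n x - g x))\<^sup>2) \<le> liminf (\<lambda>j. ennreal ((norm (f n x - f (r j) x))\<^sup>2))"
        using lim
      proof eventually_elim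
        case (elim x)
        have "(\<lambda>j. ennreal ((norm (f n x - f (r j) x))\<^sup>2)) \<longlonglongrightarrow> ennreal ((norm (f n x - g x))\<^sup>2)"
          by (intro tendsto_ennrealI tendsto_intros elim)
        from lim_imp_Liminf[OF _ this] show ?case by simp
      qed
    qed
    also have "\<dots> \<le> liminf (\<lambda>j. \<integral>\<^sup>+x. ennreal ((norm (f n x - f (r j) x))\<^sup>2) \<partial>M)"
      by (rule nn_integral_liminf) measurable
    also have "\<dots> \<le> ennreal ((1/8)^k)"
    proof (rule Liminf_le)
      show "\<forall>\<^sub>F j in sequentially. (\<integral>\<^sup>+x. ennreal ((norm (f n x - f (r j) x))\<^sup>2) \<partial>M) \<le> ennreal ((1/8)^k)"
        using eventually_ge_at_top[of "N0 k"]
      proof eventually_elim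
        case (elim j)
        have "L2_sq M (\<lambda>x. f n x - f (r j) x) < (1/8)^k"
          using elim r(2)[of j] by (intro N0 that) simp
        then show ?case
          by (subst nn_integral_L2_sq[OF L2_space_diff[OF f f]]) (simp add: ennreal_leI)
      qed
    qed simp
    finally have "(\<integral>\<^sup>+x. ennreal ((norm (f n x - g x))\<^sup>2) \<partial>M) \<le> ennreal ((1/8)^k)" .
    from L2_sq_le_nn_integral[OF _ this] show "(\<lambda>x. f n x - g x) \<in> L2_space M" "L2_sq M (\<lambda>x. f n x - g x) \<le> (1/8)^k"
      by auto
  qed
  show ?thesis
  proof (rule that)
    show "g \<in> L2_space M"
      using L2_space_diff[OF f[of "N0 0"] Fatou(1)[of 0 "N0 0"]] by simp
    show "(\<lambda>n. L2_sq M (\<lambda>x. f n x - g x)) \<longlonglongrightarrow> 0"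
    proof (rule LIMSEQ_I)
      fix e :: real assume "e > 0"
      then obtain k where k: "(1/8::real)^k < e" using real_arch_pow_inv[of e "1/8"] by auto
      have "norm (L2_sq M (\<lambda>x. f n x - g x) - 0) < e" if "n \<ge> N0 k" for n
        using Fatou(2)[OF that] k by simp
      then show "\<exists>no. \<forall>n\<ge>no. norm (L2_sq M (\<lambda>x. f n x - g x) - 0) < e" by blast
    qed
  qed
qed

lemma L2_tendsto_AE_subseq:
  assumes "\<And>n. f n \<in> L2_space M" "g \<in> L2_space M" "(\<lambda>n. L2_sq M (\<lambda>x. f n x - g x)) \<longlonglongrightarrow> 0"
  obtains r where "strict_mono r" "AE x in M. (\<lambda>n. f (r n) x) \<longlonglongrightarrow> g x"
proof -
  have "\<exists>r. strict_mono r \<and> (AE x in M. (\<lambda>n. (norm (f (r n) x - g x))\<^sup>2) \<longlonglongrightarrow> 0)"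
    using L2_spaceD(2)[OF L2_space_diff[OF assms(1,2)]] assms(3)
    by (intro tendsto_L1_AE_subseq) (auto simp: L2_sq_def)
  then obtain r where r: "strict_mono r" "AE x in M. (\<lambda>n. (norm (f (r n) x - g x))\<^sup>2) \<longlonglongrightarrow> 0" by blast
  have "AE x in M. (\<lambda>n. f (r n) x) \<longlonglongrightarrow> g x"
    using r(2)
  proof eventually_elim
    case (elim x)
    then have "(\<lambda>n. sqrt ((norm (f (r n) x - g x))\<^sup>2)) \<longlonglongrightarrow> sqrt 0" by (intro tendsto_intros)
    then have "(\<lambda>n. f (r n) x - g x) \<longlonglongrightarrow> 0" by (simp add: tendsto_norm_zero_iff)
    then show ?case by (simp add: LIM_zero_iff)
  qed
  then show ?thesis using r(1) that by blast
qed

lemma L2_imp_integrable: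
  assumes "finite_measure M" "f \<in> L2_space M"
  shows "integrable M f"
proof (rule Bochner_Integration.integrable_bound)
  show "integrable M (\<lambda>x. 1 + (norm (f x))\<^sup>2)"
    using finite_measure.integrable_const[OF assms(1), of "1::real"] L2_spaceD(2)[OF assms(2)] by simp
  have "t \<le> 1 + t\<^sup>2" for t :: real
    using zero_le_power2[of "t - 1/2"] by (simp add: power2_diff power2_eq_square algebra_simps)
  then show "AE x in M. norm (f x) \<le> norm (1 + (norm (f x))\<^sup>2)"
    by (intro AE_I2) simp
qed (rule L2_spaceD(1)[OF assms(2)])

text \<open>The elementary inequality t \<le> c + t^2 / c takes the place of Cauchy-Schwarz;
  \<open>c\<close> is chosen so small that its integral is at most e / 2.\<close>

lemma L2_tendsto_imp_L1_tendsto: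
  assumes M: "finite_measure M" and f: "\<And>n. f n \<in> L2_space M" and lim: "(\<lambda>n. L2_sq M (f n)) \<longlonglongrightarrow> 0"
  shows "(\<lambda>n. LINT x|M. norm (f n x)) \<longlonglongrightarrow> 0"
proof (rule LIMSEQ_I)
  interpret finite_measure M by (rule M)
  fix e :: real assume e: "e > 0"
  define c where "c = e / (2 * (measure M (space M) + 1))"
  have c: "c > 0" unfolding c_def using e by (intro divide_pos_pos mult_pos_pos add_nonneg_pos measure_nonneg) auto
  have "\<forall>\<^sub>F n in sequentially. L2_sq M (f n) < c * e / 2"
    by (rule order_tendstoD(2)[OF lim]) (use c e in simp)
  then obtain N where N: "\<And>n. n \<ge> N \<Longrightarrow> L2_sq M (f n) < c * e / 2" by (auto simp: eventually_sequentially)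
  have "norm ((LINT x|M. norm (f n x)) - 0) < e" if "n \<ge> N" for n
  proof -
    have "t \<le> c + t\<^sup>2 / c" if "t \<ge> 0" for t :: real
    proof (cases "t \<le> c")
      case False
      then have "t * c \<le> t * t" using that by (intro mult_left_mono) auto
      then show ?thesis using c by (simp add: field_simps power2_eq_square add_nonneg_nonneg add_increasing)
    qed (use c in \<open>simp add: add_increasing2\<close>)
    then have "(LINT x|M. norm (f n x)) \<le> (LINT x|M. c + (norm (f n x))\<^sup>2 / c)"
      using L2_imp_integrable[OF M f] L2_spaceD(2)[OF f] by (intro integral_mono) auto
    also have "\<dots> = c * measure M (space M) + L2_sq M (f n) / c"
      unfolding L2_sq_def using L2_spaceD(2)[OF f] by simp
    also have "\<dots> < c * measure M (space M) + e / 2"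
      using N[OF that] c by (simp add: field_simps)
    also have "c * measure M (space M) \<le> e / 2"
    proof -
      have "measure M (space M) + 1 > 0" by (intro add_nonneg_pos measure_nonneg) simp
      then have "c * (measure M (space M) + 1) = e / 2"
        unfolding c_def by (metis less_irrefl mult.commute nonzero_mult_divide_mult_cancel_right times_divide_eq_left)
      then show ?thesis using c by (simp add: algebra_simps)
    qed
    finally show ?thesis by simp
  qed
  then show "\<exists>no. \<forall>n\<ge>no. norm ((LINT x|M. norm (f n x)) - 0) < e" by blast
qed

section \<open>Stability of weak gradients under linear operations and limits\<close>

lemma finite_measure_lebesgue_on_bounded:
  assumes "open S" "bounded S"
  shows "finite_measure (lebesgue_on S)"
  using assms lmeasurable_open finite_measure_lebesgue_on by blast

lemma locally_integrable_on_add: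
  assumes "locally_integrable_on S f" "locally_integrable_on S g"
  shows "locally_integrable_on S (\<lambda>x. f x + g x)"
  using assms by (auto simp: locally_integrable_on_def intro: set_integral_add)

lemma locally_integrable_on_scaleR:
  assumes "locally_integrable_on S f"
  shows "locally_integrable_on S (\<lambda>x. c *\<^sub>R f x)"
  using assms by (auto simp: locally_integrable_on_def)

lemma has_weak_gradient_add:
  assumes S: "open S" and G: "has_weak_gradient S v G" and H: "has_weak_gradient S w H"
  shows "has_weak_gradient S (\<lambda>x. v x + w x) (\<lambda>x. G x + H x)"
proof -
  have GH: "locally_integrable_on S G" "locally_integrable_on S H" "locally_integrable_on S v"
     "locally_integrable_on S w"
    using G H by (auto simp: has_weak_gradient_def)
  show ?thesis
  proof (rule has_weak_gradientI_inner[OF S])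
    fix \<phi> D\<phi> and e :: 'a assume \<phi>: "test_function S \<phi> D\<phi>"
    have i: "integrable (lebesgue_on S) (\<lambda>x. f x * (D\<phi> x \<bullet> e))" if "locally_integrable_on S f" for f
      using test_function_times_locally_integrable(2)[OF that S \<phi>, of e] by (simp add: mult.commute)
    have j: "integrable (lebesgue_on S) (\<lambda>x. \<phi> x * (F x \<bullet> e))" if "locally_integrable_on S F" for F
      using test_function_times_locally_integrable(1)[OF locally_integrable_on_inner[OF that] S \<phi>] by simp
    show "(LINT x|lebesgue_on S. (v x + w x) * (D\<phi> x \<bullet> e)) = - (LINT x|lebesgue_on S. \<phi> x * ((G x + H x) \<bullet> e))"
      using has_weak_gradientD_inner[OF S G \<phi>, of e] has_weak_gradientD_inner[OF S H \<phi>, of e]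
        i[OF GH(3)] i[OF GH(4)] j[OF GH(1)] j[OF GH(2)]
      by (simp add: distrib_right distrib_left inner_add_left)
  qed (intro locally_integrable_on_add GH)+
qed

lemma has_weak_gradient_scale:
  assumes S: "open S" and G: "has_weak_gradient S v G"
  shows "has_weak_gradient S (\<lambda>x. c * v x) (\<lambda>x. c *\<^sub>R G x)"
proof (rule has_weak_gradientI_inner[OF S])
  have vG: "locally_integrable_on S v" "locally_integrable_on S G"
    using G by (auto simp: has_weak_gradient_def)
  show "locally_integrable_on S (\<lambda>x. c * v x)"
    using locally_integrable_on_scaleR[OF vG(1), of c] by simp
  show "locally_integrable_on S (\<lambda>x. c *\<^sub>R G x)"
    by (rule locally_integrable_on_scaleR[OF vG(2)])
  fix \<phi> D\<phi> and e :: 'a assume \<phi>: "test_function S \<phi> D\<phi>"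
  show "(LINT x|lebesgue_on S. c * v x * (D\<phi> x \<bullet> e)) = - (LINT x|lebesgue_on S. \<phi> x * ((c *\<^sub>R G x) \<bullet> e))"
    using has_weak_gradientD_inner[OF S G \<phi>, of e] by (simp add: mult_ac)
qed

text \<open>The gradient of a test function has integral 0, because the integral of \<phi>(x - s e)
  does not depend on s. To differentiate through
  \<open>integral_against_translated_test_function_deriv\<close>, the constant 1, which is not
  integrable on the whole space, is replaced by the indicator of a ball that contains the support of
  \<phi> and its shifts with |s| \<le> 1.\<close>

lemma has_weak_gradient_const:
  fixes S :: "'a::euclidean_space set"
  assumes S: "open S" "bounded S"
  shows "has_weak_gradient S (\<lambda>_. c) (\<lambda>_. 0)"
proof (rule has_weak_gradientI_inner[OF S(1)])
  interpret finite_measure "lebesgue_on S" by (rule finite_measure_lebesgue_on_bounded[OF S])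
  show "locally_integrable_on S (\<lambda>_. c)"
    by (rule integrable_imp_locally_integrable_on[OF S(1)]) simp
  show "locally_integrable_on S (\<lambda>_. 0::'a)"
    by (rule integrable_imp_locally_integrable_on[OF S(1)]) simp
  fix \<phi> D\<phi> and e :: 'a assume \<phi>: "test_function S \<phi> D\<phi>" and "e \<in> Basis"
  obtain K where K: "compact K" "K \<subseteq> S" "\<And>x. x \<notin> K \<Longrightarrow> \<phi> x = 0" "\<And>x. x \<notin> K \<Longrightarrow> D\<phi> x = 0"
    by (rule test_functionE[OF \<phi>]) (rule that)
  obtain R where R: "\<And>x. x \<in> K \<Longrightarrow> norm x \<le> R"
    using compact_imp_bounded[OF K(1)] by (auto simp: bounded_iff)
  define V where "V = indicat_real (cball (0::'a) (R + norm e))"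
  have V: "integrable lebesgue V"
    unfolding V_def by (rule integrable_indicator_cball)
  have m: "\<phi> \<in> borel_measurable lebesgue"
    by (rule continuous_on_imp_borel_measurable_lebesgue[OF test_function_continuous(1)[OF \<phi>]])
  have V1: "V x * f (x - s *\<^sub>R e) = f (x - s *\<^sub>R e)"
    if f: "\<And>x. x \<notin> K \<Longrightarrow> f x = 0" and "\<bar>s\<bar> \<le> 1" for x s and f :: "'a \<Rightarrow> real"
  proof (cases "x - s *\<^sub>R e \<in> K")
    case True
    then have "norm (x - s *\<^sub>R e) \<le> R" by (rule R)
    moreover have "norm x \<le> norm (x - s *\<^sub>R e) + norm (s *\<^sub>R e)"
      using norm_triangle_ineq[of "x - s *\<^sub>R e" "s *\<^sub>R e"] by simp
    moreover have "norm (s *\<^sub>R e) \<le> 1 * norm e"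
      unfolding norm_scaleR using that(2) by (intro mult_right_mono) auto
    ultimately have "norm x \<le> R + norm e" by linarith
    then show ?thesis by (simp add: V_def)
  qed (simp add: f)
  have const: "(\<integral>x. V x * \<phi> (x - s *\<^sub>R e) \<partial>lebesgue) = (\<integral>x. \<phi> x \<partial>lebesgue)" if "\<bar>s\<bar> \<le> 1" for s
  proof -
    have "(\<lambda>x. V x * \<phi> (x - s *\<^sub>R e)) = (\<lambda>x. \<phi> (x - s *\<^sub>R e))"
      by (rule ext, rule V1) (use K(3) that in auto)
    then show ?thesis
      using integral_lebesgue_translation[OF m, of "- (s *\<^sub>R e)"] by simp
  qed
  have "((\<lambda>s. \<integral>x. V x * \<phi> (x - s *\<^sub>R e) \<partial>lebesgue) has_real_derivative 0) (at 0)"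
  proof (rule has_field_derivative_transform_within_open)
    show "((\<lambda>s. \<integral>x. \<phi> x \<partial>lebesgue) has_real_derivative 0) (at 0)" by simp
    show "(\<integral>x. \<phi> x \<partial>lebesgue) = (\<integral>x. V x * \<phi> (x - s *\<^sub>R e) \<partial>lebesgue)" if "s \<in> {-1<..<1}" for s
      using that by (subst const) auto
  qed auto
  moreover have "((\<lambda>s. \<integral>x. V x * \<phi> (x - s *\<^sub>R e) \<partial>lebesgue) has_real_derivative
      - (\<integral>x. V x * (D\<phi> (x - 0 *\<^sub>R e) \<bullet> e) \<partial>lebesgue)) (at 0)"
    by (rule integral_against_translated_test_function_deriv[OF V \<phi>])
  ultimately have zero: "(\<integral>x. V x * (D\<phi> (x - 0 *\<^sub>R e) \<bullet> e) \<partial>lebesgue) = 0"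
    using DERIV_unique by fastforce
  have eq: "V x * (D\<phi> (x - 0 *\<^sub>R e) \<bullet> e) = indicator S x *\<^sub>R (D\<phi> x \<bullet> e)" for x
  proof -
    have "V x * (D\<phi> (x - 0 *\<^sub>R e) \<bullet> e) = D\<phi> (x - 0 *\<^sub>R e) \<bullet> e"
      by (rule V1) (use K(4) in auto)
    then show ?thesis using K(2) K(4)[of x] by (cases "x \<in> K") (auto simp: indicator_def)
  qed
  have "(LINT x|lebesgue_on S. D\<phi> x \<bullet> e) = 0"
    using zero unfolding eq by (subst integral_lebesgue_on_eq) (use S in auto)
  then show "(LINT x|lebesgue_on S. c * (D\<phi> x \<bullet> e)) = - (LINT x|lebesgue_on S. \<phi> x * (0 \<bullet> e))"
    by simp
qed

lemma L2_tendsto_integral_mult_bounded: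
  fixes f :: "nat \<Rightarrow> 'a \<Rightarrow> real"
  assumes M: "finite_measure M" and f: "\<And>n. f n \<in> L2_space M" and g: "g \<in> L2_space M"
    and lim: "(\<lambda>n. L2_sq M (\<lambda>x. f n x - g x)) \<longlonglongrightarrow> 0"
    and h: "h \<in> borel_measurable M" "\<And>x. \<bar>h x\<bar> \<le> B"
  shows "(\<lambda>n. LINT x|M. f n x * h x) \<longlonglongrightarrow> (LINT x|M. g x * h x)"
proof -
  have i: "integrable M (\<lambda>x. w x * h x)" if "w \<in> L2_space M" for w
    using L2_imp_integrable[OF M that] h by (rule integrable_mult_bounded)
  have d: "(\<lambda>x. f n x - g x) \<in> L2_space M" for n by (rule L2_space_diff[OF f g])
  have "(\<lambda>n. (LINT x|M. f n x * h x) - (LINT x|M. g x * h x)) \<longlonglongrightarrow> 0"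
  proof (rule Lim_null_comparison)
    show "\<forall>\<^sub>F n in sequentially. norm ((LINT x|M. f n x * h x) - (LINT x|M. g x * h x)) \<le>
        B * (LINT x|M. norm (f n x - g x))"
    proof (rule always_eventually, rule allI)
      fix n
      have "(LINT x|M. f n x * h x) - (LINT x|M. g x * h x) = (LINT x|M. (f n x - g x) * h x)"
        using i[OF f] i[OF g] by (simp add: left_diff_distrib)
      also have "norm \<dots> \<le> (LINT x|M. norm ((f n x - g x) * h x))"
        by (rule integral_norm_bound)
      also have "\<dots> \<le> (LINT x|M. B * norm (f n x - g x))"
      proof (rule integral_mono)
        show "integrable M (\<lambda>x. norm ((f n x - g x) * h x))" using i[OF d] by (rule integrable_norm)
        show "integrable M (\<lambda>x. B * norm (f n x - g x))"
          using L2_imp_integrable[OF M d] by simp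
        show "norm ((f n x - g x) * h x) \<le> B * norm (f n x - g x)" for x
          using mult_right_mono[OF h(2), of "\<bar>f n x - g x\<bar>" x] by (simp add: abs_mult mult.commute)
      qed
      finally show "norm ((LINT x|M. f n x * h x) - (LINT x|M. g x * h x)) \<le> B * (LINT x|M. norm (f n x - g x))"
        by simp
    qed
    show "(\<lambda>n. B * (LINT x|M. norm (f n x - g x))) \<longlonglongrightarrow> 0"
      using tendsto_mult[OF tendsto_const L2_tendsto_imp_L1_tendsto[OF M d lim], of B] by simp
  qed
  then show ?thesis by (simp add: LIM_zero_iff)
qed

text \<open>Both sides of the identity are continuous in L^2: test functions and their gradients are
  bounded, and on a set of finite measure L^2 convergence implies L^1 convergence.\<close>

lemma has_weak_gradient_L2_limit:
  fixes S :: "'a::euclidean_space set"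
  assumes S: "open S" "bounded S"
    and v: "\<And>n. v n \<in> L2_space (lebesgue_on S)" "v0 \<in> L2_space (lebesgue_on S)"
    and G: "\<And>n. G n \<in> L2_space (lebesgue_on S)" "G0 \<in> L2_space (lebesgue_on S)"
    and wg: "\<And>n. has_weak_gradient S (v n) (G n)"
    and lim: "(\<lambda>n. L2_sq (lebesgue_on S) (\<lambda>x. v n x - v0 x)) \<longlonglongrightarrow> 0"
      "(\<lambda>n. L2_sq (lebesgue_on S) (\<lambda>x. G n x - G0 x)) \<longlonglongrightarrow> 0"
  shows "has_weak_gradient S v0 G0"
proof (rule has_weak_gradientI_inner[OF S(1)])
  note fin = finite_measure_lebesgue_on_bounded[OF S]
  show "locally_integrable_on S v0" "locally_integrable_on S G0"
    using L2_imp_integrable[OF fin] v(2) G(2) by (auto intro: integrable_imp_locally_integrable_on[OF S(1)])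
  fix \<phi> D\<phi> and e :: 'a assume \<phi>: "test_function S \<phi> D\<phi>" and "e \<in> Basis"
  obtain B where B: "B > 0" "\<And>x. \<bar>\<phi> x\<bar> \<le> B" "\<And>x. norm (D\<phi> x) \<le> B"
    by (rule test_function_bounded[OF \<phi>]) (rule that)
  have m: "\<phi> \<in> borel_measurable (lebesgue_on S)" "(\<lambda>x. D\<phi> x \<bullet> e) \<in> borel_measurable (lebesgue_on S)"
    using test_function_continuous[OF \<phi>]
    by (auto intro!: measurable_restrict_space1 continuous_on_imp_borel_measurable_lebesgue continuous_intros)
  have b: "\<bar>D\<phi> x \<bullet> e\<bar> \<le> B" for x
    using Cauchy_Schwarz_ineq2[of "D\<phi> x" e] B(3)[of x] \<open>e \<in> Basis\<close> by simp
  have l1: "(\<lambda>n. LINT x|lebesgue_on S. v n x * (D\<phi> x \<bullet> e)) \<longlonglongrightarrow> (LINT x|lebesgue_on S. v0 x * (D\<phi> x \<bullet> e))"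
    by (rule L2_tendsto_integral_mult_bounded[OF fin v lim(1) m(2) b])
  have inner: "(\<lambda>x. F x \<bullet> e) \<in> L2_space (lebesgue_on S)" if "F \<in> L2_space (lebesgue_on S)" for F
    using bounded_linear_inner_left that by (rule L2_space_bounded_linear)
  have "(\<lambda>n. L2_sq (lebesgue_on S) (\<lambda>x. G n x \<bullet> e - G0 x \<bullet> e)) \<longlonglongrightarrow> 0"
  proof (rule tendsto_sandwich[OF _ _ tendsto_const lim(2)])
    show "\<forall>\<^sub>F n in sequentially. L2_sq (lebesgue_on S) (\<lambda>x. G n x \<bullet> e - G0 x \<bullet> e) \<le>
        L2_sq (lebesgue_on S) (\<lambda>x. G n x - G0 x)"
    proof (intro always_eventually allI L2_sq_mono L2_space_diff G inner)
      fix n x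
      show "norm (G n x \<bullet> e - G0 x \<bullet> e) \<le> norm (G n x - G0 x)"
        using Cauchy_Schwarz_ineq2[of "G n x - G0 x" e] \<open>e \<in> Basis\<close> by (simp add: inner_diff_left)
    qed
  qed simp
  then have "(\<lambda>n. LINT x|lebesgue_on S. (G n x \<bullet> e) * \<phi> x) \<longlonglongrightarrow> (LINT x|lebesgue_on S. (G0 x \<bullet> e) * \<phi> x)"
    by (intro L2_tendsto_integral_mult_bounded[OF fin _ _ _ m(1) B(2)] inner G)
  then have l2: "(\<lambda>n. - (LINT x|lebesgue_on S. \<phi> x * (G n x \<bullet> e))) \<longlonglongrightarrow> - (LINT x|lebesgue_on S. \<phi> x * (G0 x \<bullet> e))"
    by (intro tendsto_minus) (simp add: mult.commute)
  show "(LINT x|lebesgue_on S. v0 x * (D\<phi> x \<bullet> e)) = - (LINT x|lebesgue_on S. \<phi> x * (G0 x \<bullet> e))"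
    using LIMSEQ_unique[OF l1] l2 has_weak_gradientD_inner[OF S(1) wg \<phi>, of _ e] by simp
qed

lemma weak_gradient_AE_eq:
  assumes "open S" "has_weak_gradient S v G"
  shows "has_weak_gradient S v (weak_gradient S v)" "AE x in lebesgue_on S. weak_gradient S v x = G x"
proof -
  show 1: "has_weak_gradient S v (weak_gradient S v)"
    unfolding weak_gradient_def by (rule someI[of "has_weak_gradient S v", OF assms(2)])
  show "AE x in lebesgue_on S. weak_gradient S v x = G x"
    by (rule has_weak_gradient_unique[OF assms(1) 1 assms(2)]) simp
qed

text \<open>\<open>weak_gradient\<close> is an arbitrary choice, but it agrees almost everywhere
  with any given weak gradient.\<close>

lemma H1_sqnorm_eq:
  assumes S: "open S" and wg: "has_weak_gradient S v G" and v: "v \<in> L2_space (lebesgue_on S)"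
    and G: "G \<in> L2_space (lebesgue_on S)"
  shows "H1_sqnorm S v = ennreal (L2_sq (lebesgue_on S) v + L2_sq (lebesgue_on S) G)"
proof -
  have [measurable]: "v \<in> borel_measurable (lebesgue_on S)" "G \<in> borel_measurable (lebesgue_on S)"
    using v G by (auto dest: L2_spaceD)
  have "H1_sqnorm S v = (\<integral>\<^sup>+x. ennreal ((norm (v x))\<^sup>2) + ennreal ((norm (G x))\<^sup>2) \<partial>lebesgue_on S)"
    unfolding H1_sqnorm_def
    by (rule nn_integral_cong_AE) (use weak_gradient_AE_eq(2)[OF S wg] in eventually_elim, simp)
  also have "\<dots> = (\<integral>\<^sup>+x. ennreal ((norm (v x))\<^sup>2) \<partial>lebesgue_on S) + (\<integral>\<^sup>+x. ennreal ((norm (G x))\<^sup>2) \<partial>lebesgue_on S)"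
    by (rule nn_integral_add) measurable
  also have "\<dots> = ennreal (L2_sq (lebesgue_on S) v + L2_sq (lebesgue_on S) G)"
    using nn_integral_L2_sq[OF v] nn_integral_L2_sq[OF G] by simp
  finally show ?thesis .
qed

section \<open>Traces\<close>

text \<open>The approximating sequence of \<open>has_trace\<close> expressed by a tolerance, with
  the gradient named. In this form a limit of limits needs no diagonal sequence, see
  \<open>trace_triple_L2_limit\<close>.\<close>

definition H1_trace_close ::
  "'a::euclidean_space set \<Rightarrow> ('a \<Rightarrow> real) \<Rightarrow> ('a \<Rightarrow> 'a) \<Rightarrow> ('a \<Rightarrow> real) \<Rightarrow> real \<Rightarrow> ('a \<Rightarrow> real) \<Rightarrow> ('a \<Rightarrow> 'a) \<Rightarrow> bool" where
  "H1_trace_close S v G g e w Dw \<longleftrightarrow>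
     w \<in> L2_space (lebesgue_on S) \<and> Dw \<in> L2_space (lebesgue_on S) \<and>
     has_weak_gradient S w Dw \<and> continuous_on (closure S) w \<and>
     L2_sq (lebesgue_on S) (\<lambda>x. w x - v x) < e \<and> L2_sq (lebesgue_on S) (\<lambda>x. Dw x - G x) < e \<and>
     L2_sq (surface_measure S) (\<lambda>x. w x - g x) < e"

text \<open>\<open>trace_triple S v G g\<close>: \<open>v\<close> is in \<open>H\<^sup>1(S)\<close> with gradient \<open>G\<close> and trace \<open>g\<close>.\<close>

definition trace_triple ::
  "'a::euclidean_space set \<Rightarrow> ('a \<Rightarrow> real) \<Rightarrow> ('a \<Rightarrow> 'a) \<Rightarrow> ('a \<Rightarrow> real) \<Rightarrow> bool" where
  "trace_triple S v G g \<longleftrightarrow>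
     v \<in> L2_space (lebesgue_on S) \<and> G \<in> L2_space (lebesgue_on S) \<and> g \<in> L2_space (surface_measure S) \<and>
     has_weak_gradient S v G \<and> (\<forall>e>0. \<exists>w Dw. H1_trace_close S v G g e w Dw)"

lemma trace_tripleD:
  assumes "trace_triple S v G g"
  shows "v \<in> L2_space (lebesgue_on S)" "G \<in> L2_space (lebesgue_on S)" "g \<in> L2_space (surface_measure S)"
    "has_weak_gradient S v G"
  using assms by (auto simp: trace_triple_def)

lemma continuous_in_L2_surface:
  fixes w :: "'a::euclidean_space \<Rightarrow> real"
  assumes fin: "finite_measure (surface_measure S)" and w: "continuous_on (closure S) w" and "bounded S"
  shows "w \<in> L2_space (surface_measure S)"
proof -
  interpret finite_measure "surface_measure S" by (rule fin)
  have "compact (closure S)" using \<open>bounded S\<close> by simp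
  then have "bounded (w ` closure S)" using w compact_continuous_image compact_imp_bounded by blast
  then obtain B where B: "\<And>x. x \<in> closure S \<Longrightarrow> norm (w x) \<le> B" by (auto simp: bounded_iff)
  have sp: "space (surface_measure S) \<subseteq> closure S"
    by (auto simp: surface_measure_def space_restrict_space frontier_def)
  show ?thesis
  proof (rule L2_space_bound[OF L2_space_const[OF fin]])
    show "AE x in surface_measure S. norm (w x) \<le> 1 * norm B"
      using B sp by (intro AE_I2) (force intro: order_trans[OF _ abs_ge_self])
  qed (rule borel_measurable_surface_measure[OF w])
qed

lemma trace_triple_approx:
  assumes T: "trace_triple S v G g" and S: "bounded S" and fin: "finite_measure (surface_measure S)"
  obtains w Dw where "\<And>n. w n \<in> L2_space (lebesgue_on S)" "\<And>n. Dw n \<in> L2_space (lebesgue_on S)"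
    "\<And>n. has_weak_gradient S (w n) (Dw n)" "\<And>n. continuous_on (closure S) (w n)"
    "\<And>n. w n \<in> L2_space (surface_measure S)"
    "(\<lambda>n. L2_sq (lebesgue_on S) (\<lambda>x. w n x - v x)) \<longlonglongrightarrow> 0"
    "(\<lambda>n. L2_sq (lebesgue_on S) (\<lambda>x. Dw n x - G x)) \<longlonglongrightarrow> 0"
    "(\<lambda>n. L2_sq (surface_measure S) (\<lambda>x. w n x - g x)) \<longlonglongrightarrow> 0"
proof -
  have "\<exists>w Dw. H1_trace_close S v G g (1 / real (Suc n)) w Dw" for n
    using T by (simp add: trace_triple_def)
  then obtain w Dw where "\<And>n. H1_trace_close S v G g (1 / real (Suc n)) (w n) (Dw n)"
    by metis
  then have w: "\<And>n. w n \<in> L2_space (lebesgue_on S)" "\<And>n. Dw n \<in> L2_space (lebesgue_on S)"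
    "\<And>n. has_weak_gradient S (w n) (Dw n)" "\<And>n. continuous_on (closure S) (w n)"
    "\<And>n. L2_sq (lebesgue_on S) (\<lambda>x. w n x - v x) < 1 / real (Suc n)"
    "\<And>n. L2_sq (lebesgue_on S) (\<lambda>x. Dw n x - G x) < 1 / real (Suc n)"
    "\<And>n. L2_sq (surface_measure S) (\<lambda>x. w n x - g x) < 1 / real (Suc n)"
    by (auto simp: H1_trace_close_def)
  have inv0: "(\<lambda>n. 1 / real (Suc n)) \<longlonglongrightarrow> 0"
    using LIMSEQ_inverse_real_of_nat by (simp add: inverse_eq_divide)
  have lim: "X \<longlonglongrightarrow> 0" if "\<And>n. 0 \<le> X n" "\<And>n. X n < 1 / real (Suc n)" for X :: "nat \<Rightarrow> real"
    by (rule tendsto_sandwich[OF _ _ tendsto_const inv0])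
      (use that in \<open>auto intro!: always_eventually less_imp_le\<close>)
  show ?thesis
    by (rule that[OF w(1-4) continuous_in_L2_surface[OF fin w(4) S] lim[OF L2_sq_nonneg w(5)]
          lim[OF L2_sq_nonneg w(6)] lim[OF L2_sq_nonneg w(7)]])
qed

lemma trace_tripleI:
  assumes "v \<in> L2_space (lebesgue_on S)" "G \<in> L2_space (lebesgue_on S)" "g \<in> L2_space (surface_measure S)"
    "has_weak_gradient S v G"
    and w: "\<And>n. w n \<in> L2_space (lebesgue_on S)" "\<And>n. Dw n \<in> L2_space (lebesgue_on S)"
    "\<And>n. has_weak_gradient S (w n) (Dw n)" "\<And>n. continuous_on (closure S) (w n)"
    and lim: "(\<lambda>n. L2_sq (lebesgue_on S) (\<lambda>x. w n x - v x)) \<longlonglongrightarrow> 0"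
    "(\<lambda>n. L2_sq (lebesgue_on S) (\<lambda>x. Dw n x - G x)) \<longlonglongrightarrow> 0"
    "(\<lambda>n. L2_sq (surface_measure S) (\<lambda>x. w n x - g x)) \<longlonglongrightarrow> 0"
  shows "trace_triple S v G g"
  unfolding trace_triple_def
proof (intro conjI allI impI assms)
  fix e :: real assume "e > 0"
  have "\<forall>\<^sub>F n in sequentially. L2_sq (lebesgue_on S) (\<lambda>x. w n x - v x) < e \<and>
     L2_sq (lebesgue_on S) (\<lambda>x. Dw n x - G x) < e \<and> L2_sq (surface_measure S) (\<lambda>x. w n x - g x) < e"
    by (intro eventually_conj order_tendstoD(2)[OF lim(1)] order_tendstoD(2)[OF lim(2)]
       order_tendstoD(2)[OF lim(3)] \<open>e > 0\<close>)
  then obtain n where "L2_sq (lebesgue_on S) (\<lambda>x. w n x - v x) < e"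
     "L2_sq (lebesgue_on S) (\<lambda>x. Dw n x - G x) < e" "L2_sq (surface_measure S) (\<lambda>x. w n x - g x) < e"
    by (auto dest: eventually_happens)
  then show "\<exists>w Dw. H1_trace_close S v G g e w Dw"
    using w unfolding H1_trace_close_def by blast
qed

lemma has_trace_imp_trace_triple:
  fixes S :: "'a::euclidean_space set"
  assumes S: "open S" "bounded S" and fin: "finite_measure (surface_measure S)" and T: "has_trace S v g"
  obtains G where "trace_triple S v G g"
proof -
  have H1: "\<exists>G. has_weak_gradient S w G \<and> G \<in> L2_space (lebesgue_on S)" "w \<in> L2_space (lebesgue_on S)"
    if "w \<in> H1_space S" for w
    using that by (auto simp: H1_space_def)
  have v: "v \<in> H1_space S" "g \<in> L2_space (surface_measure S)"
    using T by (auto simp: has_trace_def)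
  obtain G where G: "has_weak_gradient S v G" "G \<in> L2_space (lebesgue_on S)" using H1(1)[OF v(1)] by blast
  obtain w where w: "\<And>m. w m \<in> H1_space S" "\<And>m. continuous_on (closure S) (w m)"
    "(\<lambda>m. H1_sqnorm S (\<lambda>x. w m x - v x)) \<longlonglongrightarrow> 0"
    "(\<lambda>m. \<integral>\<^sup>+ x. ennreal ((w m x - g x)\<^sup>2) \<partial>surface_measure S) \<longlonglongrightarrow> 0"
    using T by (auto simp: has_trace_def)
  obtain Dw where Dw: "\<And>m. has_weak_gradient S (w m) (Dw m)" "\<And>m. Dw m \<in> L2_space (lebesgue_on S)"
    using H1(1)[OF w(1)] by metis
  have wL: "w m \<in> L2_space (surface_measure S)" for m
    by (rule continuous_in_L2_surface[OF fin w(2) S(2)])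
  have wg: "has_weak_gradient S (\<lambda>x. w m x - v x) (\<lambda>x. Dw m x - G x)" for m
    using has_weak_gradient_add[OF S(1) Dw(1) has_weak_gradient_scale[OF S(1) G(1), of "-1"]] by simp
  have d: "(\<lambda>x. w m x - v x) \<in> L2_space (lebesgue_on S)" "(\<lambda>x. Dw m x - G x) \<in> L2_space (lebesgue_on S)" for m
    by (intro L2_space_diff H1(2) w v Dw G)+
  have "(\<lambda>m. ennreal (L2_sq (lebesgue_on S) (\<lambda>x. w m x - v x) + L2_sq (lebesgue_on S) (\<lambda>x. Dw m x - G x))) \<longlonglongrightarrow> ennreal 0"
    using w(3) by (simp add: H1_sqnorm_eq[OF S(1) wg d])
  then have sum: "(\<lambda>m. L2_sq (lebesgue_on S) (\<lambda>x. w m x - v x) + L2_sq (lebesgue_on S) (\<lambda>x. Dw m x - G x)) \<longlonglongrightarrow> 0"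
    by (subst (asm) tendsto_ennreal_iff) auto
  have l: "(\<lambda>m. L2_sq (lebesgue_on S) (\<lambda>x. w m x - v x)) \<longlonglongrightarrow> 0" "(\<lambda>m. L2_sq (lebesgue_on S) (\<lambda>x. Dw m x - G x)) \<longlonglongrightarrow> 0"
    by (rule tendsto_sandwich[OF _ _ tendsto_const sum]; simp)+
  have "(\<lambda>m. ennreal (L2_sq (surface_measure S) (\<lambda>x. w m x - g x))) \<longlonglongrightarrow> ennreal 0"
    using w(4) nn_integral_L2_sq[OF L2_space_diff[OF wL v(2)]] by simp
  then have l3: "(\<lambda>m. L2_sq (surface_measure S) (\<lambda>x. w m x - g x)) \<longlonglongrightarrow> 0"
    by (subst (asm) tendsto_ennreal_iff) auto
  show ?thesis
    by (rule that, rule trace_tripleI[OF H1(2)[OF v(1)] G(2) v(2) G(1) H1(2)[OF w(1)] Dw(2,1) w(2) l l3])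
qed

lemma trace_triple_imp_has_trace:
  fixes S :: "'a::euclidean_space set"
  assumes S: "open S" "bounded S" and fin: "finite_measure (surface_measure S)" and T: "trace_triple S v G g"
  shows "v \<in> H1_space S" "has_trace S v g"
proof -
  note v = trace_tripleD[OF T]
  obtain w Dw where w: "\<And>n. w n \<in> L2_space (lebesgue_on S)" "\<And>n. Dw n \<in> L2_space (lebesgue_on S)"
    "\<And>n. has_weak_gradient S (w n) (Dw n)" "\<And>n. continuous_on (closure S) (w n)"
    "\<And>n. w n \<in> L2_space (surface_measure S)"
    and lim: "(\<lambda>n. L2_sq (lebesgue_on S) (\<lambda>x. w n x - v x)) \<longlonglongrightarrow> 0"
    "(\<lambda>n. L2_sq (lebesgue_on S) (\<lambda>x. Dw n x - G x)) \<longlonglongrightarrow> 0"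
    "(\<lambda>n. L2_sq (surface_measure S) (\<lambda>x. w n x - g x)) \<longlonglongrightarrow> 0"
    by (rule trace_triple_approx[OF T S(2) fin]) (rule that)
  have H1: "f \<in> H1_space S" if "f \<in> L2_space (lebesgue_on S)" "has_weak_gradient S f F" "F \<in> L2_space (lebesgue_on S)" for f F
    using that by (auto simp: H1_space_def)
  show vH: "v \<in> H1_space S" by (rule H1[OF v(1,4,2)])
  have wg: "has_weak_gradient S (\<lambda>x. w m x - v x) (\<lambda>x. Dw m x - G x)" for m
    using has_weak_gradient_add[OF S(1) w(3) has_weak_gradient_scale[OF S(1) v(4), of "-1"]] by simp
  have d: "(\<lambda>x. w m x - v x) \<in> L2_space (lebesgue_on S)" "(\<lambda>x. Dw m x - G x) \<in> L2_space (lebesgue_on S)" for m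
    by (intro L2_space_diff w v)+
  have "(\<lambda>m. H1_sqnorm S (\<lambda>x. w m x - v x)) \<longlonglongrightarrow> ennreal (0 + 0)"
    unfolding H1_sqnorm_eq[OF S(1) wg d] by (intro tendsto_ennrealI tendsto_add lim)
  moreover have "(\<lambda>m. \<integral>\<^sup>+ x. ennreal ((w m x - g x)\<^sup>2) \<partial>surface_measure S) \<longlonglongrightarrow> ennreal 0"
    using tendsto_ennrealI[OF lim(3)] nn_integral_L2_sq[OF L2_space_diff[OF w(5) v(3)]] by simp
  ultimately show "has_trace S v g"
    unfolding has_trace_def using vH v(3) H1[OF w(1,3,2)] w(4) by auto
qed

lemma trace_triple_const:
  assumes S: "open S" "bounded S" and fin: "finite_measure (surface_measure S)"
  shows "trace_triple S (\<lambda>_. c) (\<lambda>_. 0) (\<lambda>_. c)"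
  by (rule trace_tripleI[where w="\<lambda>_ _. c" and Dw="\<lambda>_ _. 0"])
    (intro L2_space_const finite_measure_lebesgue_on_bounded S fin has_weak_gradient_const continuous_on_const | simp)+

lemma trace_triple_midpoint:
  fixes S :: "'a::euclidean_space set"
  assumes S: "open S" "bounded S" and fin: "finite_measure (surface_measure S)"
    and T: "trace_triple S v G g" and T': "trace_triple S v' G' g'"
  shows "trace_triple S (\<lambda>x. (1/2) *\<^sub>R (v x + v' x)) (\<lambda>x. (1/2) *\<^sub>R (G x + G' x)) (\<lambda>x. (1/2) *\<^sub>R (g x + g' x))"
proof -
  note v = trace_tripleD[OF T] and v' = trace_tripleD[OF T']
  obtain w Dw where w: "\<And>n. w n \<in> L2_space (lebesgue_on S)" "\<And>n. Dw n \<in> L2_space (lebesgue_on S)"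
    "\<And>n. has_weak_gradient S (w n) (Dw n)" "\<And>n. continuous_on (closure S) (w n)"
    "\<And>n. w n \<in> L2_space (surface_measure S)"
    and lim: "(\<lambda>n. L2_sq (lebesgue_on S) (\<lambda>x. w n x - v x)) \<longlonglongrightarrow> 0"
    "(\<lambda>n. L2_sq (lebesgue_on S) (\<lambda>x. Dw n x - G x)) \<longlonglongrightarrow> 0"
    "(\<lambda>n. L2_sq (surface_measure S) (\<lambda>x. w n x - g x)) \<longlonglongrightarrow> 0"
    by (rule trace_triple_approx[OF T S(2) fin]) (rule that)
  obtain w' Dw' where w': "\<And>n. w' n \<in> L2_space (lebesgue_on S)" "\<And>n. Dw' n \<in> L2_space (lebesgue_on S)"
    "\<And>n. has_weak_gradient S (w' n) (Dw' n)" "\<And>n. continuous_on (closure S) (w' n)"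
    "\<And>n. w' n \<in> L2_space (surface_measure S)"
    and lim': "(\<lambda>n. L2_sq (lebesgue_on S) (\<lambda>x. w' n x - v' x)) \<longlonglongrightarrow> 0"
    "(\<lambda>n. L2_sq (lebesgue_on S) (\<lambda>x. Dw' n x - G' x)) \<longlonglongrightarrow> 0"
    "(\<lambda>n. L2_sq (surface_measure S) (\<lambda>x. w' n x - g' x)) \<longlonglongrightarrow> 0"
    by (rule trace_triple_approx[OF T' S(2) fin]) (rule that)
  have mid_lim: "(\<lambda>n. L2_sq M (\<lambda>x. (1/2) *\<^sub>R (a n x + a' n x) - (1/2) *\<^sub>R (b x + b' x))) \<longlonglongrightarrow> 0"
    if a: "\<And>n. a n \<in> L2_space M" "b \<in> L2_space M" "\<And>n. a' n \<in> L2_space M" "b' \<in> L2_space M"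
      and l: "(\<lambda>n. L2_sq M (\<lambda>x. a n x - b x)) \<longlonglongrightarrow> 0" "(\<lambda>n. L2_sq M (\<lambda>x. a' n x - b' x)) \<longlonglongrightarrow> 0"
    for M :: "'a measure" and a a' :: "nat \<Rightarrow> 'a \<Rightarrow> 'c::euclidean_space" and b b'
  proof (rule tendsto_sandwich[OF _ _ tendsto_const])
    show "(\<lambda>n. 2 * L2_sq M (\<lambda>x. a n x - b x) + 2 * L2_sq M (\<lambda>x. a' n x - b' x)) \<longlonglongrightarrow> 0"
      using tendsto_add[OF tendsto_mult[OF tendsto_const[of 2] l(1)] tendsto_mult[OF tendsto_const[of 2] l(2)]] by simp
    show "\<forall>\<^sub>F n in sequentially. L2_sq M (\<lambda>x. (1/2) *\<^sub>R (a n x + a' n x) - (1/2) *\<^sub>R (b x + b' x)) \<le>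
       2 * L2_sq M (\<lambda>x. a n x - b x) + 2 * L2_sq M (\<lambda>x. a' n x - b' x)"
    proof (intro always_eventually allI)
      fix n
      have d: "(\<lambda>x. a n x - b x) \<in> L2_space M" "(\<lambda>x. a' n x - b' x) \<in> L2_space M"
        by (intro L2_space_diff a)+
      have eq: "(1/2) *\<^sub>R (a n x + a' n x) - (1/2) *\<^sub>R (b x + b' x) = (1/2) *\<^sub>R ((a n x - b x) + (a' n x - b' x))" for x
        by (simp add: algebra_simps)
      have "L2_sq M (\<lambda>x. (1/2) *\<^sub>R ((a n x - b x) + (a' n x - b' x))) \<le> L2_sq M (\<lambda>x. (a n x - b x) + (a' n x - b' x))"
        by (intro L2_sq_mono L2_space_scaleR L2_space_add d) simp
      also have "\<dots> \<le> 2 * L2_sq M (\<lambda>x. a n x - b x) + 2 * L2_sq M (\<lambda>x. a' n x - b' x)"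
        by (rule L2_sq_add_le[OF d])
      finally show "L2_sq M (\<lambda>x. (1/2) *\<^sub>R (a n x + a' n x) - (1/2) *\<^sub>R (b x + b' x)) \<le>
       2 * L2_sq M (\<lambda>x. a n x - b x) + 2 * L2_sq M (\<lambda>x. a' n x - b' x)"
        unfolding eq .
    qed
  qed simp
  have wg: "has_weak_gradient S (\<lambda>x. (1/2) *\<^sub>R (f x + f' x)) (\<lambda>x. (1/2) *\<^sub>R (F x + F' x))"
    if "has_weak_gradient S f F" "has_weak_gradient S f' F'" for f f' F F'
    using has_weak_gradient_scale[OF S(1) has_weak_gradient_add[OF S(1) that], of "1/2"] by simp
  show ?thesis
    by (rule trace_tripleI[where w="\<lambda>n x. (1/2) *\<^sub>R (w n x + w' n x)" and Dw="\<lambda>n x. (1/2) *\<^sub>R (Dw n x + Dw' n x)"])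
      (intro L2_space_scaleR L2_space_add v(1-3) v'(1-3) w(1,2) w'(1,2) wg[OF v(4) v'(4)] wg[OF w(3) w'(3)]
         continuous_on_scaleR continuous_on_const continuous_on_add w(4) w'(4)
         mid_lim[OF w(1) v(1) w'(1) v'(1) lim(1) lim'(1)] mid_lim[OF w(2) v(2) w'(2) v'(2) lim(2) lim'(2)]
         mid_lim[OF w(5) v(3) w'(5) v'(3) lim(3) lim'(3)])+
qed

lemma trace_triple_L2_limit:
  fixes S :: "'a::euclidean_space set"
  assumes S: "open S" "bounded S" and fin: "finite_measure (surface_measure S)"
    and T: "\<And>n. trace_triple S (v n) (G n) (g n)"
    and v0: "v0 \<in> L2_space (lebesgue_on S)" "G0 \<in> L2_space (lebesgue_on S)" "g0 \<in> L2_space (surface_measure S)"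
    and lim: "(\<lambda>n. L2_sq (lebesgue_on S) (\<lambda>x. v n x - v0 x)) \<longlonglongrightarrow> 0"
      "(\<lambda>n. L2_sq (lebesgue_on S) (\<lambda>x. G n x - G0 x)) \<longlonglongrightarrow> 0"
      "(\<lambda>n. L2_sq (surface_measure S) (\<lambda>x. g n x - g0 x)) \<longlonglongrightarrow> 0"
  shows "trace_triple S v0 G0 g0"
proof -
  note v = trace_tripleD[OF T]
  have wg: "has_weak_gradient S v0 G0"
    by (rule has_weak_gradient_L2_limit[OF S v(1) v0(1) v(2) v0(2) v(4) lim(1,2)])
  show ?thesis
    unfolding trace_triple_def
  proof (intro conjI allI impI v0 wg)
    fix e :: real assume "e > 0"
    have "\<forall>\<^sub>F n in sequentially. L2_sq (lebesgue_on S) (\<lambda>x. v n x - v0 x) < e/4 \<and>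
       L2_sq (lebesgue_on S) (\<lambda>x. G n x - G0 x) < e/4 \<and> L2_sq (surface_measure S) (\<lambda>x. g n x - g0 x) < e/4"
      using \<open>e > 0\<close> by (intro eventually_conj order_tendstoD(2)[OF lim(1)] order_tendstoD(2)[OF lim(2)]
         order_tendstoD(2)[OF lim(3)]) auto
    then obtain n where n: "L2_sq (lebesgue_on S) (\<lambda>x. v n x - v0 x) < e/4"
       "L2_sq (lebesgue_on S) (\<lambda>x. G n x - G0 x) < e/4" "L2_sq (surface_measure S) (\<lambda>x. g n x - g0 x) < e/4"
      by (auto dest: eventually_happens)
    \<comment> \<open>The factor 2 in \<open>L2_sq_triangle\<close> makes e/4 the right share for
      either of the two distances.\<close>
    obtain w Dw where "H1_trace_close S (v n) (G n) (g n) (e/4) w Dw"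
      using T[of n] \<open>e > 0\<close> unfolding trace_triple_def by (meson zero_less_divide_iff zero_less_numeral)
    then have w: "w \<in> L2_space (lebesgue_on S)" "Dw \<in> L2_space (lebesgue_on S)"
        "has_weak_gradient S w Dw" "continuous_on (closure S) w"
        "L2_sq (lebesgue_on S) (\<lambda>x. w x - v n x) < e/4" "L2_sq (lebesgue_on S) (\<lambda>x. Dw x - G n x) < e/4"
        "L2_sq (surface_measure S) (\<lambda>x. w x - g n x) < e/4"
      by (auto simp: H1_trace_close_def)
    have wS: "w \<in> L2_space (surface_measure S)" by (rule continuous_in_L2_surface[OF fin w(4) S(2)])
    have "L2_sq (lebesgue_on S) (\<lambda>x. w x - v0 x) < e" "L2_sq (lebesgue_on S) (\<lambda>x. Dw x - G0 x) < e"
        "L2_sq (surface_measure S) (\<lambda>x. w x - g0 x) < e"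
      using L2_sq_triangle[OF w(1) v(1)[of n] v0(1)] L2_sq_triangle[OF w(2) v(2)[of n] v0(2)]
        L2_sq_triangle[OF wS v(3)[of n] v0(3)] n w(5-7) by linarith+
    then show "\<exists>w Dw. H1_trace_close S v0 G0 g0 e w Dw"
      using w(1-4) unfolding H1_trace_close_def by blast
  qed
qed

section \<open>Truncation of fields and of their traces\<close>

lemma L2_space_max:
  fixes v :: "'a \<Rightarrow> real"
  assumes "finite_measure M" "v \<in> L2_space M"
  shows "(\<lambda>x. max a (v x)) \<in> L2_space M"
proof -
  have "(\<lambda>x. \<bar>a\<bar> + \<bar>v x\<bar>) \<in> L2_space M"
    using assms L2_spaceD(1)[OF assms(2)]
    by (intro L2_space_add L2_space_const L2_space_bound[OF assms(2), where c=1]) auto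
  then show ?thesis
    using L2_spaceD(1)[OF assms(2)] by (elim L2_space_bound[where c=1]) auto
qed

lemma L2_space_if:
  assumes "G \<in> L2_space M" "Measurable.pred M P"
  shows "(\<lambda>x. if P x then G x else 0) \<in> L2_space M"
  using assms L2_spaceD(1)[OF assms(1)]
  by (intro L2_space_bound[OF assms(1), where c=1] measurable_If) auto

lemma has_weak_gradient_max:
  fixes S :: "'a::euclidean_space set"
  assumes S: "open S" "bounded S" and v: "v \<in> L2_space (lebesgue_on S)" "G \<in> L2_space (lebesgue_on S)"
    and wg: "has_weak_gradient S v G"
  shows "has_weak_gradient S (\<lambda>x. max a (v x)) (\<lambda>x. if v x > a then G x else 0)"
    and "AE x in lebesgue_on S. v x = a \<longrightarrow> G x = 0"
proof -
  note fin = finite_measure_lebesgue_on_bounded[OF S]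
  have wg': "has_weak_gradient S (\<lambda>x. v x - a) G"
    using has_weak_gradient_add[OF S(1) wg has_weak_gradient_const[OF S, of "- a"]] by simp
  have int: "integrable (lebesgue_on S) (\<lambda>x. v x - a)" "integrable (lebesgue_on S) G"
    using L2_imp_integrable[OF fin] v L2_space_diff[OF v(1) L2_space_const[OF fin, of a]] by auto
  have "has_weak_gradient S (\<lambda>x. max 0 (v x - a) + a) (\<lambda>x. (if v x - a > 0 then G x else 0) + 0)"
    by (intro has_weak_gradient_add[OF S(1)] has_weak_gradient_pos_part[OF S(1) int wg'] has_weak_gradient_const[OF S])
  moreover have "max 0 (v x - a) + a = max a (v x)" for x by simp
  ultimately show "has_weak_gradient S (\<lambda>x. max a (v x)) (\<lambda>x. if v x > a then G x else 0)" by simp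
  show "AE x in lebesgue_on S. v x = a \<longrightarrow> G x = 0"
    using weak_gradient_zero_on_level_set[OF S(1) int wg'] by simp
qed

text \<open>The approximants are truncated as well, along a subsequence that converges almost
  everywhere. The gradients of max a (w n) and max a v differ by \<open>A n\<close>, the error of
  the gradients where w n > a, and by \<open>B n\<close>, where only the indicator changes.
  \<open>B n\<close> is bounded by \<open>G\<close> and tends to 0 wherever v \<noteq> a and w n
  converges, while \<open>G\<close> vanishes almost everywhere on v = a; so dominated convergence
  applies.\<close>

lemma trace_triple_max:
  fixes S :: "'a::euclidean_space set"
  assumes S: "open S" "bounded S" and fin: "finite_measure (surface_measure S)" and T: "trace_triple S v G g"
  shows "trace_triple S (\<lambda>x. max a (v x)) (\<lambda>x. if v x > a then G x else 0) (\<lambda>x. max a (g x))"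
proof -
  note v = trace_tripleD[OF T]
  note finS = finite_measure_lebesgue_on_bounded[OF S]
  let ?M = "lebesgue_on S"
  obtain w0 Dw0 where w0: "\<And>n. w0 n \<in> L2_space ?M" "\<And>n. Dw0 n \<in> L2_space ?M"
    "\<And>n. has_weak_gradient S (w0 n) (Dw0 n)" "\<And>n. continuous_on (closure S) (w0 n)"
    "\<And>n. w0 n \<in> L2_space (surface_measure S)"
    and lim0: "(\<lambda>n. L2_sq ?M (\<lambda>x. w0 n x - v x)) \<longlonglongrightarrow> 0"
    "(\<lambda>n. L2_sq ?M (\<lambda>x. Dw0 n x - G x)) \<longlonglongrightarrow> 0"
    "(\<lambda>n. L2_sq (surface_measure S) (\<lambda>x. w0 n x - g x)) \<longlonglongrightarrow> 0"
    by (rule trace_triple_approx[OF T S(2) fin]) (rule that)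
  obtain r where r: "strict_mono r" "AE x in ?M. (\<lambda>n. w0 (r n) x) \<longlonglongrightarrow> v x"
    by (rule L2_tendsto_AE_subseq[OF w0(1) v(1) lim0(1)]) (rule that)
  define w where "w n = w0 (r n)" for n
  define Dw where "Dw n = Dw0 (r n)" for n
  have w: "\<And>n. w n \<in> L2_space ?M" "\<And>n. Dw n \<in> L2_space ?M"
    "\<And>n. has_weak_gradient S (w n) (Dw n)" "\<And>n. continuous_on (closure S) (w n)"
    "\<And>n. w n \<in> L2_space (surface_measure S)"
    using w0 by (auto simp: w_def Dw_def)
  have lim: "(\<lambda>n. L2_sq ?M (\<lambda>x. w n x - v x)) \<longlonglongrightarrow> 0"
    "(\<lambda>n. L2_sq ?M (\<lambda>x. Dw n x - G x)) \<longlonglongrightarrow> 0"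
    "(\<lambda>n. L2_sq (surface_measure S) (\<lambda>x. w n x - g x)) \<longlonglongrightarrow> 0"
    using LIMSEQ_subseq_LIMSEQ[OF lim0(1) r(1)] LIMSEQ_subseq_LIMSEQ[OF lim0(2) r(1)]
      LIMSEQ_subseq_LIMSEQ[OF lim0(3) r(1)] by (auto simp: w_def Dw_def o_def)
  have AE: "AE x in ?M. (\<lambda>n. w n x) \<longlonglongrightarrow> v x" using r(2) by (simp add: w_def)
  have [measurable]: "v \<in> borel_measurable ?M" "w n \<in> borel_measurable ?M" for n
    using v(1) w(1) by (auto dest: L2_spaceD)
  have squeeze: "X \<longlonglongrightarrow> 0" if "Y \<longlonglongrightarrow> 0" "\<And>n. 0 \<le> X n" "\<And>n. X n \<le> Y n" for X Y :: "nat \<Rightarrow> real"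
    by (rule tendsto_sandwich[OF _ _ tendsto_const that(1)]) (use that in auto)
  define B where "B n x = (if w n x > a then G x else 0) - (if v x > a then G x else 0)" for n x
  have BL: "B n \<in> L2_space ?M" for n
    unfolding B_def by (intro L2_space_diff L2_space_if v(2)) measurable
  have B_lim: "(\<lambda>n. L2_sq ?M (B n)) \<longlonglongrightarrow> 0"
  proof -
    have "(\<lambda>n. LINT x|?M. (norm (B n x))\<^sup>2) \<longlonglongrightarrow> (LINT x|?M. 0)"
    proof (rule integral_dominated_convergence[where w="\<lambda>x. (norm (G x))\<^sup>2"])
      show "AE x in ?M. (\<lambda>n. (norm (B n x))\<^sup>2) \<longlonglongrightarrow> 0"
        using AE has_weak_gradient_max(2)[OF S v(1,2,4), of a]
      proof eventually_elim
        case (elim x)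
        have "\<forall>\<^sub>F n in sequentially. (norm (B n x))\<^sup>2 = 0"
        proof -
          consider "v x = a" | "v x < a" | "v x > a" by linarith
          then show ?thesis
          proof cases
            case 1 then show ?thesis using elim(2) by (simp add: B_def)
          next
            case 2 then show ?thesis
              by (intro eventually_mono[OF order_tendstoD(2)[OF elim(1) 2]]) (use 2 in \<open>simp add: B_def\<close>)
          next
            case 3 then show ?thesis
              by (intro eventually_mono[OF order_tendstoD(1)[OF elim(1) 3]]) (use 3 in \<open>simp add: B_def\<close>)
          qed
        qed
        then show ?case by (rule tendsto_eventually)
      qed
      show "AE x in ?M. norm ((norm (B n x))\<^sup>2) \<le> (norm (G x))\<^sup>2" for n
        by (auto simp: B_def)
    qed (use L2_spaceD[OF BL] L2_spaceD[OF v(2)] in auto)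
    then show ?thesis by (simp add: L2_sq_def)
  qed
  define A where "A n x = (if w n x > a then Dw n x - G x else 0)" for n x
  have AL: "A n \<in> L2_space ?M" for n
    unfolding A_def by (intro L2_space_if L2_space_diff w v) measurable
  have A_lim: "(\<lambda>n. L2_sq ?M (A n)) \<longlonglongrightarrow> 0"
    by (rule squeeze[OF lim(2)]) (auto intro!: L2_sq_mono AL L2_space_diff w v simp: A_def)
  have AB: "(if w n x > a then Dw n x else 0) - (if v x > a then G x else 0) = A n x + B n x" for n x
    by (simp add: A_def B_def)
  have max_le: "norm (max a s - max a t) \<le> norm (s - t)" for s t :: real
    by (auto simp: max_def)
  show ?thesis
  proof (rule trace_tripleI[where w="\<lambda>n x. max a (w n x)" and Dw="\<lambda>n x. if w n x > a then Dw n x else 0"])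
    show "(\<lambda>x. max a (v x)) \<in> L2_space ?M" "(\<lambda>x. max a (g x)) \<in> L2_space (surface_measure S)"
      "(\<lambda>x. max a (w n x)) \<in> L2_space ?M" for n
      by (intro L2_space_max finS fin v w)+
    show "(\<lambda>x. if v x > a then G x else 0) \<in> L2_space ?M" "(\<lambda>x. if w n x > a then Dw n x else 0) \<in> L2_space ?M" for n
      by (intro L2_space_if v w; measurable)+
    show "has_weak_gradient S (\<lambda>x. max a (v x)) (\<lambda>x. if v x > a then G x else 0)"
      "has_weak_gradient S (\<lambda>x. max a (w n x)) (\<lambda>x. if w n x > a then Dw n x else 0)" for n
      by (intro has_weak_gradient_max(1)[OF S] v w)+
    show "continuous_on (closure S) (\<lambda>x. max a (w n x))" for n
      by (intro continuous_intros w)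
    show "(\<lambda>n. L2_sq ?M (\<lambda>x. max a (w n x) - max a (v x))) \<longlonglongrightarrow> 0"
      by (rule squeeze[OF lim(1) L2_sq_nonneg])
        (intro L2_sq_mono L2_space_diff L2_space_max finS v w max_le)
    show "(\<lambda>n. L2_sq (surface_measure S) (\<lambda>x. max a (w n x) - max a (g x))) \<longlonglongrightarrow> 0"
      by (rule squeeze[OF lim(3) L2_sq_nonneg])
        (intro L2_sq_mono L2_space_diff L2_space_max fin v w max_le)
    show "(\<lambda>n. L2_sq ?M (\<lambda>x. (if w n x > a then Dw n x else 0) - (if v x > a then G x else 0))) \<longlonglongrightarrow> 0"
      unfolding AB
    proof (rule squeeze[OF _ L2_sq_nonneg L2_sq_add_le[OF AL BL]])
      show "(\<lambda>n. 2 * L2_sq ?M (A n) + 2 * L2_sq ?M (B n)) \<longlonglongrightarrow> 0"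
        using tendsto_add[OF tendsto_mult[OF tendsto_const[of 2] A_lim] tendsto_mult[OF tendsto_const[of 2] B_lim]] by simp
    qed
  qed
qed

lemma trace_triple_minus:
  fixes S :: "'a::euclidean_space set"
  assumes S: "open S" and T: "trace_triple S v G g"
  shows "trace_triple S (\<lambda>x. - v x) (\<lambda>x. - G x) (\<lambda>x. - g x)"
proof -
  have wg: "has_weak_gradient S (\<lambda>x. - f x) (\<lambda>x. - F x)" if "has_weak_gradient S f F" for f F
    using has_weak_gradient_scale[OF S that, of "-1"] by simp
  have sq: "L2_sq M (\<lambda>x. - f x - - h x) = L2_sq M (\<lambda>x. f x - h x)" for M :: "'a measure" and f h :: "'a \<Rightarrow> 'c::euclidean_space"
    by (simp add: L2_sq_def norm_minus_commute)
  show ?thesis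
    unfolding trace_triple_def
  proof (intro conjI allI impI L2_space_minus wg trace_tripleD[OF T])
    fix e :: real assume "e > 0"
    then obtain w Dw where "H1_trace_close S v G g e w Dw" using T by (auto simp: trace_triple_def)
    then have "H1_trace_close S (\<lambda>x. - v x) (\<lambda>x. - G x) (\<lambda>x. - g x) e (\<lambda>x. - w x) (\<lambda>x. - Dw x)"
      unfolding H1_trace_close_def sq by (auto intro: L2_space_minus wg continuous_on_minus)
    then show "\<exists>w Dw. H1_trace_close S (\<lambda>x. - v x) (\<lambda>x. - G x) (\<lambda>x. - g x) e w Dw" by blast
  qed
qed

text \<open>The minimum is obtained from the maximum by a change of sign. At each point
  \<open>G'\<close> is either \<open>G\<close> or 0, which gives the norm bound.\<close>

lemma trace_triple_clamp:
  fixes S :: "'a::euclidean_space set"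
  assumes S: "open S" "bounded S" and fin: "finite_measure (surface_measure S)" and T: "trace_triple S v G g"
  obtains G' where "trace_triple S (\<lambda>x. max a (min b (v x))) G' (\<lambda>x. max a (min b (g x)))"
    "\<And>x. norm (G' x) \<le> norm (G x)"
proof -
  have eq: "- max (- b) (- s) = min b s" for s :: real by (simp add: max_def min_def)
  have "trace_triple S (\<lambda>x. - max (- b) (- v x)) (\<lambda>x. - (if - v x > - b then - G x else 0)) (\<lambda>x. - max (- b) (- g x))"
    by (intro trace_triple_minus[OF S(1)] trace_triple_max[OF S fin] T)
  then have "trace_triple S (\<lambda>x. min b (v x)) (\<lambda>x. - (if - v x > - b then - G x else 0)) (\<lambda>x. min b (g x))"
    unfolding eq .
  from trace_triple_max[OF S fin this, of a] show ?thesis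
    by (rule that) auto
qed

section \<open>The saddle point of the Lagrangian\<close>

lemma coupling_matrix_form:
  fixes v :: "real ^ 2"
  shows "v \<bullet> (coupling_matrix ks *v v) = ks * (v $ 1 - v $ 2)\<^sup>2"
  by (simp add: coupling_matrix_def inner_vec_def matrix_vector_mult_def sum_2 power2_eq_square algebra_simps)

lemma norm_vec2_sq: "(norm (x :: 'c::real_inner ^ 2))\<^sup>2 = (norm (x $ 1))\<^sup>2 + (norm (x $ 2))\<^sup>2"
  by (simp add: power2_norm_eq_inner inner_vec_def sum_2)

lemma norm_prod_sq: "(norm (p :: 'c::real_inner \<times> 'd::real_inner))\<^sup>2 = (norm (fst p))\<^sup>2 + (norm (snd p))\<^sup>2"
  by (simp add: power2_norm_eq_inner inner_prod_def)

text \<open>Young's inequality. For small \<open>s\<close> it compares two squares with a factor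
  close to 1, at the cost of a large factor on the difference; through
  \<open>tendsto_if_weighted_le\<close> this yields continuity of quadratic functionals.\<close>

lemma norm_sq_weighted_le:
  fixes a b :: "'c::real_inner"
  assumes "s > 0"
  shows "(norm a)\<^sup>2 \<le> (1 + s) * (norm b)\<^sup>2 + (1 + 1/s) * (norm (a - b))\<^sup>2"
proof -
  have "(norm a)\<^sup>2 \<le> (norm b + norm (a - b))\<^sup>2"
    using norm_triangle_ineq[of b "a - b"] by (intro power_mono) auto
  also have "\<dots> = (norm b)\<^sup>2 + (norm (a - b))\<^sup>2 + 2 * norm b * norm (a - b)"
    by (simp add: power2_sum)
  also have "2 * norm b * norm (a - b) \<le> s * (norm b)\<^sup>2 + (1/s) * (norm (a - b))\<^sup>2"
  proof -
    have "0 \<le> (1/s) * (s * norm b - norm (a - b))\<^sup>2" using assms by simp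
    also have "\<dots> = s * (norm b)\<^sup>2 + (1/s) * (norm (a - b))\<^sup>2 - 2 * norm b * norm (a - b)"
      using assms by (simp add: power2_diff power2_eq_square field_simps)
    finally show ?thesis by simp
  qed
  finally show ?thesis by (simp add: algebra_simps)
qed

text \<open>For given \<open>e\<close>, first \<open>s\<close> is chosen to make the factor 1 + s
  harmless; then, with \<open>s\<close> fixed, \<open>n\<close> is taken large, since d n tends to
  0.\<close>

lemma tendsto_if_weighted_le:
  fixes X d :: "nat \<Rightarrow> real"
  assumes "d \<longlonglongrightarrow> 0" "0 \<le> x"
    and up: "\<And>s n. s > 0 \<Longrightarrow> X n \<le> (1 + s) * x + (1 + 1/s) * (K * d n)"
    and lo: "\<And>s n. s > 0 \<Longrightarrow> x \<le> (1 + s) * X n + (1 + 1/s) * (K * d n)"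
  shows "X \<longlonglongrightarrow> x"
proof (rule LIMSEQ_I)
  fix e :: real assume "e > 0"
  \<comment> \<open>Then s (x + 1) \<le> e/4; moreover s \<le> 1 keeps X n \<le> 2 (x + 1), so that
    the term s X n of the lower estimate is at most e/2.\<close>
  define s where "s = min 1 (e / (4 * (x + 1)))"
  have s: "0 < s" "s \<le> 1" using \<open>e > 0\<close> \<open>0 \<le> x\<close> by (auto simp: s_def)
  have sx: "s * (x + 1) \<le> e / 4"
  proof -
    have "s * (x + 1) \<le> e / (4 * (x + 1)) * (x + 1)"
      using \<open>0 \<le> x\<close> by (intro mult_right_mono) (auto simp: s_def)
    also have "\<dots> = e / 4"
      using \<open>0 \<le> x\<close> by (metis add_nonneg_pos less_irrefl mult.commute nonzero_mult_divide_mult_cancel_right times_divide_eq_left zero_less_one)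
    finally show ?thesis .
  qed
  have "(\<lambda>n. (1 + 1/s) * (K * d n)) \<longlonglongrightarrow> (1 + 1/s) * (K * 0)"
    by (intro tendsto_intros assms)
  then have "\<forall>\<^sub>F n in sequentially. (1 + 1/s) * (K * d n) < min 1 (e / 4)"
    using \<open>e > 0\<close> by (intro order_tendstoD(2)[where y=0]) simp_all
  then obtain N where N: "\<And>n. n \<ge> N \<Longrightarrow> (1 + 1/s) * (K * d n) < min 1 (e / 4)"
    by (auto simp: eventually_sequentially)
  have "norm (X n - x) < e" if "n \<ge> N" for n
  proof -
    define r where "r = (1 + 1/s) * (K * d n)"
    have r: "r < 1" "r < e / 4" using N[OF that] by (auto simp: r_def)
    have 1: "X n \<le> x + s * x + r" using up[OF s(1), of n] by (simp add: r_def algebra_simps)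
    have 2: "x \<le> X n + s * X n + r" using lo[OF s(1), of n] by (simp add: r_def algebra_simps)
    have "s * x \<le> e / 4" using sx s(1) by (simp add: algebra_simps)
    then have a: "X n - x < e" using 1 r \<open>e > 0\<close> by linarith
    have "s * x \<le> x" using s \<open>0 \<le> x\<close> by (simp add: mult_left_le_one_le)
    then have "X n \<le> 2 * (x + 1)" using 1 r by argo
    then have "s * X n \<le> s * (2 * (x + 1))" using s by (intro mult_left_mono) auto
    then have "s * X n \<le> e / 2" using sx by (simp add: algebra_simps)
    then have "x - X n < e" using 2 r \<open>e > 0\<close> by linarith
    with a show ?thesis by (simp add: abs_if)
  qed
  then show "\<exists>no. \<forall>n\<ge>no. norm (X n - x) < e" by blast
qed

lemma L2_sq_weighted_le:
  assumes "f \<in> L2_space M" "g \<in> L2_space M" "s > 0"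
  shows "L2_sq M f \<le> (1 + s) * L2_sq M g + (1 + 1/s) * L2_sq M (\<lambda>x. f x - g x)"
proof -
  note i = L2_spaceD(2)[OF assms(1)] L2_spaceD(2)[OF assms(2)] L2_spaceD(2)[OF L2_space_diff[OF assms(1,2)]]
  have "L2_sq M f \<le> (LINT x|M. (1 + s) * (norm (g x))\<^sup>2 + (1 + 1/s) * (norm (f x - g x))\<^sup>2)"
    unfolding L2_sq_def
    by (intro integral_mono norm_sq_weighted_le assms(3) Bochner_Integration.integrable_add integrable_mult_right i)
  also have "\<dots> = (1 + s) * L2_sq M g + (1 + 1/s) * L2_sq M (\<lambda>x. f x - g x)"
    unfolding L2_sq_def using i
    by (subst Bochner_Integration.integral_add) auto
  finally show ?thesis .
qed

lemma L2_sq_tendsto: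
  assumes "\<And>n. f n \<in> L2_space M" "g \<in> L2_space M" "(\<lambda>n. L2_sq M (\<lambda>x. f n x - g x)) \<longlonglongrightarrow> 0"
  shows "(\<lambda>n. L2_sq M (f n)) \<longlonglongrightarrow> L2_sq M g"
proof (rule tendsto_if_weighted_le[OF assms(3) L2_sq_nonneg, where K=1])
  fix s :: real and n assume "s > 0"
  then show "L2_sq M (f n) \<le> (1 + s) * L2_sq M g + (1 + 1/s) * (1 * L2_sq M (\<lambda>x. f n x - g x))"
    using L2_sq_weighted_le[OF assms(1)[of n] assms(2)] by simp
  show "L2_sq M g \<le> (1 + s) * L2_sq M (f n) + (1 + 1/s) * (1 * L2_sq M (\<lambda>x. f n x - g x))"
    using L2_sq_weighted_le[OF assms(2) assms(1)[of n] \<open>s > 0\<close>] L2_sq_minus_commute[of M g "f n"] by simp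
qed

lemma bounded_linear_axis: "bounded_linear (axis i :: 'c::real_normed_vector \<Rightarrow> 'c ^ 'n)"
proof (rule bounded_linear_intro[where K=1])
  show "norm (axis i x :: 'c ^ 'n) \<le> norm x * 1" for x
    by (simp add: norm_vec_def L2_set_def axis_def if_distrib[of norm] if_distrib[of "\<lambda>t. t\<^sup>2"] cong: if_cong)
qed (auto simp: vec_eq_iff axis_def)

lemma L2_space_vec2:
  fixes f :: "'a \<Rightarrow> 'c::euclidean_space ^ 2"
  assumes "\<And>i. (\<lambda>x. f x $ i) \<in> L2_space M"
  shows "f \<in> L2_space M"
proof -
  have "(\<lambda>x. axis (1::2) (f x $ 1) + axis (2::2) (f x $ 2)) \<in> L2_space M"
    by (intro L2_space_add L2_space_bounded_linear[OF bounded_linear_axis] assms)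
  moreover have "axis (1::2) (f x $ 1) + axis (2::2) (f x $ 2) = f x" for x
    by (simp add: vec_eq_iff axis_def forall_2)
  ultimately show ?thesis by simp
qed

lemma L2_space_Pair:
  assumes "f \<in> L2_space M" "g \<in> L2_space M"
  shows "(\<lambda>x. (f x, g x)) \<in> L2_space M"
proof -
  have "(\<lambda>x. (f x, 0) + (0, g x)) \<in> L2_space M"
    by (intro L2_space_add L2_space_bounded_linear[of "\<lambda>y. (y, 0)"] L2_space_bounded_linear[of "\<lambda>y. (0, y)"] assms
        bounded_linear_Pair bounded_linear_ident bounded_linear_zero)
  then show ?thesis by simp
qed

section \<open>The energy density and its inequalities\<close>

context
  fixes k :: "real ^ 2 ^ 2" and ks :: real
begin

text \<open>\<open>p\<close> is the pair of field and gradient at a point. The term with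
  \<open>lam\<close> is left out so that, for positive constants and 0 \<le> c \<le> 1, this is a
  non-negative combination of squares in \<open>p\<close>.\<close>

definition energy_density :: "real \<Rightarrow> (real ^ 2) \<times> ('c::euclidean_space ^ 2) \<Rightarrow> real" where
  "energy_density c p = 1/2 * (\<Sum>i\<in>UNIV. (k $ i $ 1 * c + k $ i $ 2 * (1 - c)) * (norm (snd p $ i))\<^sup>2)
     + 1/2 * c * (1 - c) * (ks * (fst p $ 1 - fst p $ 2)\<^sup>2)"

lemma energy_density_measurable:
  fixes z :: "'a \<Rightarrow> (real ^ 2) \<times> ('c::euclidean_space ^ 2)"
  assumes [measurable]: "chi \<in> borel_measurable M" and z: "z \<in> borel_measurable M"
  shows "(\<lambda>x. energy_density (chi x) (z x)) \<in> borel_measurable M"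
proof -
  have [measurable]: "(\<lambda>x. snd (z x) $ i) \<in> borel_measurable M" for i
    using borel_measurable_continuous_onI[of "\<lambda>p::(real ^ 2) \<times> ('c ^ 2). snd p $ i"] z
    by (rule measurable_compose_rev) (intro continuous_intros)
  have [measurable]: "(\<lambda>x. fst (z x) $ i) \<in> borel_measurable M" for i
    using borel_measurable_continuous_onI[of "\<lambda>p::(real ^ 2) \<times> ('c ^ 2). fst p $ i"] z
    by (rule measurable_compose_rev) (intro continuous_intros)
  show ?thesis unfolding energy_density_def by measurable
qed

text \<open>In \<open>c\<close> the gradient terms are affine and the coupling term is quadratic
  with leading coefficient -1/2 ks (v1 - v2)^2; the concavity defect is therefore computed
  exactly.\<close>

lemma energy_density_concave:
  assumes "0 \<le> t" "t \<le> 1" "ks \<ge> 0"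
  shows "(1 - t) * energy_density c p + t * energy_density c' p \<le> energy_density ((1 - t) * c + t * c') p"
proof -
  have "energy_density ((1 - t) * c + t * c') p - ((1 - t) * energy_density c p + t * energy_density c' p) =
      1/2 * (t * (1 - t) * (c - c')\<^sup>2) * (ks * (fst p $ 1 - fst p $ 2)\<^sup>2)"
    unfolding energy_density_def sum_2 by algebra
  also have "\<dots> \<ge> 0"
    using assms by (intro mult_nonneg_nonneg) auto
  finally show ?thesis by simp
qed

lemma energy_density_tendsto:
  assumes "f \<longlonglongrightarrow> c"
  shows "(\<lambda>n. energy_density (f n) p) \<longlonglongrightarrow> energy_density c p"
  unfolding energy_density_def by (intro tendsto_intros assms)

text \<open>For \<open>c\<close> in [0, 1] the density is a combination, with non-negative
  coefficients, of three squares: those of the two gradients and that of the difference of the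
  components. An inequality valid for each square passes to the density. Midpoint convexity, the
  weighted inequality and the effect of truncation all come from here.\<close>

lemma energy_density_quadratic_mono:
  assumes k: "\<And>i j. k $ i $ j > 0" and ks: "ks \<ge> 0" and c: "0 \<le> c" "c \<le> 1"
    and "\<And>i. (norm (snd p $ i))\<^sup>2 \<le> a * (norm (snd p1 $ i))\<^sup>2 + b * (norm (snd p2 $ i))\<^sup>2"
    and "(fst p $ 1 - fst p $ 2)\<^sup>2 \<le> a * (fst p1 $ 1 - fst p1 $ 2)\<^sup>2 + b * (fst p2 $ 1 - fst p2 $ 2)\<^sup>2"
  shows "energy_density c p \<le> a * energy_density c p1 + b * energy_density c p2"
proof -
  have kc: "k $ i $ 1 * c + k $ i $ 2 * (1 - c) \<ge> 0" for i
    using k c by (intro add_nonneg_nonneg mult_nonneg_nonneg) (auto intro: less_imp_le)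
  have "energy_density c p \<le> 1/2 * (\<Sum>i\<in>UNIV. (k $ i $ 1 * c + k $ i $ 2 * (1 - c)) * (a * (norm (snd p1 $ i))\<^sup>2 + b * (norm (snd p2 $ i))\<^sup>2))
     + 1/2 * c * (1 - c) * (ks * (a * (fst p1 $ 1 - fst p1 $ 2)\<^sup>2 + b * (fst p2 $ 1 - fst p2 $ 2)\<^sup>2))"
    unfolding energy_density_def
    by (intro add_mono mult_left_mono sum_mono assms(5,6) kc) (use c ks in auto)
  also have "\<dots> = a * energy_density c p1 + b * energy_density c p2"
    unfolding energy_density_def sum_2 by algebra
  finally show ?thesis .
qed

lemma energy_density_nonneg:
  assumes "\<And>i j. k $ i $ j > 0" "ks \<ge> 0" "0 \<le> c" "c \<le> 1"
  shows "0 \<le> energy_density c p"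
  unfolding energy_density_def using assms
  by (intro add_nonneg_nonneg mult_nonneg_nonneg sum_nonneg) (auto intro: less_imp_le)

lemma energy_density_midconvex:
  assumes "\<And>i j. k $ i $ j > 0" "ks \<ge> 0" "0 \<le> c" "c \<le> 1"
  shows "energy_density c ((1/2) *\<^sub>R (p1 + p2)) \<le> 1/2 * energy_density c p1 + 1/2 * energy_density c p2"
proof (rule energy_density_quadratic_mono[OF assms])
  have le: "(norm ((1/2) *\<^sub>R (a + b)))\<^sup>2 \<le> 1/2 * (norm a)\<^sup>2 + 1/2 * (norm b)\<^sup>2" for a b :: "'b::real_inner"
    using norm_add_sq_le[of a b] by (simp add: power_mult_distrib power_divide)
  show "(norm (snd ((1/2) *\<^sub>R (p1 + p2)) $ i))\<^sup>2 \<le> 1/2 * (norm (snd p1 $ i))\<^sup>2 + 1/2 * (norm (snd p2 $ i))\<^sup>2" for i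
    using le[of "snd p1 $ i" "snd p2 $ i"] by simp
  show "(fst ((1/2) *\<^sub>R (p1 + p2)) $ 1 - fst ((1/2) *\<^sub>R (p1 + p2)) $ 2)\<^sup>2 \<le>
     1/2 * (fst p1 $ 1 - fst p1 $ 2)\<^sup>2 + 1/2 * (fst p2 $ 1 - fst p2 $ 2)\<^sup>2"
    using le[of "fst p1 $ 1 - fst p1 $ 2" "fst p2 $ 1 - fst p2 $ 2"] by (simp add: algebra_simps)
qed

lemma energy_density_weighted_le:
  assumes "\<And>i j. k $ i $ j > 0" "ks \<ge> 0" "0 \<le> c" "c \<le> 1" "s > 0"
  shows "energy_density c p \<le> (1 + s) * energy_density c p' + (1 + 1/s) * energy_density c (p - p')"
proof (rule energy_density_quadratic_mono[OF assms(1-4)])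
  show "(norm (snd p $ i))\<^sup>2 \<le> (1 + s) * (norm (snd p' $ i))\<^sup>2 + (1 + 1/s) * (norm (snd (p - p') $ i))\<^sup>2" for i
    using norm_sq_weighted_le[OF assms(5), of "snd p $ i" "snd p' $ i"] by simp
  show "(fst p $ 1 - fst p $ 2)\<^sup>2 \<le> (1 + s) * (fst p' $ 1 - fst p' $ 2)\<^sup>2 + (1 + 1/s) * (fst (p - p') $ 1 - fst (p - p') $ 2)\<^sup>2"
    using norm_sq_weighted_le[OF assms(5), of "fst p $ 1 - fst p $ 2" "fst p' $ 1 - fst p' $ 2"]
    by (simp add: algebra_simps)
qed

definition kmax :: real where "kmax = (\<Sum>i\<in>UNIV. \<Sum>j\<in>UNIV. k $ i $ j) + ks"

lemma energy_density_upper: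
  fixes p :: "(real ^ 2) \<times> ('c::euclidean_space ^ 2)"
  assumes k: "\<And>i j. k $ i $ j > 0" and ks: "ks \<ge> 0" and c: "0 \<le> c" "c \<le> 1"
  shows "energy_density c p \<le> kmax * (norm p)\<^sup>2"
proof -
  define K where "K = (\<Sum>i\<in>UNIV. \<Sum>j\<in>UNIV. k $ i $ j)"
  have K: "K = k$1$1 + k$1$2 + k$2$1 + k$2$2" by (simp add: K_def sum_2)
  have half: "1/2 * a \<le> b" if "a \<le> b" "0 \<le> b" for a b :: real
    using that by simp
  have K0: "K \<ge> 0" using k by (simp add: K_def sum_nonneg less_imp_le)
  have kc: "k $ i $ 1 * c + k $ i $ 2 * (1 - c) \<le> K" for i
  proof -
    have "k $ i $ 1 * c \<le> k $ i $ 1" "k $ i $ 2 * (1 - c) \<le> k $ i $ 2"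
      using k c by (auto intro!: mult_left_le less_imp_le)
    moreover have "k $ i $ 1 + k $ i $ 2 \<le> K"
      using k[of 1 1] k[of 1 2] k[of 2 1] k[of 2 2] exhaust_2[of i] unfolding K by auto
    ultimately show ?thesis by linarith
  qed
  have "(\<Sum>i\<in>UNIV. (k $ i $ 1 * c + k $ i $ 2 * (1 - c)) * (norm (snd p $ i))\<^sup>2) \<le> (\<Sum>i\<in>UNIV. K * (norm (snd p $ i))\<^sup>2)"
    by (intro sum_mono mult_right_mono kc) auto
  also have "\<dots> = K * (norm (snd p))\<^sup>2" by (simp add: sum_2 norm_vec2_sq algebra_simps)
  finally have "(\<Sum>i\<in>UNIV. (k $ i $ 1 * c + k $ i $ 2 * (1 - c)) * (norm (snd p $ i))\<^sup>2) \<le> K * (norm (snd p))\<^sup>2" .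
  moreover have "0 \<le> K * (norm (snd p))\<^sup>2" using K0 by simp
  ultimately have 1: "1/2 * (\<Sum>i\<in>UNIV. (k $ i $ 1 * c + k $ i $ 2 * (1 - c)) * (norm (snd p $ i))\<^sup>2) \<le> K * (norm (snd p))\<^sup>2"
    by (rule half)
  have "c * (1 - c) \<le> 1 * 1" using c by (intro mult_mono) auto
  moreover have "(fst p $ 1 - fst p $ 2)\<^sup>2 \<le> 2 * (norm (fst p))\<^sup>2"
    using norm_add_sq_le[of "fst p $ 1" "- (fst p $ 2)"] by (simp add: norm_vec2_sq)
  ultimately have "(c * (1 - c)) * (ks * (fst p $ 1 - fst p $ 2)\<^sup>2) \<le> 1 * (ks * (2 * (norm (fst p))\<^sup>2))"
    using ks c by (intro mult_mono mult_left_mono) auto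
  then have 2: "1/2 * c * (1 - c) * (ks * (fst p $ 1 - fst p $ 2)\<^sup>2) \<le> ks * (norm (fst p))\<^sup>2"
    by (simp add: algebra_simps)
  have "energy_density c p \<le> K * (norm (snd p))\<^sup>2 + ks * (norm (fst p))\<^sup>2"
    unfolding energy_density_def using 1 2 by linarith
  also have "\<dots> \<le> (K + ks) * ((norm (fst p))\<^sup>2 + (norm (snd p))\<^sup>2)"
    using K0 ks by (simp add: algebra_simps)
  finally show ?thesis by (simp add: kmax_def K_def norm_prod_sq)
qed

definition kmin :: real where "kmin = Min {k $ 1 $ 1, k $ 1 $ 2, k $ 2 $ 1, k $ 2 $ 2}"

text \<open>Only the gradient is controlled: the coupling term vanishes at c = 0 and c = 1, so it is
  dropped. Bounds on the field itself come from the definition of \<open>states\<close>.\<close>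

lemma energy_density_lower:
  fixes p :: "(real ^ 2) \<times> ('c::euclidean_space ^ 2)"
  assumes ks: "ks \<ge> 0" and c: "0 \<le> c" "c \<le> 1"
  shows "kmin / 2 * (norm (snd p))\<^sup>2 \<le> energy_density c p"
proof -
  have kc: "kmin \<le> k $ i $ 1 * c + k $ i $ 2 * (1 - c)" for i
  proof -
    have "kmin \<le> k $ i $ 1" "kmin \<le> k $ i $ 2"
      unfolding kmin_def using exhaust_2[of i] by auto
    then have "kmin * c + kmin * (1 - c) \<le> k $ i $ 1 * c + k $ i $ 2 * (1 - c)"
      using c by (intro add_mono mult_right_mono) auto
    then show ?thesis by (simp add: algebra_simps)
  qed
  have "kmin * (norm (snd p))\<^sup>2 = (\<Sum>i\<in>UNIV. kmin * (norm (snd p $ i))\<^sup>2)"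
    by (simp add: sum_2 norm_vec2_sq algebra_simps)
  also have "\<dots> \<le> (\<Sum>i\<in>UNIV. (k $ i $ 1 * c + k $ i $ 2 * (1 - c)) * (norm (snd p $ i))\<^sup>2)"
    by (intro sum_mono mult_right_mono kc) auto
  finally have 1: "kmin * (norm (snd p))\<^sup>2 \<le> (\<Sum>i\<in>UNIV. (k $ i $ 1 * c + k $ i $ 2 * (1 - c)) * (norm (snd p $ i))\<^sup>2)" .
  have 2: "0 \<le> 1/2 * c * (1 - c) * (ks * (fst p $ 1 - fst p $ 2)\<^sup>2)" using ks c by simp
  show ?thesis unfolding energy_density_def using 1 2 by linarith
qed

lemma kmin_pos: "(\<And>i j. k $ i $ j > 0) \<Longrightarrow> kmin > 0"
  by (simp add: kmin_def)

end

section \<open>The game of states and designs\<close>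

locale design_problem =
  fixes S :: "'a::euclidean_space set" and \<Gamma> :: "2 \<Rightarrow> 'a set" and u :: "real ^ 2"
    and k :: "real ^ 2 ^ 2" and ks lam :: real
  assumes S: "open S" "bounded S" and fin_surface: "finite_measure (surface_measure S)"
    and k_pos: "\<And>i j. k $ i $ j > 0" and ks_nonneg: "ks \<ge> 0"
begin

abbreviation "M \<equiv> lebesgue_on S"
abbreviation "B \<equiv> surface_measure S"
abbreviation "X \<equiv> admissible_designs S"

definition lo :: real where "lo = min (u $ 1) (u $ 2)"
definition hi :: real where "hi = max (u $ 1) (u $ 2)"

lemma u_bounds: "lo \<le> u $ i" "u $ i \<le> hi"
  using exhaust_2[of i] by (auto simp: lo_def hi_def)

text \<open>A state \<open>(z, g)\<close> has \<open>z x = (v x, \<nabla>v x)\<close> and \<open>g\<close> the trace of \<open>v\<close>, both with values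
  between the smaller and the larger boundary value.\<close>

definition states :: "(('a \<Rightarrow> (real ^ 2) \<times> ('a ^ 2)) \<times> ('a \<Rightarrow> real ^ 2)) set" where
  "states = {(z, g). z \<in> L2_space M \<and> g \<in> L2_space B \<and>
     (\<forall>i. trace_triple S (\<lambda>x. fst (z x) $ i) (\<lambda>x. snd (z x) $ i) (\<lambda>x. g x $ i) \<and>
        (AE x in B. x \<in> \<Gamma> i \<longrightarrow> g x $ i = u $ i) \<and>
        (AE x in M. fst (z x) $ i \<in> {lo..hi}) \<and> (AE x in B. g x $ i \<in> {lo..hi}))}"

definition mid where
  "mid y y' = ((\<lambda>x. (1/2) *\<^sub>R (fst y x + fst y' x)), (\<lambda>x. (1/2) *\<^sub>R (snd y x + snd y' x)))"
  for y y' :: "('a \<Rightarrow> (real ^ 2) \<times> ('a ^ 2)) \<times> ('a \<Rightarrow> real ^ 2)"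

definition q where "q y = L2_sq M (fst y) + L2_sq B (snd y)"
  for y :: "('a \<Rightarrow> (real ^ 2) \<times> ('a ^ 2)) \<times> ('a \<Rightarrow> real ^ 2)"

definition D where "D y y' = L2_sq M (\<lambda>x. fst y x - fst y' x) + L2_sq B (\<lambda>x. snd y x - snd y' x)"
  for y y' :: "('a \<Rightarrow> (real ^ 2) \<times> ('a ^ 2)) \<times> ('a \<Rightarrow> real ^ 2)"

definition energy where
  "energy y chi = (LINT x|M. energy_density k ks (chi x) (fst y x) - lam * chi x)"
  for y :: "('a \<Rightarrow> (real ^ 2) \<times> ('a ^ 2)) \<times> ('a \<Rightarrow> real ^ 2)"

definition cv :: "real \<Rightarrow> ('a \<Rightarrow> real) \<Rightarrow> ('a \<Rightarrow> real) \<Rightarrow> 'a \<Rightarrow> real" where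
  "cv t chi xi x = (1 - t) * chi x + t * xi x"

lemma fin: "finite_measure M"
  by (rule finite_measure_lebesgue_on_bounded[OF S])

lemma statesD:
  assumes "y \<in> states"
  shows "fst y \<in> L2_space M" "snd y \<in> L2_space B"
    "trace_triple S (\<lambda>x. fst (fst y x) $ i) (\<lambda>x. snd (fst y x) $ i) (\<lambda>x. snd y x $ i)"
    "AE x in B. x \<in> \<Gamma> i \<longrightarrow> snd y x $ i = u $ i"
    "AE x in M. fst (fst y x) $ i \<in> {lo..hi}" "AE x in B. snd y x $ i \<in> {lo..hi}"
  using assms by (auto simp: states_def)

lemma XD:
  assumes "chi \<in> X"
  shows "chi \<in> L2_space M" "AE x in M. 0 \<le> chi x \<and> chi x \<le> 1" "chi \<in> borel_measurable M"
  using assms by (auto simp: admissible_designs_def L2_space_def)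

lemma XI:
  assumes "chi \<in> borel_measurable M" "AE x in M. 0 \<le> chi x \<and> chi x \<le> 1"
  shows "chi \<in> X"
proof -
  have "chi \<in> L2_space M"
    using assms by (intro L2_space_bound[OF L2_space_const[OF fin, of "1::real"], where c=1]) auto
  then show ?thesis using assms by (simp add: admissible_designs_def)
qed

lemma lin_states:
  shows "bounded_linear (\<lambda>p::(real ^ 2) \<times> ('a ^ 2). fst p $ i)" "bounded_linear (\<lambda>p::(real ^ 2) \<times> ('a ^ 2). snd p $ i)"
    "bounded_linear (\<lambda>p::real ^ 2. p $ i)"
  using bounded_linear_compose[OF bounded_linear_vec_nth bounded_linear_fst]
    bounded_linear_compose[OF bounded_linear_vec_nth bounded_linear_snd] bounded_linear_vec_nth by auto

lemma design_AEI:
  assumes "chi \<in> X" "\<And>x. 0 \<le> chi x \<Longrightarrow> chi x \<le> 1 \<Longrightarrow> P x"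
  shows "AE x in M. P x"
  using XD(2)[OF assms(1)] by eventually_elim (use assms(2) in auto)

lemma density_integrable:
  assumes "z \<in> L2_space M" "chi \<in> X"
  shows "integrable M (\<lambda>x. energy_density k ks (chi x) (z x))"
proof (rule Bochner_Integration.integrable_bound)
  show "integrable M (\<lambda>x. kmax k ks * (norm (z x))\<^sup>2)"
    using L2_spaceD(2)[OF assms(1)] by simp
  show "(\<lambda>x. energy_density k ks (chi x) (z x)) \<in> borel_measurable M"
    by (rule energy_density_measurable[OF XD(3)[OF assms(2)] L2_spaceD(1)[OF assms(1)]])
  show "AE x in M. norm (energy_density k ks (chi x) (z x)) \<le> norm (kmax k ks * (norm (z x))\<^sup>2)"
    using XD(2)[OF assms(2)]
  proof eventually_elim
    case (elim x)
    then show ?case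
      using energy_density_nonneg[OF k_pos ks_nonneg, of "chi x" "z x"] energy_density_upper[OF k_pos ks_nonneg, of "chi x" "z x"] by simp
  qed
qed

lemma design_integrable: "chi \<in> X \<Longrightarrow> integrable M chi"
  using L2_imp_integrable[OF fin XD(1)] .

lemma energy_eq:
  assumes "fst y \<in> L2_space M" "chi \<in> X"
  shows "energy y chi = (LINT x|M. energy_density k ks (chi x) (fst y x)) - lam * (LINT x|M. chi x)"
  unfolding energy_def using density_integrable[OF assms] design_integrable[OF assms(2)] by simp

lemma design_integral_bound:
  assumes "chi \<in> X"
  shows "\<bar>lam * (LINT x|M. chi x)\<bar> \<le> \<bar>lam\<bar> * measure M (space M)"
proof -
  interpret finite_measure M by (rule fin)
  have "0 \<le> (LINT x|M. chi x)"
    using XD(2)[OF assms] by (intro integral_nonneg_AE) auto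
  moreover have "(LINT x|M. chi x) \<le> (LINT x|M. 1)"
    using XD(2)[OF assms] design_integrable[OF assms] by (intro integral_mono_AE) auto
  ultimately show ?thesis by (simp add: abs_mult mult_left_mono)
qed

lemma density_integral_nonneg:
  assumes "chi \<in> X"
  shows "0 \<le> (LINT x|M. energy_density k ks (chi x) (z x))"
  by (intro integral_nonneg_AE design_AEI[OF assms] energy_density_nonneg[OF k_pos ks_nonneg])

lemma density_integral_upper:
  assumes "z \<in> L2_space M" "chi \<in> X"
  shows "(LINT x|M. energy_density k ks (chi x) (z x)) \<le> kmax k ks * L2_sq M z"
proof -
  have "(LINT x|M. energy_density k ks (chi x) (z x)) \<le> (LINT x|M. kmax k ks * (norm (z x))\<^sup>2)"
    by (intro integral_mono_AE density_integrable[OF assms] integrable_mult_right L2_spaceD(2)[OF assms(1)]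
        design_AEI[OF assms(2)] energy_density_upper[OF k_pos ks_nonneg])
  then show ?thesis by (simp add: L2_sq_def)
qed

lemma mid_in_states:
  assumes "y \<in> states" "y' \<in> states"
  shows "mid y y' \<in> states"
proof -
  have "trace_triple S (\<lambda>x. fst (fst (mid y y') x) $ i) (\<lambda>x. snd (fst (mid y y') x) $ i) (\<lambda>x. snd (mid y y') x $ i)" for i
    using trace_triple_midpoint[OF S fin_surface statesD(3)[OF assms(1), of i] statesD(3)[OF assms(2), of i]]
    by (simp add: mid_def)
  moreover have "AE x in B. x \<in> \<Gamma> i \<longrightarrow> snd (mid y y') x $ i = u $ i" for i
    using statesD(4)[OF assms(1), of i] statesD(4)[OF assms(2), of i] by eventually_elim (simp add: mid_def)
  moreover have "AE x in M. fst (fst (mid y y') x) $ i \<in> {lo..hi}" for i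
    using statesD(5)[OF assms(1), of i] statesD(5)[OF assms(2), of i] by eventually_elim (simp add: mid_def)
  moreover have "AE x in B. snd (mid y y') x $ i \<in> {lo..hi}" for i
    using statesD(6)[OF assms(1), of i] statesD(6)[OF assms(2), of i] by eventually_elim (simp add: mid_def)
  moreover have "fst (mid y y') \<in> L2_space M" "snd (mid y y') \<in> L2_space B"
    unfolding mid_def fst_conv snd_conv by (intro L2_space_scaleR L2_space_add statesD assms)+
  ultimately show ?thesis unfolding states_def by (simp add: case_prod_beta)
qed

text \<open>The relation between field, gradient and trace passes to the limit by
  \<open>trace_triple_L2_limit\<close>, the pointwise conditions along almost everywhere convergent
  subsequences, one for each of the two measures.\<close>

lemma states_closed:
  assumes y: "\<And>n. y n \<in> states" and z: "z \<in> L2_space M" "g \<in> L2_space B"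
    and lim: "(\<lambda>n. L2_sq M (\<lambda>x. fst (y n) x - z x)) \<longlonglongrightarrow> 0" "(\<lambda>n. L2_sq B (\<lambda>x. snd (y n) x - g x)) \<longlonglongrightarrow> 0"
  shows "(z, g) \<in> states"
proof -
  have comp: "(\<lambda>n. L2_sq N (\<lambda>x. h (f n x) - h (f0 x))) \<longlonglongrightarrow> 0"
    if "bounded_linear h" "\<And>p. norm (h p) \<le> norm p" "\<And>n. f n \<in> L2_space N" "f0 \<in> L2_space N"
      "(\<lambda>n. L2_sq N (\<lambda>x. f n x - f0 x)) \<longlonglongrightarrow> 0"
    for h :: "'b::euclidean_space \<Rightarrow> 'c::euclidean_space" and N :: "'a measure" and f f0
  proof (rule tendsto_sandwich[OF _ _ tendsto_const that(5)])
    interpret bounded_linear h by (rule that)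
    show "\<forall>\<^sub>F n in sequentially. L2_sq N (\<lambda>x. h (f n x) - h (f0 x)) \<le> L2_sq N (\<lambda>x. f n x - f0 x)"
    proof (intro always_eventually allI L2_sq_mono L2_space_diff L2_space_bounded_linear[OF that(1)] that(3,4))
      show "norm (h (f n x) - h (f0 x)) \<le> norm (f n x - f0 x)" for n x
        using that(2)[of "f n x - f0 x"] by (simp add: diff)
    qed
  qed simp
  have n1: "norm (fst p $ i) \<le> norm p" and n2: "norm (snd p $ i) \<le> norm p" for p :: "(real ^ 2) \<times> ('a ^ 2)" and i
    using Finite_Cartesian_Product.norm_nth_le[of "fst p" i] Finite_Cartesian_Product.norm_nth_le[of "snd p" i] norm_fst_le[of "fst p" "snd p"]
      norm_snd_le[of "snd p" "fst p"] by auto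
  have tt: "trace_triple S (\<lambda>x. fst (z x) $ i) (\<lambda>x. snd (z x) $ i) (\<lambda>x. g x $ i)" for i
    by (rule trace_triple_L2_limit[OF S fin_surface statesD(3)[OF y]
        L2_space_bounded_linear[OF lin_states(1) z(1)] L2_space_bounded_linear[OF lin_states(2) z(1)]
        L2_space_bounded_linear[OF lin_states(3) z(2)]
        comp[OF lin_states(1) n1 statesD(1)[OF y] z(1) lim(1)] comp[OF lin_states(2) n2 statesD(1)[OF y] z(1) lim(1)]
        comp[OF lin_states(3) Finite_Cartesian_Product.norm_nth_le statesD(2)[OF y] z(2) lim(2)]])
  obtain r where r: "strict_mono r" "AE x in M. (\<lambda>n. fst (y (r n)) x) \<longlonglongrightarrow> z x"
    by (rule L2_tendsto_AE_subseq[OF statesD(1)[OF y] z(1) lim(1)]) (rule that)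
  obtain r' where r': "strict_mono r'" "AE x in B. (\<lambda>n. snd (y (r' n)) x) \<longlonglongrightarrow> g x"
    by (rule L2_tendsto_AE_subseq[OF statesD(2)[OF y] z(2) lim(2)]) (rule that)
  have "AE x in M. fst (z x) $ i \<in> {lo..hi}" for i
  proof -
    have "AE x in M. \<forall>n. fst (fst (y (r n)) x) $ i \<in> {lo..hi}"
      unfolding AE_all_countable using statesD(5)[OF y] by blast
    with r(2) show ?thesis
    proof eventually_elim
      case (elim x)
      have "(\<lambda>n. fst (fst (y (r n)) x) $ i) \<longlonglongrightarrow> fst (z x) $ i"
        by (intro tendsto_intros elim)
      then show ?case
        using closed_sequentially[OF closed_atLeastAtMost, of "\<lambda>n. fst (fst (y (r n)) x) $ i"] elim(2) by blast
    qed
  qed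
  moreover have "AE x in B. g x $ i \<in> {lo..hi}" "AE x in B. x \<in> \<Gamma> i \<longrightarrow> g x $ i = u $ i" for i
  proof -
    have "AE x in B. \<forall>n. snd (y (r' n)) x $ i \<in> {lo..hi} \<and> (x \<in> \<Gamma> i \<longrightarrow> snd (y (r' n)) x $ i = u $ i)"
      unfolding AE_all_countable using statesD(4)[OF y] statesD(6)[OF y] by (auto intro: AE_conjI)
    with r'(2) have "AE x in B. g x $ i \<in> {lo..hi} \<and> (x \<in> \<Gamma> i \<longrightarrow> g x $ i = u $ i)"
    proof eventually_elim
      case (elim x)
      have l: "(\<lambda>n. snd (y (r' n)) x $ i) \<longlonglongrightarrow> g x $ i"
        by (intro tendsto_intros elim)
      then have "g x $ i \<in> {lo..hi}"
        using closed_sequentially[OF closed_atLeastAtMost, of "\<lambda>n. snd (y (r' n)) x $ i"] elim(2) by blast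
      moreover have "g x $ i = u $ i" if "x \<in> \<Gamma> i"
        using LIMSEQ_unique[OF l] elim(2) that by simp
      ultimately show ?case by blast
    qed
    then show "AE x in B. g x $ i \<in> {lo..hi}" "AE x in B. x \<in> \<Gamma> i \<longrightarrow> g x $ i = u $ i" by auto
  qed
  ultimately show ?thesis
    using z tt by (simp add: states_def)
qed

lemma states_complete:
  assumes y: "\<And>n. y n \<in> states"
    and Cauchy: "\<And>e. e > 0 \<Longrightarrow> \<exists>N. \<forall>m\<ge>N. \<forall>n\<ge>N. D (y m) (y n) < e"
  shows "\<exists>z\<in>states. (\<lambda>n. D (y n) z) \<longlonglongrightarrow> 0"
proof -
  obtain z where z: "z \<in> L2_space M" "(\<lambda>n. L2_sq M (\<lambda>x. fst (y n) x - z x)) \<longlonglongrightarrow> 0"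
  proof (rule L2_complete[of "\<lambda>n. fst (y n)" M])
    fix e :: real assume "e > 0"
    then obtain N where "\<forall>m\<ge>N. \<forall>n\<ge>N. D (y m) (y n) < e" using Cauchy by blast
    then show "\<exists>N. \<forall>m\<ge>N. \<forall>n\<ge>N. L2_sq M (\<lambda>x. fst (y m) x - fst (y n) x) < e"
      unfolding D_def by (meson L2_sq_nonneg le_add_same_cancel1 order_le_less_trans)
  qed (use statesD(1)[OF y] in auto)
  obtain g where g: "g \<in> L2_space B" "(\<lambda>n. L2_sq B (\<lambda>x. snd (y n) x - g x)) \<longlonglongrightarrow> 0"
  proof (rule L2_complete[of "\<lambda>n. snd (y n)" B])
    fix e :: real assume "e > 0"
    then obtain N where "\<forall>m\<ge>N. \<forall>n\<ge>N. D (y m) (y n) < e" using Cauchy by blast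
    then show "\<exists>N. \<forall>m\<ge>N. \<forall>n\<ge>N. L2_sq B (\<lambda>x. snd (y m) x - snd (y n) x) < e"
      unfolding D_def by (meson L2_sq_nonneg le_add_same_cancel2 order_le_less_trans)
  qed (use statesD(2)[OF y] in auto)
  have "(\<lambda>n. D (y n) (z, g)) \<longlonglongrightarrow> 0"
    using tendsto_add[OF z(2) g(2)] by (simp add: D_def)
  then show ?thesis using states_closed[OF y z(1) g(1) z(2) g(2)] by blast
qed

lemma D_tendstoD:
  assumes "(\<lambda>n. D (y n) z) \<longlonglongrightarrow> 0"
  shows "(\<lambda>n. L2_sq M (\<lambda>x. fst (y n) x - fst z x)) \<longlonglongrightarrow> 0" "(\<lambda>n. L2_sq B (\<lambda>x. snd (y n) x - snd z x)) \<longlonglongrightarrow> 0"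
  by (rule tendsto_sandwich[OF _ _ tendsto_const assms]; simp add: D_def)+

text \<open>For fixed \<open>chi\<close>, and up to the term with \<open>lam\<close>, the energy is
  a bounded quadratic functional of the state; the weighted inequality, used in both directions,
  gives continuity.\<close>

lemma energy_continuous:
  assumes y: "\<And>n. y n \<in> states" and z: "z \<in> states" and lim: "(\<lambda>n. D (y n) z) \<longlonglongrightarrow> 0" and chi: "chi \<in> X"
  shows "(\<lambda>n. energy (y n) chi) \<longlonglongrightarrow> energy z chi"
proof -
  let ?d = "\<lambda>n. L2_sq M (\<lambda>x. fst (y n) x - fst z x)"
  have le: "(LINT x|M. energy_density k ks (chi x) (f x)) \<le> (1 + s) * (LINT x|M. energy_density k ks (chi x) (h x)) +
      (1 + 1/s) * (kmax k ks * L2_sq M (\<lambda>x. f x - h x))"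
    if f: "f \<in> L2_space M" and h: "h \<in> L2_space M" and s: "s > 0" for f h s
  proof -
    note i = density_integrable[OF f chi] density_integrable[OF h chi] density_integrable[OF L2_space_diff[OF f h] chi]
    have "(LINT x|M. energy_density k ks (chi x) (f x)) \<le>
      (LINT x|M. (1 + s) * energy_density k ks (chi x) (h x) + (1 + 1/s) * energy_density k ks (chi x) (f x - h x))"
      by (intro integral_mono_AE Bochner_Integration.integrable_add integrable_mult_right i
          design_AEI[OF chi] energy_density_weighted_le[OF k_pos ks_nonneg _ _ s])
    also have "\<dots> = (1 + s) * (LINT x|M. energy_density k ks (chi x) (h x)) + (1 + 1/s) * (LINT x|M. energy_density k ks (chi x) (f x - h x))"
      using i by (subst Bochner_Integration.integral_add) auto
    also have "(1 + 1/s) * (LINT x|M. energy_density k ks (chi x) (f x - h x)) \<le> (1 + 1/s) * (kmax k ks * L2_sq M (\<lambda>x. f x - h x))"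
      using s by (intro mult_left_mono density_integral_upper L2_space_diff f h chi) auto
    finally show ?thesis by simp
  qed
  have "(\<lambda>n. LINT x|M. energy_density k ks (chi x) (fst (y n) x)) \<longlonglongrightarrow> (LINT x|M. energy_density k ks (chi x) (fst z x))"
  proof (rule tendsto_if_weighted_le[OF D_tendstoD(1)[OF lim] density_integral_nonneg[OF chi]])
    fix s :: real and n assume s: "s > 0"
    show "(LINT x|M. energy_density k ks (chi x) (fst (y n) x)) \<le> (1 + s) * (LINT x|M. energy_density k ks (chi x) (fst z x)) + (1 + 1/s) * (kmax k ks * ?d n)"
      by (rule le[OF statesD(1)[OF y] statesD(1)[OF z] s])
    show "(LINT x|M. energy_density k ks (chi x) (fst z x)) \<le> (1 + s) * (LINT x|M. energy_density k ks (chi x) (fst (y n) x)) + (1 + 1/s) * (kmax k ks * ?d n)"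
      using le[OF statesD(1)[OF z] statesD(1)[OF y[of n]] s] by (simp add: L2_sq_minus_commute)
  qed
  then have "(\<lambda>n. (LINT x|M. energy_density k ks (chi x) (fst (y n) x)) - lam * (LINT x|M. chi x)) \<longlonglongrightarrow>
     (LINT x|M. energy_density k ks (chi x) (fst z x)) - lam * (LINT x|M. chi x)"
    by (intro tendsto_intros)
  then show ?thesis by (simp add: energy_eq[OF statesD(1)[OF y] chi] energy_eq[OF statesD(1)[OF z] chi])
qed

lemma energy_coercive: "\<exists>C. \<forall>y\<in>states. \<forall>chi\<in>X. energy y chi \<le> b \<longrightarrow> q y \<le> C"
proof -
  interpret M: finite_measure M by (rule fin)
  interpret B: finite_measure B by (rule fin_surface)
  \<comment> \<open>The factor 2 counts the two components.\<close>
  define c where "c = 2 * (max \<bar>lo\<bar> \<bar>hi\<bar>)\<^sup>2"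
  have sq: "(norm p)\<^sup>2 \<le> c" if "\<And>i. p $ i \<in> {lo..hi}" for p :: "real ^ 2"
  proof -
    have "(norm (p $ i))\<^sup>2 \<le> (max \<bar>lo\<bar> \<bar>hi\<bar>)\<^sup>2" for i
      using that[of i] by (intro power_mono) auto
    from this[of 1] this[of 2] show ?thesis unfolding norm_vec2_sq c_def by linarith
  qed
  have kmin: "kmin k > 0" by (rule kmin_pos[OF k_pos])
  \<comment> \<open>The bound on the squared norm of the gradient when kmin / 2 times that norm is
    at most b plus |lam| times the measure of \<open>S\<close>.\<close>
  define E where "E = (2 / kmin k) * (b + \<bar>lam\<bar> * measure M (space M))"
  have "q y \<le> c * measure M (space M) + E + c * measure B (space B)"
    if y: "y \<in> states" and chi: "chi \<in> X" and b: "energy y chi \<le> b" for y chi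
  proof -
    have L: "(\<lambda>x. fst (fst y x)) \<in> L2_space M" "(\<lambda>x. snd (fst y x)) \<in> L2_space M"
      by (intro L2_space_bounded_linear[OF bounded_linear_fst] L2_space_bounded_linear[OF bounded_linear_snd] statesD(1)[OF y])+
    have "AE x in M. \<forall>i. fst (fst y x) $ i \<in> {lo..hi}"
      using statesD(5)[OF y, of 1] statesD(5)[OF y, of 2] unfolding forall_2 by (rule AE_conjI)
    then have 1: "L2_sq M (\<lambda>x. fst (fst y x)) \<le> (LINT x|M. c)"
      unfolding L2_sq_def using L2_spaceD(2)[OF L(1)] sq by (intro integral_mono_AE) auto
    have "AE x in B. \<forall>i. snd y x $ i \<in> {lo..hi}"
      using statesD(6)[OF y, of 1] statesD(6)[OF y, of 2] unfolding forall_2 by (rule AE_conjI)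
    then have 2: "L2_sq B (snd y) \<le> (LINT x|B. c)"
      unfolding L2_sq_def using L2_spaceD(2)[OF statesD(2)[OF y]] sq by (intro integral_mono_AE) auto
    have "kmin k / 2 * L2_sq M (\<lambda>x. snd (fst y x)) = (LINT x|M. kmin k / 2 * (norm (snd (fst y x)))\<^sup>2)"
      by (simp add: L2_sq_def)
    also have "\<dots> \<le> (LINT x|M. energy_density k ks (chi x) (fst y x))"
      by (intro integral_mono_AE integrable_mult_right density_integrable[OF statesD(1)[OF y] chi]
          L2_spaceD(2)[OF L(2)] design_AEI[OF chi] energy_density_lower[OF ks_nonneg])
    also have "\<dots> = energy y chi + lam * (LINT x|M. chi x)"
      using energy_eq[OF statesD(1)[OF y] chi] by simp
    also have "\<dots> \<le> b + \<bar>lam\<bar> * measure M (space M)"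
      using b design_integral_bound[OF chi] by linarith
    finally have 3: "L2_sq M (\<lambda>x. snd (fst y x)) \<le> E"
      using kmin by (simp add: E_def field_simps)
    have "L2_sq M (fst y) = L2_sq M (\<lambda>x. fst (fst y x)) + L2_sq M (\<lambda>x. snd (fst y x))"
      unfolding L2_sq_def norm_prod_sq using L2_spaceD(2)[OF L(1)] L2_spaceD(2)[OF L(2)]
      by (rule Bochner_Integration.integral_add)
    then show ?thesis using 1 2 3 by (simp add: q_def mult.commute)
  qed
  then show ?thesis by blast
qed

lemma energy_midconvex:
  assumes y: "y \<in> states" "y' \<in> states" and chi: "chi \<in> X"
  shows "energy (mid y y') chi \<le> (energy y chi + energy y' chi) / 2"
proof -
  note i = density_integrable[OF statesD(1)[OF y(1)] chi] density_integrable[OF statesD(1)[OF y(2)] chi]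
  note m = statesD(1)[OF mid_in_states[OF y]]
  have "(LINT x|M. energy_density k ks (chi x) (fst (mid y y') x)) \<le>
     (LINT x|M. 1/2 * energy_density k ks (chi x) (fst y x) + 1/2 * energy_density k ks (chi x) (fst y' x))"
    unfolding mid_def fst_conv
    by (intro integral_mono_AE Bochner_Integration.integrable_add integrable_mult_right i
        density_integrable[OF m[unfolded mid_def fst_conv] chi] design_AEI[OF chi]
        energy_density_midconvex[OF k_pos ks_nonneg])
  also have "\<dots> = 1/2 * (LINT x|M. energy_density k ks (chi x) (fst y x)) + 1/2 * (LINT x|M. energy_density k ks (chi x) (fst y' x))"
    using i by (subst Bochner_Integration.integral_add) auto
  finally show ?thesis
    unfolding energy_eq[OF m chi] energy_eq[OF statesD(1)[OF y(1)] chi] energy_eq[OF statesD(1)[OF y(2)] chi]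
    by (simp add: field_simps)
qed

lemma cv_in_X:
  assumes t: "0 \<le> t" "t \<le> 1" and chi: "chi \<in> X" "xi \<in> X"
  shows "cv t chi xi \<in> X"
proof (rule XI)
  have [measurable]: "chi \<in> borel_measurable M" "xi \<in> borel_measurable M" using XD(3) chi by auto
  show "cv t chi xi \<in> borel_measurable M" unfolding cv_def[abs_def] by measurable
  show "AE x in M. 0 \<le> cv t chi xi x \<and> cv t chi xi x \<le> 1"
    using XD(2)[OF chi(1)] XD(2)[OF chi(2)]
  proof eventually_elim
    case (elim x)
    then show ?case
      using t convex_bound_le[of "chi x" 1 "xi x" "1 - t" t] by (simp add: cv_def)
  qed
qed

lemma energy_concave:
  assumes t: "0 \<le> t" "t \<le> 1" and y: "y \<in> states" and chi: "chi \<in> X" "xi \<in> X"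
  shows "(1 - t) * energy y chi + t * energy y xi \<le> energy y (cv t chi xi)"
proof -
  note z = statesD(1)[OF y] and c = cv_in_X[OF t chi]
  note i = density_integrable[OF z chi(1)] density_integrable[OF z chi(2)]
  have "(1 - t) * (LINT x|M. energy_density k ks (chi x) (fst y x)) + t * (LINT x|M. energy_density k ks (xi x) (fst y x)) =
     (LINT x|M. (1 - t) * energy_density k ks (chi x) (fst y x) + t * energy_density k ks (xi x) (fst y x))"
    using i by (subst Bochner_Integration.integral_add) auto
  also have "\<dots> \<le> (LINT x|M. energy_density k ks (cv t chi xi x) (fst y x))"
    unfolding cv_def
    by (intro integral_mono Bochner_Integration.integrable_add integrable_mult_right i
        density_integrable[OF z c, unfolded cv_def] energy_density_concave[OF t ks_nonneg])
  finally have 1: "(1 - t) * (LINT x|M. energy_density k ks (chi x) (fst y x)) + t * (LINT x|M. energy_density k ks (xi x) (fst y x))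
     \<le> (LINT x|M. energy_density k ks (cv t chi xi x) (fst y x))" .
  have 2: "(LINT x|M. cv t chi xi x) = (1 - t) * (LINT x|M. chi x) + t * (LINT x|M. xi x)"
    unfolding cv_def using design_integrable[OF chi(1)] design_integrable[OF chi(2)]
    by (subst Bochner_Integration.integral_add) auto
  show ?thesis
    unfolding energy_eq[OF z chi(1)] energy_eq[OF z chi(2)] energy_eq[OF z c] 2
    using 1 by (simp add: algebra_simps)
qed

text \<open>Almost minimisers of the L^2 norm over the sets \<open>C n\<close> converge strongly. A
  subsequence converges almost everywhere, so the limit keeps values in [0, 1] and, for a fixed
  state, the energies converge by dominated convergence. Since the sets are nested and
  \<open>r n \<ge> n\<close>, reindexing by \<open>r\<close> stays inside them.\<close>

lemma designs_compact:
  assumes sub: "\<And>n. C n \<subseteq> X" and ne: "\<And>n. C n \<noteq> {}" and dec: "\<And>n. C (Suc n) \<subseteq> C n"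
    and conv: "\<And>n chi xi. chi \<in> C n \<Longrightarrow> xi \<in> C n \<Longrightarrow> cv (1/2) chi xi \<in> C n"
  shows "\<exists>y. \<exists>z\<in>X. (\<forall>n. y n \<in> C n) \<and> (\<forall>v\<in>states. (\<lambda>n. energy v (y n)) \<longlonglongrightarrow> energy v z)"
proof -
  interpret M: finite_measure M by (rule fin)
  have X: "chi \<in> X" if "chi \<in> C n" for chi n using sub that by blast
  obtain y where y: "\<And>n. y n \<in> C n"
    and Cauchy: "\<And>e. e > 0 \<Longrightarrow> \<exists>N. \<forall>m\<ge>N. \<forall>n\<ge>N. L2_sq M (\<lambda>x. y m x - y n x) < e"
  proof (rule nested_midconvex_Cauchy[where C=C and q="L2_sq M" and D="\<lambda>f g. L2_sq M (\<lambda>x. f x - g x)"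
        and mid="cv (1/2)" and M="measure M (space M)"])
    show "L2_sq M (\<lambda>x. chi x - xi x) = 2 * L2_sq M chi + 2 * L2_sq M xi - 4 * L2_sq M (cv (1/2) chi xi)"
      if "chi \<in> C 0" "xi \<in> C 0" for chi xi
    proof -
      have "cv (1/2) chi xi = (\<lambda>x. (1/2) *\<^sub>R (chi x + xi x))" by (auto simp: cv_def)
      then show ?thesis using L2_sq_parallelogram[OF XD(1)[OF X[OF that(1)]] XD(1)[OF X[OF that(2)]]] by simp
    qed
    show "L2_sq M chi \<le> measure M (space M)" if "chi \<in> C 0" for chi
    proof -
      have "L2_sq M chi \<le> (LINT x|M. 1)"
        unfolding L2_sq_def using L2_spaceD(2)[OF XD(1)[OF X[OF that]]] XD(2)[OF X[OF that]]
        by (intro integral_mono_AE) (auto simp: abs_square_le_1)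
      then show ?thesis by simp
    qed
  qed (use ne dec conv in auto)
  obtain z where z: "z \<in> L2_space M" "(\<lambda>n. L2_sq M (\<lambda>x. y n x - z x)) \<longlonglongrightarrow> 0"
  proof (rule L2_complete[of y M])
    show "y n \<in> L2_space M" for n by (rule XD(1)[OF X[OF y]])
    show "\<exists>N. \<forall>m\<ge>N. \<forall>n\<ge>N. L2_sq M (\<lambda>x. y m x - y n x) < e" if "e > 0" for e
      by (rule Cauchy[OF that])
  qed (rule that)
  obtain r where r: "strict_mono r" "AE x in M. (\<lambda>n. y (r n) x) \<longlonglongrightarrow> z x"
    by (rule L2_tendsto_AE_subseq[OF XD(1)[OF X[OF y]] z]) (rule that)
  have all: "AE x in M. \<forall>n. 0 \<le> y (r n) x \<and> y (r n) x \<le> 1"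
    unfolding AE_all_countable using XD(2)[OF X[OF y]] by blast
  have zX: "z \<in> X"
  proof (rule XI[OF L2_spaceD(1)[OF z(1)]])
    show "AE x in M. 0 \<le> z x \<and> z x \<le> 1"
      using r(2) all
    proof eventually_elim
      case (elim x)
      then show ?case using LIMSEQ_le_const[OF elim(1), of 0] LIMSEQ_le_const2[OF elim(1), of 1] by blast
    qed
  qed
  have "(\<lambda>n. energy v (y (r n))) \<longlonglongrightarrow> energy v z" if v: "v \<in> states" for v
    unfolding energy_def
  proof (rule integral_dominated_convergence[where w="\<lambda>x. kmax k ks * (norm (fst v x))\<^sup>2 + \<bar>lam\<bar>"])
    show "(\<lambda>x. energy_density k ks (z x) (fst v x) - lam * z x) \<in> borel_measurable M"
      using density_integrable[OF statesD(1)[OF v] zX] design_integrable[OF zX] by measurable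
    show "(\<lambda>x. energy_density k ks (y (r n) x) (fst v x) - lam * y (r n) x) \<in> borel_measurable M" for n
      using density_integrable[OF statesD(1)[OF v] X[OF y]] design_integrable[OF X[OF y]] by measurable
    show "integrable M (\<lambda>x. kmax k ks * (norm (fst v x))\<^sup>2 + \<bar>lam\<bar>)"
      using L2_spaceD(2)[OF statesD(1)[OF v]] by simp
    show "AE x in M. (\<lambda>n. energy_density k ks (y (r n) x) (fst v x) - lam * y (r n) x) \<longlonglongrightarrow> energy_density k ks (z x) (fst v x) - lam * z x"
      using r(2) by eventually_elim (intro tendsto_intros energy_density_tendsto)
    show "AE x in M. norm (energy_density k ks (y (r n) x) (fst v x) - lam * y (r n) x) \<le> kmax k ks * (norm (fst v x))\<^sup>2 + \<bar>lam\<bar>" for n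
      using all
    proof eventually_elim
      case (elim x)
      then have c: "0 \<le> y (r n) x" "y (r n) x \<le> 1" by auto
      have "\<bar>lam * y (r n) x\<bar> \<le> \<bar>lam\<bar>" using c by (simp add: abs_mult mult_left_le)
      then show ?case
        using energy_density_nonneg[OF k_pos ks_nonneg c, of "fst v x"] energy_density_upper[OF k_pos ks_nonneg c, of "fst v x"]
        unfolding real_norm_def by linarith
    qed
  qed
  moreover have "y (r n) \<in> C n" for n
    using lift_Suc_antimono_le[of C, OF dec seq_suble[OF r(1), of n]] y by blast
  ultimately show ?thesis using zX by (intro exI[of _ "\<lambda>n. y (r n)"] bexI[of _ z]) auto
qed

lemma states_nonempty: "states \<noteq> {}"
proof -
  have "trace_triple S (\<lambda>_. u $ i) (\<lambda>_. 0) (\<lambda>_. u $ i)" for i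
    by (rule trace_triple_const[OF S fin_surface])
  then have "((\<lambda>_. (u, 0)), (\<lambda>_. u)) \<in> states"
    unfolding states_def using u_bounds L2_space_const[OF fin, of "(u, 0::'a ^ 2)"] L2_space_const[OF fin_surface, of u] by simp
  then show ?thesis by blast
qed

lemma zero_in_X: "(\<lambda>_. 0) \<in> X"
  by (rule XI) auto

sublocale quadratic_game states mid q D X cv energy
proof
  show "D v w = 2 * q v + 2 * q w - 4 * q (mid v w)" if "v \<in> states" "w \<in> states" for v w
    using L2_sq_parallelogram[OF statesD(1)[OF that(1)] statesD(1)[OF that(2)]]
      L2_sq_parallelogram[OF statesD(2)[OF that(1)] statesD(2)[OF that(2)]]
    by (simp add: D_def q_def mid_def)
  show "D v z \<le> 2 * D v w + 2 * D w z" if "v \<in> states" "w \<in> states" "z \<in> states" for v w z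
    using L2_sq_triangle[OF statesD(1)[OF that(1)] statesD(1)[OF that(2)] statesD(1)[OF that(3)]]
      L2_sq_triangle[OF statesD(2)[OF that(1)] statesD(2)[OF that(2)] statesD(2)[OF that(3)]]
    by (simp add: D_def)
  show "(\<lambda>n. q (y n)) \<longlonglongrightarrow> q z" if "\<And>n. y n \<in> states" "z \<in> states" "(\<lambda>n. D (y n) z) \<longlonglongrightarrow> 0" for y z
    unfolding q_def
    by (intro tendsto_add L2_sq_tendsto[OF statesD(1)[OF that(1)] statesD(1)[OF that(2)] D_tendstoD(1)[OF that(3)]]
        L2_sq_tendsto[OF statesD(2)[OF that(1)] statesD(2)[OF that(2)] D_tendstoD(2)[OF that(3)]])
  show "\<exists>m. \<forall>v\<in>states. \<forall>chi\<in>X. m \<le> energy v chi"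
  proof (intro exI ballI)
    fix v chi assume "v \<in> states" "chi \<in> X"
    then show "- (\<bar>lam\<bar> * measure M (space M)) \<le> energy v chi"
      using energy_eq[OF statesD(1), of v chi] density_integral_nonneg[of chi "fst v"] design_integral_bound[of chi] by linarith
  qed
  show "\<exists>b. \<forall>chi\<in>X. energy v chi \<le> b" if "v \<in> states" for v
  proof (intro exI ballI)
    fix chi assume "chi \<in> X"
    then show "energy v chi \<le> kmax k ks * L2_sq M (fst v) + \<bar>lam\<bar> * measure M (space M)"
      using energy_eq[OF statesD(1)[OF that], of chi] density_integral_upper[OF statesD(1)[OF that], of chi]
        design_integral_bound[of chi] by linarith
  qed
qed (use states_nonempty zero_in_X mid_in_states states_complete energy_continuous energy_coercive energy_midconvex
      cv_in_X energy_concave designs_compact in \<open>auto simp: q_def D_def\<close>)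

end

text \<open>This serves for \<open>weak_gradient\<close>, a choice about which only local
  integrability is known: it is the pointwise limit of its restrictions to an exhaustion by compact
  sets.\<close>

lemma locally_integrable_imp_borel_measurable:
  fixes G :: "'a::euclidean_space \<Rightarrow> 'b::euclidean_space"
  assumes S: "open S" and G: "locally_integrable_on S G"
  shows "G \<in> borel_measurable (lebesgue_on S)"
proof -
  obtain C where C: "\<And>n. compact (C n)" "\<And>n. C n \<subseteq> S" "\<And>n. C n \<subseteq> interior (C (Suc n))"
    "\<Union>(range C) = S"
    by (rule open_Union_compact_subsets[OF S]) (rule that)
  have inc: "C m \<subseteq> C n" if "m \<le> n" for m n
    using that by (rule lift_Suc_mono_le[rotated]) (use C(3) interior_subset in blast)
  have "(\<lambda>x. indicator S x *\<^sub>R G x) \<in> borel_measurable lebesgue"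
  proof (rule borel_measurable_LIMSEQ_metric)
    show "(\<lambda>x. indicator (C n) x *\<^sub>R G x) \<in> borel_measurable lebesgue" for n
      by (rule borel_measurable_integrable)
        (use G C(1,2) in \<open>simp add: locally_integrable_on_def set_integrable_def\<close>)
    fix x
    show "(\<lambda>n. indicator (C n) x *\<^sub>R G x) \<longlonglongrightarrow> indicator S x *\<^sub>R G x"
    proof (cases "x \<in> S")
      case True
      then obtain m where "x \<in> C m" using C(4) by blast
      then have "\<forall>\<^sub>F n in sequentially. indicator (C n) x *\<^sub>R G x = indicator S x *\<^sub>R G x"
        using True inc by (intro eventually_sequentiallyI[of m]) (auto simp: indicator_def)
      then show ?thesis by (rule tendsto_eventually)
    next
      case False
      then have "x \<notin> C n" for n using C(2) by blast
      with False show ?thesis by simp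
    qed
  qed
  then show ?thesis
    using S by (subst borel_measurable_restrict_space_iff) auto
qed

section \<open>From states to fields and the Lagrangian\<close>

context design_problem
begin

text \<open>The gradient picked by \<open>weak_gradient\<close> is exchanged for the known one, with
  which it agrees almost everywhere; this frees the integrand from the choice operator.\<close>

lemma lagrangian_eq:
  assumes v: "v \<in> L2_space M" and wg: "\<And>i. has_weak_gradient S (\<lambda>x. v x $ i) (\<lambda>x. P x $ i)"
    and P: "P \<in> L2_space M" and chi: "chi \<in> X"
  shows "lagrangian S k ks lam v chi = (LINT x|M. energy_density k ks (chi x) (v x, P x) - lam * chi x)"
  unfolding lagrangian_def
proof (rule integral_cong_AE)
  have [measurable]: "chi \<in> borel_measurable M" by (rule XD(3)[OF chi])
  have [measurable]: "weak_gradient S (\<lambda>y. v y $ i) \<in> borel_measurable M" for i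
    by (rule locally_integrable_imp_borel_measurable[OF S(1)])
      (use weak_gradient_AE_eq(1)[OF S(1) wg[of i]] in \<open>simp add: has_weak_gradient_def\<close>)
  have [measurable]: "(\<lambda>x. v x $ i) \<in> borel_measurable M" for i
    using L2_spaceD(1)[OF L2_space_bounded_linear[OF bounded_linear_vec_nth v]] .
  show "(\<lambda>x. 1/2 * (\<Sum>i\<in>UNIV. conductivity k chi i x * (norm (weak_gradient S (\<lambda>y. v y $ i) x))\<^sup>2)
        + 1/2 * chi x * (1 - chi x) * (v x \<bullet> (coupling_matrix ks *v v x)) - lam * chi x) \<in> borel_measurable M"
    unfolding coupling_matrix_form conductivity_def by measurable
  show "(\<lambda>x. energy_density k ks (chi x) (v x, P x) - lam * chi x) \<in> borel_measurable M"
    using energy_density_measurable[OF XD(3)[OF chi] L2_spaceD(1)[OF L2_space_Pair[OF v P]]] by measurable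
  have "AE x in M. \<forall>i. weak_gradient S (\<lambda>y. v y $ i) x = P x $ i"
    using weak_gradient_AE_eq(2)[OF S(1) wg[of 1]] weak_gradient_AE_eq(2)[OF S(1) wg[of 2]]
    unfolding forall_2 by (rule AE_conjI)
  then show "AE x in M. 1/2 * (\<Sum>i\<in>UNIV. conductivity k chi i x * (norm (weak_gradient S (\<lambda>y. v y $ i) x))\<^sup>2)
        + 1/2 * chi x * (1 - chi x) * (v x \<bullet> (coupling_matrix ks *v v x)) - lam * chi x =
      energy_density k ks (chi x) (v x, P x) - lam * chi x"
    by eventually_elim (simp add: energy_density_def coupling_matrix_form conductivity_def)
qed

lemma state_field:
  assumes y: "y \<in> states"
  shows "(\<lambda>x. fst (fst y x)) \<in> admissible_fields S \<Gamma> u"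
    and "chi \<in> X \<Longrightarrow> lagrangian S k ks lam (\<lambda>x. fst (fst y x)) chi = energy y chi"
proof -
  note T = trace_triple_imp_has_trace[OF S fin_surface statesD(3)[OF y]]
  show "(\<lambda>x. fst (fst y x)) \<in> admissible_fields S \<Gamma> u"
    unfolding admissible_fields_def using T statesD(4)[OF y] by blast
  show "lagrangian S k ks lam (\<lambda>x. fst (fst y x)) chi = energy y chi" if "chi \<in> X"
    using lagrangian_eq[OF L2_space_bounded_linear[OF bounded_linear_fst statesD(1)[OF y]]
        trace_tripleD(4)[OF statesD(3)[OF y]] L2_space_bounded_linear[OF bounded_linear_snd statesD(1)[OF y]] that]
    by (simp add: energy_def)
qed

text \<open>Truncating a field at the extreme boundary values decreases the energy for every design;
  this replaces the inequalities of Poincare and of the trace theorem.\<close>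

lemma truncated_state:
  assumes v: "v \<in> admissible_fields S \<Gamma> u"
  obtains y where "y \<in> states" "\<And>chi. chi \<in> X \<Longrightarrow> energy y chi \<le> lagrangian S k ks lam v chi"
proof -
  define Q where "Q i g \<longleftrightarrow> has_trace S (\<lambda>x. v x $ i) g \<and> (AE x in B. x \<in> \<Gamma> i \<longrightarrow> g x = u $ i)" for i g
  have "\<exists>g. Q i g" for i
    using v by (auto simp: admissible_fields_def Q_def)
  then obtain g where "\<And>i. Q i (g i)" by metis
  then have g: "\<And>i. has_trace S (\<lambda>x. v x $ i) (g i)" "\<And>i. AE x in B. x \<in> \<Gamma> i \<longrightarrow> g i x = u $ i"
    by (auto simp: Q_def)
  have "\<exists>G. trace_triple S (\<lambda>x. v x $ i) G (g i)" for i
    using has_trace_imp_trace_triple[OF S fin_surface g(1)] by metis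
  then obtain G where G: "\<And>i. trace_triple S (\<lambda>x. v x $ i) (G i) (g i)" by metis
  \<comment> \<open>Both components are clamped to one common interval. It contains both prescribed
    values, so the boundary conditions survive; and as \<open>T\<close> does not increase distances,
    (v1 - v2)^2 does not grow.\<close>
  define T where "T t = max lo (min hi t)" for t
  have lohi: "lo \<le> hi" using u_bounds order_trans by blast
  have "\<exists>G'. trace_triple S (\<lambda>x. T (v x $ i)) G' (\<lambda>x. T (g i x)) \<and> (\<forall>x. norm (G' x) \<le> norm (G i x))" for i
    unfolding T_def by (rule trace_triple_clamp[OF S fin_surface G[of i], of lo hi]) blast
  then obtain G' where G': "\<And>i. trace_triple S (\<lambda>x. T (v x $ i)) (G' i) (\<lambda>x. T (g i x))"
    "\<And>i x. norm (G' i x) \<le> norm (G i x)"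
    by metis
  define y where "y = ((\<lambda>x. ((\<chi> i. T (v x $ i)), (\<chi> i. G' i x))), (\<lambda>x. (\<chi> i. T (g i x))))"
  have T_range: "T t \<in> {lo..hi}" for t using lohi by (auto simp: T_def)
  have T_u: "T (u $ i) = u $ i" for i using u_bounds[of i] by (simp add: T_def)
  have y: "y \<in> states"
  proof -
    have "fst y \<in> L2_space M" "snd y \<in> L2_space B"
      unfolding y_def fst_conv snd_conv
      by (intro L2_space_Pair L2_space_vec2; simp add: trace_tripleD[OF G'(1)])+
    moreover have "AE x in B. x \<in> \<Gamma> i \<longrightarrow> T (g i x) = u $ i" for i
      using g(2)[of i] by eventually_elim (simp add: T_u)
    ultimately show ?thesis
      using G'(1) T_range unfolding states_def by (simp add: y_def)
  qed
  have vL: "v \<in> L2_space M" by (rule L2_space_vec2) (rule trace_tripleD(1)[OF G])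
  have PL: "(\<lambda>x. \<chi> i. G i x) \<in> L2_space M" by (rule L2_space_vec2) (simp add: trace_tripleD(2)[OF G])
  have "energy y chi \<le> lagrangian S k ks lam v chi" if chi: "chi \<in> X" for chi
  proof -
    have "has_weak_gradient S (\<lambda>x. v x $ i) (\<lambda>x. (\<chi> i. G i x) $ i)" for i
      using trace_tripleD(4)[OF G[of i]] by simp
    from lagrangian_eq[OF vL this PL chi]
    have "lagrangian S k ks lam v chi = (LINT x|M. energy_density k ks (chi x) (v x, \<chi> i. G i x) - lam * chi x)" .
    also have "\<dots> = (LINT x|M. energy_density k ks (chi x) (v x, \<chi> i. G i x)) - lam * (LINT x|M. chi x)"
      using density_integrable[OF L2_space_Pair[OF vL PL] chi] design_integrable[OF chi] by simp
    also have "\<dots> \<ge> (LINT x|M. energy_density k ks (chi x) (fst y x)) - lam * (LINT x|M. chi x)"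
    proof (intro diff_right_mono integral_mono_AE density_integrable[OF statesD(1)[OF y] chi]
        density_integrable[OF L2_space_Pair[OF vL PL] chi] design_AEI[OF chi])
      fix x assume c: "0 \<le> chi x" "chi x \<le> 1"
      \<comment> \<open>The weights 1 and 0 reduce the two-term inequality to plain monotonicity in
        the squares.\<close>
      have "energy_density k ks (chi x) (fst y x) \<le> 1 * energy_density k ks (chi x) (v x, \<chi> i. G i x) +
          0 * energy_density k ks (chi x) (v x, \<chi> i. G i x)"
      proof (rule energy_density_quadratic_mono[OF k_pos ks_nonneg c])
        show "(norm (snd (fst y x) $ i))\<^sup>2 \<le> 1 * (norm (snd (v x, \<chi> i. G i x) $ i))\<^sup>2 + 0 * (norm (snd (v x, \<chi> i. G i x) $ i))\<^sup>2" for i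
          using power_mono[OF G'(2)[of i x], of 2] by (simp add: y_def)
        have "\<bar>T a - T b\<bar> \<le> \<bar>a - b\<bar>" for a b by (auto simp: T_def)
        then show "(fst (fst y x) $ 1 - fst (fst y x) $ 2)\<^sup>2 \<le>
            1 * (fst (v x, \<chi> i. G i x) $ 1 - fst (v x, \<chi> i. G i x) $ 2)\<^sup>2 +
            0 * (fst (v x, \<chi> i. G i x) $ 1 - fst (v x, \<chi> i. G i x) $ 2)\<^sup>2"
          by (simp add: y_def abs_le_square_iff[symmetric])
      qed
      then show "energy_density k ks (chi x) (fst y x) \<le> energy_density k ks (chi x) (v x, \<chi> i. G i x)" by simp
    qed
    finally show ?thesis by (simp add: energy_eq[OF statesD(1)[OF y] chi])
  qed
  then show ?thesis using y that by blast
qed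

text \<open>Minimality among the states extends to all admissible fields, because each of these has
  a truncated state of no larger energy for every design.\<close>

lemma lagrangian_saddle_point:
  "\<exists>v\<in>admissible_fields S \<Gamma> u. \<exists>chi\<in>X. (\<forall>xi\<in>X. lagrangian S k ks lam v xi \<le> lagrangian S k ks lam v chi) \<and>
     (\<forall>w\<in>admissible_fields S \<Gamma> u. lagrangian S k ks lam v chi \<le> lagrangian S k ks lam w chi)"
proof -
  obtain y chi where y: "y \<in> states" and chi: "chi \<in> X"
    and 1: "\<And>xi. xi \<in> X \<Longrightarrow> energy y xi \<le> energy y chi" and 2: "\<And>w. w \<in> states \<Longrightarrow> energy y chi \<le> energy w chi"
    using saddle_point by blast
  have "energy y chi \<le> lagrangian S k ks lam w chi" if "w \<in> admissible_fields S \<Gamma> u" for w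
  proof (rule truncated_state[OF that])
    fix z assume "z \<in> states" "\<And>chi. chi \<in> X \<Longrightarrow> energy z chi \<le> lagrangian S k ks lam w chi"
    then show "energy y chi \<le> lagrangian S k ks lam w chi" using 2 chi order_trans by blast
  qed
  then show ?thesis
    using state_field[OF y] chi 1 by (intro bexI[of _ "\<lambda>x. fst (fst y x)"] bexI[of _ chi]) auto
qed

end

text \<open>In the extended reals all suprema and infima exist, so boundedness of the payoffs need
  not be checked. The saddle value is at most the max-min value and at least the min-max value,
  while max-min never exceeds min-max.\<close>

lemma saddle_point_imp_minimax:
  fixes f :: "'a \<Rightarrow> 'b \<Rightarrow> real"
  assumes "v \<in> V" "x \<in> X" and max: "\<And>y. y \<in> X \<Longrightarrow> f v y \<le> f v x" and min: "\<And>w. w \<in> V \<Longrightarrow> f v x \<le> f w x"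
  shows "ereal (f v x) = (SUP y\<in>X. INF w\<in>V. ereal (f w y))"
    and "(SUP y\<in>X. INF w\<in>V. ereal (f w y)) = (INF w\<in>V. SUP y\<in>X. ereal (f w y))"
proof -
  have "ereal (f v x) \<le> (INF w\<in>V. ereal (f w x))"
    using min by (intro INF_greatest) simp
  also have "\<dots> \<le> (SUP y\<in>X. INF w\<in>V. ereal (f w y))"
    using \<open>x \<in> X\<close> by (rule SUP_upper)
  finally have 1: "ereal (f v x) \<le> (SUP y\<in>X. INF w\<in>V. ereal (f w y))" .
  have 2: "(SUP y\<in>X. INF w\<in>V. ereal (f w y)) \<le> (INF w\<in>V. SUP y\<in>X. ereal (f w y))"
    by (intro SUP_least INF_greatest) (meson INF_lower SUP_upper order_trans)
  have "(INF w\<in>V. SUP y\<in>X. ereal (f w y)) \<le> (SUP y\<in>X. ereal (f v y))"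
    using \<open>v \<in> V\<close> by (rule INF_lower)
  also have "\<dots> \<le> ereal (f v x)"
    using max by (intro SUP_least) simp
  finally have 3: "(INF w\<in>V. SUP y\<in>X. ereal (f w y)) \<le> ereal (f v x)" .
  from 1 2 3 show "ereal (f v x) = (SUP y\<in>X. INF w\<in>V. ereal (f w y))"
    "(SUP y\<in>X. INF w\<in>V. ereal (f w y)) = (INF w\<in>V. SUP y\<in>X. ereal (f w y))"
    by (auto intro: antisym order_trans)
qed

theorem theorem4p1:
  fixes \<Omega> :: "(real ^ 'n) set"
    and \<Gamma> :: "2 \<Rightarrow> (real ^ 'n) set" and \<Gamma>0 :: "(real ^ 'n) set"
    and u :: "real ^ 2" and k :: "real ^ 2 ^ 2" and ks lam :: real
  assumes "open \<Omega>" and "bounded \<Omega>" and "connected \<Omega>" and "lipschitz_boundary \<Omega>"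
    and "frontier \<Omega> = \<Gamma> 1 \<union> \<Gamma> 2 \<union> \<Gamma>0"
    and "\<And>i. \<Gamma> i \<in> sets (surface_measure \<Omega>)"
    and "\<And>i. emeasure (surface_measure \<Omega>) (\<Gamma> i) > 0"
    and "k $ 1 $ 1 > k $ 1 $ 2" and "k $ 1 $ 1 > k $ 2 $ 1"
    and "k $ 2 $ 2 > k $ 1 $ 2" and "k $ 2 $ 2 > k $ 2 $ 1"
    and "k $ 1 $ 2 > 0" and "k $ 2 $ 1 > 0"
    and "ks > 0"
  shows "\<exists>vbar \<in> admissible_fields \<Omega> \<Gamma> u. \<exists>chibar \<in> admissible_designs \<Omega>.
      ereal (lagrangian \<Omega> k ks lam vbar chibar)
        = (SUP chi\<in>admissible_designs \<Omega>. INF v\<in>admissible_fields \<Omega> \<Gamma> u.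
             ereal (lagrangian \<Omega> k ks lam v chi))
    \<and> (SUP chi\<in>admissible_designs \<Omega>. INF v\<in>admissible_fields \<Omega> \<Gamma> u.
             ereal (lagrangian \<Omega> k ks lam v chi))
        = (INF v\<in>admissible_fields \<Omega> \<Gamma> u. SUP chi\<in>admissible_designs \<Omega>.
             ereal (lagrangian \<Omega> k ks lam v chi))"
proof -
  interpret design_problem \<Omega> \<Gamma> u k ks lam
  proof (rule design_problem.intro)
    show "k $ i $ j > 0" for i j
      using assms(8-13) exhaust_2[of i] exhaust_2[of j] by fastforce
    show "finite_measure (surface_measure \<Omega>)"
      by (rule finite_measure_surface_measure[OF assms(1,2,4)])
    show "0 \<le> ks" using assms(14) by simp
    show "open \<Omega>" "bounded \<Omega>" by (rule assms)+
  qed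
  obtain v chi where v: "v \<in> admissible_fields \<Omega> \<Gamma> u" and chi: "chi \<in> admissible_designs \<Omega>"
    and "\<And>xi. xi \<in> admissible_designs \<Omega> \<Longrightarrow> lagrangian \<Omega> k ks lam v xi \<le> lagrangian \<Omega> k ks lam v chi"
    and "\<And>w. w \<in> admissible_fields \<Omega> \<Gamma> u \<Longrightarrow> lagrangian \<Omega> k ks lam v chi \<le> lagrangian \<Omega> k ks lam w chi"
    using lagrangian_saddle_point by blast
  from saddle_point_imp_minimax[of v _ chi _ "lagrangian \<Omega> k ks lam", OF this] show ?thesis
    using v chi by blast
qed

end
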